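(* There is an algorithm which, given a binary matroid $M$ accessed through an independence oracle, either correctly decides that $M$ is odd-$C_3^+$-free or finds an odd-$C_3^+$ of $M$, using polynomial time and a polynomial number of oracle calls.
   Context: Matroids are loopless. A matroid is binary if it is representable over the field with two elements. An independence oracle for $M$ answers, for any subset of the ground set, whether it is independent. Graphs are finite, may have parallel edges but no loops. A totally odd subdivision of a graph $H$ is obtained by replacing each edge $e$ of $H$ by a path with an odd number of edges joining the ends of $e$, such that paths corresponding to distinct edges share no inner vertices. $C_3^+$ is the graph obtained from the triangle $K_3$ by adding a single edge parallel to one of its edges. An odd-$C_3^+$ graph is a totally odd subdivision of $C_3^+$. An odd-$C_3^+$ of a matroid $M$ is a restriction of $M$ isomorphic to the circuit (cycle) matroid of an odd-$C_3^+$ graph; $M$ is odd-$C_3^+$-free if it has no odd-$C_3^+$. *)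

theory Defs
  imports "HOL-Library.Z2" "HOL-Computational_Algebra.Polynomial"
begin

section \<open>Matroids\<close>

record 'a pre_matroid =
  ground :: "'a set"
  indep :: "'a set \<Rightarrow> bool"

definition matroid :: "'a pre_matroid \<Rightarrow> bool" where
  "matroid M \<longleftrightarrow>
     finite (ground M) \<and>
     (\<forall>X. indep M X \<longrightarrow> X \<subseteq> ground M) \<and>
     indep M {} \<and>
     (\<forall>X Y. indep M X \<and> Y \<subseteq> X \<longrightarrow> indep M Y) \<and>
     (\<forall>X Y. indep M X \<and> indep M Y \<and> card X < card Y \<longrightarrow>
        (\<exists>y\<in>Y - X. indep M (insert y X)))"

definition loopless :: "'a pre_matroid \<Rightarrow> bool" where
  "loopless M \<longleftrightarrow> (\<forall>e\<in>ground M. indep M {e})"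

text \<open>
  Linear independence of the family of vectors \<open>(\<lambda>i\<in>{..<r}. A i e)\<close>, \<open>e \<in> X\<close>, that is, of the
  columns with index in \<open>X\<close> of a matrix \<open>A\<close> with \<open>r\<close> rows. The family may contain repeated vectors
  (it is then dependent), so this is not a property of the set of columns.
\<close>

definition columns_lin_indep :: "nat \<Rightarrow> (nat \<Rightarrow> 'a \<Rightarrow> 'k::field) \<Rightarrow> 'a set \<Rightarrow> bool" where
  "columns_lin_indep r A X \<longleftrightarrow>
     (\<forall>c :: 'a \<Rightarrow> 'k. (\<forall>i<r. (\<Sum>e\<in>X. c e * A i e) = 0) \<longrightarrow> (\<forall>e\<in>X. c e = 0))"

definition represents :: "nat \<Rightarrow> (nat \<Rightarrow> 'a \<Rightarrow> 'k::field) \<Rightarrow> 'a pre_matroid \<Rightarrow> bool" where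
  "represents r A M \<longleftrightarrow> (\<forall>X\<subseteq>ground M. indep M X \<longleftrightarrow> columns_lin_indep r A X)"

definition binary_matroid :: "'a pre_matroid \<Rightarrow> bool" where
  "binary_matroid M \<longleftrightarrow> matroid M \<and> (\<exists>r (A :: nat \<Rightarrow> 'a \<Rightarrow> bit). represents r A M)"

definition restriction :: "'a pre_matroid \<Rightarrow> 'a set \<Rightarrow> 'a pre_matroid" where
  "restriction M X = \<lparr>ground = X, indep = (\<lambda>Y. Y \<subseteq> X \<and> indep M Y)\<rparr>"

definition matroid_iso :: "'a pre_matroid \<Rightarrow> 'b pre_matroid \<Rightarrow> bool" where
  "matroid_iso M N \<longleftrightarrow>
     (\<exists>f. bij_betw f (ground M) (ground N) \<and>
          (\<forall>X\<subseteq>ground M. indep M X \<longleftrightarrow> indep N (f ` X)))"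


section \<open>Graphs with parallel edges and their cycle matroids\<close>

record ('v, 'e) pre_graph =
  verts :: "'v set"
  edges :: "'e set"
  ends :: "'e \<Rightarrow> 'v set"

definition multigraph :: "('v, 'e) pre_graph \<Rightarrow> bool" where
  "multigraph G \<longleftrightarrow> finite (verts G) \<and> finite (edges G) \<and>
     (\<forall>e\<in>edges G. ends G e \<subseteq> verts G \<and> card (ends G e) = 2)"

text \<open>
  A cycle is given by its cyclic sequences of vertices and edges; the edge \<open>es ! i\<close> joins \<open>vs ! i\<close> to
  its cyclic successor. Two parallel edges form a cycle of length 2.
\<close>

definition is_cycle :: "('v, 'e) pre_graph \<Rightarrow> 'v list \<Rightarrow> 'e list \<Rightarrow> bool" where
  "is_cycle G vs es \<longleftrightarrow>
     2 \<le> length es \<and> length vs = length es \<and> distinct vs \<and> distinct es \<and>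
     set vs \<subseteq> verts G \<and> set es \<subseteq> edges G \<and>
     (\<forall>i<length es. ends G (es ! i) = {vs ! i, vs ! (Suc i mod length es)})"

definition cycle_matroid :: "('v, 'e) pre_graph \<Rightarrow> 'e pre_matroid" where
  "cycle_matroid G =
     \<lparr>ground = edges G,
      indep = (\<lambda>F. F \<subseteq> edges G \<and> \<not> (\<exists>vs es. is_cycle G vs es \<and> set es \<subseteq> F))\<rparr>"

definition is_path :: "('v, 'e) pre_graph \<Rightarrow> 'v list \<Rightarrow> 'e list \<Rightarrow> bool" where
  "is_path G vs es \<longleftrightarrow>
     length vs = Suc (length es) \<and> distinct vs \<and>
     set vs \<subseteq> verts G \<and> set es \<subseteq> edges G \<and>
     (\<forall>i<length es. ends G (es ! i) = {vs ! i, vs ! Suc i})"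

definition inner_verts :: "'v list \<Rightarrow> 'v set" where
  "inner_verts vs = set (butlast (tl vs))"

text \<open>
  The map \<open>\<phi>\<close> sends the vertices of \<open>H\<close> to the branch vertices of \<open>G\<close>, and the edge \<open>e\<close> of \<open>H\<close> is
  replaced by the path with vertices \<open>vs e\<close> and edges \<open>es e\<close>; \<open>G\<close> consists of the branch vertices and
  these paths only. Disjointness of the edge sets is not implied by that of the inner vertices when
  parallel edges of \<open>H\<close> are replaced by paths of length 1.
\<close>

definition totally_odd_subdivision ::
    "('w, 'f) pre_graph \<Rightarrow> ('v, 'e) pre_graph \<Rightarrow> bool" where
  "totally_odd_subdivision H G \<longleftrightarrow>
     (\<exists>\<phi> vs es.
        inj_on \<phi> (verts H) \<and>
        (\<forall>e\<in>edges H.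
           is_path G (vs e) (es e) \<and> odd (length (es e)) \<and>
           {hd (vs e), last (vs e)} = \<phi> ` ends H e \<and>
           inner_verts (vs e) \<inter> \<phi> ` verts H = {}) \<and>
        (\<forall>e\<in>edges H. \<forall>f\<in>edges H. e \<noteq> f \<longrightarrow>
           inner_verts (vs e) \<inter> inner_verts (vs f) = {} \<and> set (es e) \<inter> set (es f) = {}) \<and>
        verts G = \<phi> ` verts H \<union> (\<Union>e\<in>edges H. inner_verts (vs e)) \<and>
        edges G = (\<Union>e\<in>edges H. set (es e)))"

definition C3_plus :: "(nat, nat) pre_graph" where
  "C3_plus =
     \<lparr>verts = {0, 1, 2},
      edges = {0, 1, 2, 3},
      ends = (\<lambda>e. if e = 1 then {1, 2} else if e = 2 then {0, 2} else {0, 1})\<rparr>"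

definition odd_C3_plus_graph :: "('v, 'e) pre_graph \<Rightarrow> bool" where
  "odd_C3_plus_graph G \<longleftrightarrow> multigraph G \<and> totally_odd_subdivision C3_plus G"

text \<open>
  The restriction of \<open>M\<close> to \<open>X\<close> is an odd-\<open>C\<^sub>3\<^sup>+\<close> of \<open>M\<close>. As graphs are finite, it is no restriction
  to take natural numbers as vertices and edges.
\<close>

definition is_odd_C3_plus_of :: "'a set \<Rightarrow> 'a pre_matroid \<Rightarrow> bool" where
  "is_odd_C3_plus_of X M \<longleftrightarrow>
     X \<subseteq> ground M \<and>
     (\<exists>G :: (nat, nat) pre_graph.
        odd_C3_plus_graph G \<and> matroid_iso (restriction M X) (cycle_matroid G))"

definition odd_C3_plus_free :: "'a pre_matroid \<Rightarrow> bool" where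
  "odd_C3_plus_free M \<longleftrightarrow> \<not> (\<exists>X. is_odd_C3_plus_of X M)"


section \<open>Algorithms with access to an oracle\<close>

text \<open>
  Algorithms are programs for a random access machine with an oracle, written as structured programs.
  The memory consists of registers and arrays of natural numbers. Arithmetic is limited to
  addition and truncated subtraction, so that one step lengthens the binary representation of the
  largest stored number by at most a constant depending on the program only. Hence the number of
  steps is polynomially related to the running time of an oracle Turing machine.
\<close>

type_synonym vname = nat
type_synonym aname = nat

datatype aexp =
    Const nat
  | Reg vname
  | Elem aname aexp
  | Plus aexp aexp
  | Minus aexp aexp

datatype bexp =
    Less aexp aexp
  | Eq aexp aexp
  | Neg bexp
  | Conj bexp bexp

datatype com =
    Skip
  | Assign vname aexp
  | Store aname aexp aexp
  | Query vname aname
  | Seq com com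
  | Cond bexp com com
  | While bexp com

record state =
  reg :: "vname \<Rightarrow> nat"
  arr :: "aname \<Rightarrow> nat \<Rightarrow> nat"

fun aval :: "aexp \<Rightarrow> state \<Rightarrow> nat" where
  "aval (Const k) s = k"
| "aval (Reg x) s = reg s x"
| "aval (Elem a e) s = arr s a (aval e s)"
| "aval (Plus e f) s = aval e s + aval f s"
| "aval (Minus e f) s = aval e s - aval f s"

fun bval :: "bexp \<Rightarrow> state \<Rightarrow> bool" where
  "bval (Less e f) s \<longleftrightarrow> aval e s < aval f s"
| "bval (Eq e f) s \<longleftrightarrow> aval e s = aval f s"
| "bval (Neg b) s \<longleftrightarrow> \<not> bval b s"
| "bval (Conj b d) s \<longleftrightarrow> bval b s \<and> bval d s"

definition set_reg :: "vname \<Rightarrow> nat \<Rightarrow> state \<Rightarrow> state" where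
  "set_reg x k s = s\<lparr>reg := (reg s)(x := k)\<rparr>"

definition set_arr :: "aname \<Rightarrow> nat \<Rightarrow> nat \<Rightarrow> state \<Rightarrow> state" where
  "set_arr a i k s = s\<lparr>arr := (arr s)(a := (arr s a)(i := k))\<rparr>"

text \<open>The subset of \<open>{..<n}\<close> whose incidence vector is stored in the array \<open>a\<close>.\<close>

definition array_set :: "nat \<Rightarrow> aname \<Rightarrow> state \<Rightarrow> nat set" where
  "array_set n a s = {i. i < n \<and> arr s a i \<noteq> 0}"

text \<open>
  \<open>exec orc n c s t q s'\<close>: run from the state \<open>s\<close> with the oracle \<open>orc\<close> for subsets of \<open>{..<n}\<close>,
  the program \<open>c\<close> halts in the state \<open>s'\<close> after \<open>t\<close> steps and \<open>q\<close> oracle calls. The expressions in a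
  fixed program have bounded size, so evaluating one counts as one step. An oracle call is charged
  the \<open>n\<close> steps needed to transmit its argument.
\<close>

inductive exec ::
    "(nat set \<Rightarrow> bool) \<Rightarrow> nat \<Rightarrow> com \<Rightarrow> state \<Rightarrow> nat \<Rightarrow> nat \<Rightarrow> state \<Rightarrow> bool"
  for orc :: "nat set \<Rightarrow> bool" and n :: nat
where
  exec_Skip: "exec orc n Skip s 1 0 s"
| exec_Assign: "exec orc n (Assign x e) s 1 0 (set_reg x (aval e s) s)"
| exec_Store: "exec orc n (Store a e f) s 1 0 (set_arr a (aval e s) (aval f s) s)"
| exec_Query: "exec orc n (Query x a) s (n + 1) 1
    (set_reg x (if orc (array_set n a s) then 1 else 0) s)"
| exec_Seq: "exec orc n c s t q s' \<Longrightarrow> exec orc n d s' t' q' s'' \<Longrightarrow>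
    exec orc n (Seq c d) s (t + t') (q + q') s''"
| exec_CondTrue: "bval b s \<Longrightarrow> exec orc n c s t q s' \<Longrightarrow>
    exec orc n (Cond b c d) s (t + 1) q s'"
| exec_CondFalse: "\<not> bval b s \<Longrightarrow> exec orc n d s t q s' \<Longrightarrow>
    exec orc n (Cond b c d) s (t + 1) q s'"
| exec_WhileFalse: "\<not> bval b s \<Longrightarrow> exec orc n (While b c) s 1 0 s"
| exec_WhileTrue: "bval b s \<Longrightarrow> exec orc n c s t q s' \<Longrightarrow>
    exec orc n (While b c) s' t' q' s'' \<Longrightarrow>
    exec orc n (While b c) s (t + t' + 1) (q + q') s''"

inductive_cases SkipE: "exec orc n Skip s t q s'"
inductive_cases AssignE: "exec orc n (Assign x e) s t q s'"
inductive_cases StoreE: "exec orc n (Store a e f) s t q s'"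
inductive_cases QueryE: "exec orc n (Query x a) s t q s'"
inductive_cases SeqE: "exec orc n (Seq c d) s t q s'"
inductive_cases CondE: "exec orc n (Cond b c d) s t q s'"
inductive_cases WhileE: "exec orc n (While b c) s t q s'"

lemma exec_deterministic:
  "exec orc n c s t q s' \<Longrightarrow> exec orc n c s u r s'' \<Longrightarrow> u = t \<and> r = q \<and> s'' = s'"
proof (induction arbitrary: u r s'' rule: exec.induct)
  case (exec_Skip s)
  then show ?case by (elim SkipE) simp
next
  case (exec_Assign x e s)
  then show ?case by (elim AssignE) simp
next
  case (exec_Store a e f s)
  then show ?case by (elim StoreE) simp
next
  case (exec_Query x a s)
  then show ?case by (elim QueryE) simp
next
  case (exec_Seq c s t q s' d t' q' s1)
  from exec_Seq.prems obtain t1 q1 s2 t2 q2 where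
    *: "exec orc n c s t1 q1 s2" "exec orc n d s2 t2 q2 s''" "u = t1 + t2" "r = q1 + q2"
    by (rule SeqE) simp
  with exec_Seq.IH(1)[OF *(1)] exec_Seq.IH(2)[of t2 q2 s''] show ?case by simp
next
  case (exec_CondTrue b s c t q s' d)
  from exec_CondTrue.prems exec_CondTrue.hyps obtain v where
    "exec orc n c s v r s''" "u = v + 1"
    by (elim CondE) simp_all
  with exec_CondTrue.IH show ?case by simp
next
  case (exec_CondFalse b s d t q s' c)
  from exec_CondFalse.prems exec_CondFalse.hyps obtain v where
    "exec orc n d s v r s''" "u = v + 1"
    by (elim CondE) simp_all
  with exec_CondFalse.IH show ?case by simp
next
  case (exec_WhileFalse b s c)
  from exec_WhileFalse.prems show ?case
    by (rule WhileE) (use exec_WhileFalse.hyps in simp_all)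
next
  case (exec_WhileTrue b s c t q s' t' q' s1)
  from exec_WhileTrue.prems obtain t1 q1 s2 t2 q2 where
    *: "exec orc n c s t1 q1 s2" "exec orc n (While b c) s2 t2 q2 s''"
       "u = t1 + t2 + 1" "r = q1 + q2"
    by (rule WhileE) (use exec_WhileTrue.hyps in simp_all)
  with exec_WhileTrue.IH(1)[OF *(1)] exec_WhileTrue.IH(2)[of t2 q2 s''] show ?case by simp
qed

text \<open>
  The size of the ground set is passed in register 0, and everything else is initially zero. On
  termination, register 0 is zero if the program found nothing; otherwise array 0 holds the
  incidence vector of the set that it found.
\<close>

definition input_state :: "nat \<Rightarrow> state" where
  "input_state n = \<lparr>reg = (\<lambda>_. 0)(0 := n), arr = (\<lambda>_ _. 0)\<rparr>"

definition result_of :: "nat \<Rightarrow> state \<Rightarrow> nat set option" where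
  "result_of n s = (if reg s 0 = 0 then None else Some (array_set n 0 s))"

end

theory Submission
  imports Defs
begin

text \<open>
  In terms of cycles, an odd-\<open>C\<^sub>3\<^sup>+\<close> of a binary matroid is a theta: three disjoint sets
  \<open>A\<close>, \<open>B\<close>, \<open>P\<close> with \<open>|A|\<close>, \<open>|B|\<close> odd and \<open>|P|\<close> even such that the only nonempty cycles in their
  union are \<open>A \<union> B\<close>, \<open>A \<union> P\<close> and \<open>B \<union> P\<close>. If a component has an odd circuit and an even circuit
  \<open>D\<close> crossed oddly by some cycle, then a minimal ear of \<open>D\<close> gives such a theta or one with three
  odd branches; in the latter case a minimal odd ear of that theta gives an odd-\<open>C\<^sub>3\<^sup>+\<close>. Otherwise
  even circuits are orthogonal to all cycles, and rerouting along ears shows that the odd circuits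
  of the component are pairwise congruent modulo the orthogonal complement of the cycle space, so
  \<open>|C \<inter> D| \<equiv> |C| |D|\<close> modulo 2 for all circuits \<open>C\<close>, \<open>D\<close> of the component. By bilinearity this
  condition can be tested on the fundamental circuits of a basis. An odd-\<open>C\<^sub>3\<^sup>+\<close> is found by deleting
  elements greedily as long as the test still detects one.
\<close>

section \<open>Cycle spaces\<close>

text \<open>Graphs enter only in the translation of thetas. Everything else happens in a family of
  sets closed under symmetric difference (called the sum below), where an ear of a set
  \<open>T\<close> is a cycle that adds a single dimension to the cycles inside \<open>T\<close>.
  Choosing a cycle with as little as possible outside \<open>T\<close> forces this. The obstacle is
  that a component all of whose circuits are even may contain even circuits that meet in an odd set,
  such as \<open>A \<union> B\<close> and \<open>A \<union> P\<close> in a theta with three odd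
  branches, although it has no odd-\<open>C\<^sub>3\<^sup>+\<close>. So the test must also find an
  odd circuit in the same component; the third index of a tested triple and the component labels
  serve this purpose. Conversely, an odd theta violates the condition by itself:
  \<open>A \<union> P\<close> is odd, \<open>A \<union> B\<close> is even, and they meet in the odd
  set \<open>A\<close>. Hence the condition is equivalent to the absence of an odd theta, and
  cubically many triples of fundamental circuits decide it. The test exhibits no theta, which is why
  it has to be available for every subset of the ground set.\<close>

lemma even_card_sym_diff:
  assumes "finite A" "finite B"
  shows "even (card (sym_diff A B)) \<longleftrightarrow> (even (card A) \<longleftrightarrow> even (card B))"
proof -
  have "card A = card (A - B) + card (A \<inter> B)" "card B = card (B - A) + card (A \<inter> B)"
    using assms card_Int_Diff[of A B] card_Int_Diff[of B A] by (auto simp: Int_commute)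
  moreover have "card (sym_diff A B) = card (A - B) + card (B - A)"
    using assms by (intro card_Un_disjoint) auto
  ultimately show ?thesis by auto
qed

lemma even_card_sym_diff_Int:
  assumes "finite A" "finite B"
  shows "even (card (sym_diff A B \<inter> C)) \<longleftrightarrow> (even (card (A \<inter> C)) \<longleftrightarrow> even (card (B \<inter> C)))"
proof -
  have "sym_diff A B \<inter> C = sym_diff (A \<inter> C) (B \<inter> C)" by blast
  then show ?thesis using even_card_sym_diff[of "A \<inter> C" "B \<inter> C"] assms by simp
qed

lemma even_card_Un_disjoint:
  assumes "finite A" "finite B" "A \<inter> B = {}"
  shows "even (card (A \<union> B)) \<longleftrightarrow> (even (card A) \<longleftrightarrow> even (card B))"
  using card_Un_disjoint[OF assms] by simp

lemma obtain_minimizer: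
  fixes m :: "'a \<Rightarrow> nat"
  assumes "R Z"
  obtains Y where "R Y" "\<And>W. R W \<Longrightarrow> m Y \<le> m W"
proof -
  obtain Y where "R Y \<and> (\<forall>W. R W \<longrightarrow> m Y \<le> m W)" using ex_has_least_nat[of R Z m] assms by blast
  then show thesis using that by blast
qed

text \<open>These properties are inherited by the cycles inside any set \<open>S\<close>, so the
  theory applies to every restriction met by the deletion loop.\<close>

locale cycle_space =
  fixes \<C> :: "'a set set"
  assumes finite_cycle: "Z \<in> \<C> \<Longrightarrow> finite Z"
    and empty_cycle: "{} \<in> \<C>"
    and sym_diff_cycle: "Y \<in> \<C> \<Longrightarrow> Z \<in> \<C> \<Longrightarrow> sym_diff Y Z \<in> \<C>"
begin

definition circuit :: "'a set \<Rightarrow> bool" where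
  "circuit Z \<longleftrightarrow> Z \<in> \<C> \<and> Z \<noteq> {} \<and> (\<forall>Y\<in>\<C>. Y \<subseteq> Z \<longrightarrow> Y = {} \<or> Y = Z)"

text \<open>The cycles inside \<open>A \<union> B \<union> P\<close> are those of a theta graph with
  these branches. Parities are kept apart, since thetas with three odd branches occur on the way to
  odd thetas.\<close>

definition theta :: "'a set \<Rightarrow> 'a set \<Rightarrow> 'a set \<Rightarrow> bool" where
  "theta A B P \<longleftrightarrow>
     A \<noteq> {} \<and> B \<noteq> {} \<and> P \<noteq> {} \<and> A \<inter> B = {} \<and> A \<inter> P = {} \<and> B \<inter> P = {} \<and>
     A \<union> B \<in> \<C> \<and> A \<union> P \<in> \<C> \<and> B \<union> P \<in> \<C> \<and>
     (\<forall>Z\<in>\<C>. Z \<subseteq> A \<union> B \<union> P \<longrightarrow> Z = {} \<or> Z = A \<union> B \<or> Z = A \<union> P \<or> Z = B \<union> P)"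

definition odd_theta :: "'a set \<Rightarrow> 'a set \<Rightarrow> 'a set \<Rightarrow> bool" where
  "odd_theta A B P \<longleftrightarrow> theta A B P \<and> odd (card A) \<and> odd (card B) \<and> even (card P)"

text \<open>The closure makes transitivity immediate. For distinct elements of a matroid, lying on a
  common circuit is already transitive, but that takes a circuit exchange argument.\<close>

definition connected :: "('a \<times> 'a) set" where
  "connected = {(x, y). \<exists>Z. circuit Z \<and> x \<in> Z \<and> y \<in> Z}\<^sup>*"

lemma circuit_cycle: "circuit Z \<Longrightarrow> Z \<in> \<C>"
  by (simp add: circuit_def)

lemma circuit_minimal: "circuit Z \<Longrightarrow> Y \<in> \<C> \<Longrightarrow> Y \<subseteq> Z \<Longrightarrow> Y \<noteq> {} \<Longrightarrow> Y = Z"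
  by (auto simp: circuit_def)

lemma circuit_nonempty: "circuit Z \<Longrightarrow> Z \<noteq> {}"
  by (simp add: circuit_def)

text \<open>A cycle \<open>Y\<close> of least size with \<open>R\<close> is a circuit: a proper
  nonempty subcycle \<open>W\<close> would split it into the smaller cycles \<open>W\<close> and
  \<open>Y - W\<close>, and \<open>R\<close> passes to one of the two.\<close>

lemma circuit_with_property:
  assumes "Z \<in> \<C>" "R Z" "\<not> R {}"
    and split: "\<And>Y W. R Y \<Longrightarrow> Y \<in> \<C> \<Longrightarrow> W \<in> \<C> \<Longrightarrow> W \<subseteq> Y \<Longrightarrow> R W \<or> R (Y - W)"
  obtains Y where "circuit Y" "R Y" "Y \<subseteq> Z"
proof -
  obtain Y where Y: "Y \<in> \<C> \<and> R Y \<and> Y \<subseteq> Z"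
    and min: "\<And>W. W \<in> \<C> \<and> R W \<and> W \<subseteq> Z \<Longrightarrow> card Y \<le> card W"
    using obtain_minimizer[of "\<lambda>Y. Y \<in> \<C> \<and> R Y \<and> Y \<subseteq> Z" Z card] assms(1,2) by blast
  have "circuit Y"
    unfolding circuit_def
  proof (intro conjI ballI impI)
    show "Y \<in> \<C>" using Y by simp
    show "Y \<noteq> {}" using Y assms(3) by auto
    fix W assume W: "W \<in> \<C>" "W \<subseteq> Y"
    have YW: "Y - W \<in> \<C>" using sym_diff_cycle[of Y W] Y W by (simp add: Diff_eq_empty_iff[THEN iffD2])
    have fin: "finite Y" using Y finite_cycle by blast
    from split[of Y W] Y W have "R W \<or> R (Y - W)" by blast
    then show "W = {} \<or> W = Y"
    proof
      assume "R W"
      then have "card Y \<le> card W" using min W Y by blast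
      then show ?thesis using card_seteq[OF fin W(2)] by blast
    next
      assume "R (Y - W)"
      then have "card Y \<le> card (Y - W)" using min YW Y by blast
      then have "Y - W = Y" using card_seteq[OF fin] by blast
      then show ?thesis using W by blast
    qed
  qed
  then show thesis using that Y by blast
qed

lemma circuit_through:
  assumes "Z \<in> \<C>" "x \<in> Z"
  obtains Y where "circuit Y" "x \<in> Y" "Y \<subseteq> Z"
  by (rule circuit_with_property[of Z "\<lambda>Y. x \<in> Y"]) (use assms that in simp_all)

lemma odd_circuit_in_odd_cycle:
  assumes "Z \<in> \<C>" "odd (card Z)"
  obtains Y where "circuit Y" "odd (card Y)" "Y \<subseteq> Z"
proof (rule circuit_with_property[of Z "\<lambda>Y. odd (card Y)"])
  fix Y W assume *: "odd (card Y)" "Y \<in> \<C>" "W \<subseteq> Y"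
  then have "finite Y" "finite W" using finite_cycle finite_subset by blast+
  then have "card Y = card W + card (Y - W)"
    using card_Diff_subset[of W Y] card_mono[of Y W] * by simp
  then show "odd (card W) \<or> odd (card (Y - W))" using * by auto
qed (use assms that in simp_all)

section \<open>Thetas and minimal ears\<close>

lemma theta_swap: "theta A B P \<Longrightarrow> theta B A P" "theta A B P \<Longrightarrow> theta A P B"
proof -
  have *: "B \<union> A = A \<union> B" "B \<inter> A = A \<inter> B" "P \<union> B = B \<union> P" "P \<inter> B = B \<inter> P" "A \<union> P \<union> B = A \<union> B \<union> P"
    by blast+
  show "theta A B P \<Longrightarrow> theta B A P" unfolding theta_def * by blast
  show "theta A B P \<Longrightarrow> theta A P B" unfolding theta_def * by blast
qed

lemma theta_finite: "theta A B P \<Longrightarrow> finite A \<and> finite B \<and> finite P"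
  unfolding theta_def by (elim conjE) (metis finite_cycle finite_Un)

lemma theta_circuit:
  assumes "theta A B P"
  shows "circuit (A \<union> B)"
  unfolding circuit_def
proof (intro conjI ballI impI)
  fix Y assume "Y \<in> \<C>" "Y \<subseteq> A \<union> B"
  moreover from this have "Y = {} \<or> Y = A \<union> B \<or> Y = A \<union> P \<or> Y = B \<union> P"
    using assms by (auto simp: theta_def)
  moreover have "\<not> P \<subseteq> A \<union> B" using assms by (auto simp: theta_def)
  ultimately show "Y = {} \<or> Y = A \<union> B" by blast
qed (use assms in \<open>auto simp: theta_def\<close>)

text \<open>The unions of two of these branches are \<open>D\<close>, \<open>C\<close> and the sum
  of both, which are the only nonempty cycles around.\<close>

lemma theta_of_two_cycles:
  assumes "C \<in> \<C>" "D \<in> \<C>" "D \<inter> C \<noteq> {}" "D - C \<noteq> {}" "C - D \<noteq> {}"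
    and only: "\<And>Z. Z \<in> \<C> \<Longrightarrow> Z \<subseteq> C \<union> D \<Longrightarrow> Z = {} \<or> Z = D \<or> Z = C \<or> Z = sym_diff D C"
  shows "theta (D \<inter> C) (D - C) (C - D)"
proof -
  have *: "D \<inter> C \<union> (D - C) = D" "D \<inter> C \<union> (C - D) = C" "D \<union> (C - D) = C \<union> D"
    by blast+
  show ?thesis
    unfolding theta_def *
    using assms(1-5) sym_diff_cycle[OF assms(2,1)] only by blast
qed

text \<open>Take \<open>C\<close> with as few elements outside \<open>D\<close> as possible. For a
  cycle \<open>Z\<close> inside \<open>C \<union> D\<close>, one of \<open>Z\<close> and its sum
  with \<open>C\<close> meets \<open>D\<close> in an odd set, so it contains all of
  \<open>C - D\<close>, and the other one lies inside the circuit \<open>D\<close>. This leaves only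
  the cycles of a theta. As \<open>D\<close> is even, both parts of \<open>D\<close> are
  odd.\<close>

lemma odd_crossing_theta:
  assumes D: "circuit D" "even (card D)" and C: "C \<in> \<C>" "odd (card (C \<inter> D))"
  obtains A B P where "theta A B P" "A \<union> B = D" "odd (card A)" "odd (card B)"
proof -
  obtain C where C: "C \<in> \<C> \<and> odd (card (C \<inter> D))"
    and min: "\<And>W. W \<in> \<C> \<and> odd (card (W \<inter> D)) \<Longrightarrow> card (C - D) \<le> card (W - D)"
    using obtain_minimizer[of "\<lambda>W. W \<in> \<C> \<and> odd (card (W \<inter> D))" C "\<lambda>W. card (W - D)"] C
    by blast
  have fin: "finite C" "finite D" using C D finite_cycle circuit_cycle by blast+
  have DC: "D \<in> \<C>" using D circuit_cycle by blast
  have "D = (C \<inter> D) \<union> (D - C)" by blast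
  with even_card_Un_disjoint[of "C \<inter> D" "D - C"] have odd2: "odd (card (D - C))"
    using C D fin by fastforce
  have ne: "D \<inter> C \<noteq> {}" "D - C \<noteq> {}"
    using C odd2 by (metis Int_commute card.empty even_zero)+
  have "C - D \<noteq> {}"
  proof
    assume "C - D = {}"
    then have "C = D" using circuit_minimal[OF D(1), of C] C ne by blast
    then show False using ne by blast
  qed
  have *: "card (W - D) \<ge> card (C - D)" if "W \<in> \<C>" "odd (card (W \<inter> D))" for W
    using min that by blast
  have only: "Z = {} \<or> Z = D \<or> Z = C \<or> Z = sym_diff D C" if Z: "Z \<in> \<C>" "Z \<subseteq> C \<union> D" for Z
  proof -
    have Z': "sym_diff Z C \<in> \<C>" using Z C sym_diff_cycle by blast
    have "odd (card (Z \<inter> D)) \<or> odd (card (sym_diff Z C \<inter> D))"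
      using even_card_sym_diff_Int[of Z C D] Z C finite_cycle by blast
    moreover have "Z - D = C - D" if "odd (card (Z \<inter> D))"
      using *[OF Z(1) that] Z fin by (intro card_seteq) auto
    moreover have "sym_diff Z C - D = C - D" if "odd (card (sym_diff Z C \<inter> D))"
      using *[OF Z' that] Z fin by (intro card_seteq) auto
    ultimately have "Z \<subseteq> D \<or> sym_diff Z C \<subseteq> D" using Z by blast
    then show ?thesis
    proof
      assume "Z \<subseteq> D"
      then show ?thesis using circuit_minimal[OF D(1) Z(1)] by blast
    next
      assume "sym_diff Z C \<subseteq> D"
      then have "sym_diff Z C = {} \<or> sym_diff Z C = D" using circuit_minimal[OF D(1) Z'] by blast
      then show ?thesis by blast
    qed
  qed
  have "theta (D \<inter> C) (D - C) (C - D)"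
    using theta_of_two_cycles[of C D] C DC ne \<open>C - D \<noteq> {}\<close> only by blast
  moreover have "D \<inter> C \<union> (D - C) = D" by blast
  ultimately show thesis
    using that[of "D \<inter> C" "D - C" "C - D"] C odd2 by (simp add: Int_commute)
qed

text \<open>Modulo the cycles inside \<open>T\<close>, the cycle \<open>C\<close> is the only
  nonzero cycle of \<open>T \<union> C\<close>. Only \<open>C - T\<close> is canonical;
  \<open>C\<close> itself may be changed by cycles inside \<open>T\<close>.\<close>

definition odd_ear :: "'a set \<Rightarrow> 'a set \<Rightarrow> bool" where
  "odd_ear T C \<longleftrightarrow> C \<in> \<C> \<and> odd (card C) \<and>
     (\<forall>Z\<in>\<C>. Z \<subseteq> T \<union> C \<longrightarrow> Z \<subseteq> T \<or> sym_diff Z C \<subseteq> T)"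

lemma odd_ear_shift:
  assumes "odd_ear T C" "W \<in> \<C>" "W \<subseteq> T" "even (card W)"
  shows "odd_ear T (sym_diff C W)"
  unfolding odd_ear_def
proof (intro conjI ballI impI)
  show "sym_diff C W \<in> \<C>" using assms sym_diff_cycle odd_ear_def by auto
  show "odd (card (sym_diff C W))"
    using assms even_card_sym_diff[of C W] finite_cycle odd_ear_def by auto
  fix Z assume "Z \<in> \<C>" "Z \<subseteq> T \<union> sym_diff C W"
  moreover from this have "Z \<subseteq> T \<or> sym_diff Z C \<subseteq> T"
    using assms unfolding odd_ear_def by blast
  ultimately show "Z \<subseteq> T \<or> sym_diff Z (sym_diff C W) \<subseteq> T" using assms(3) by blast
qed

text \<open>A cycle inside both \<open>A \<union> B \<union> P\<close> and
  \<open>C \<union> (A \<union> B)\<close> cannot contain all of \<open>P\<close>, so it is empty or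
  \<open>A \<union> B\<close>. By the ear condition, \<open>C\<close> and the even circuit
  \<open>A \<union> B\<close> then form a theta. Both parts of \<open>A \<union> B\<close> are odd,
  and \<open>C - (A \<union> B)\<close> is even because \<open>C\<close> and its part in
  \<open>A \<union> B\<close> are odd.\<close>

lemma odd_theta_of_crossing_ear:
  assumes T: "theta A B P" "odd (card A)" "odd (card B)"
    and C: "odd_ear (A \<union> B \<union> P) C" "odd (card (C \<inter> (A \<union> B)))" "\<not> P \<subseteq> C"
  shows "\<exists>A B P. odd_theta A B P"
proof -
  let ?D = "A \<union> B"
  have fin: "finite A" "finite B" "finite C"
    using theta_finite[OF T(1)] C(1) finite_cycle by (auto simp: odd_ear_def)
  have disj: "A \<inter> B = {}" "A \<inter> P = {}" "B \<inter> P = {}" using T by (auto simp: theta_def)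
  have CC: "C \<in> \<C>" "odd (card C)" and DC: "?D \<in> \<C>" using C T by (auto simp: odd_ear_def theta_def)
  have evD: "even (card ?D)" using even_card_Un_disjoint[OF fin(1,2) disj(1)] T by simp
  have "?D = (C \<inter> ?D) \<union> (?D - C)" by blast
  with even_card_Un_disjoint[of "C \<inter> ?D" "?D - C"] have o: "odd (card (?D - C))"
    using C(2) evD fin by fastforce
  have "C = (C \<inter> ?D) \<union> (C - ?D)" by blast
  with even_card_Un_disjoint[of "C \<inter> ?D" "C - ?D"] have e: "even (card (C - ?D))"
    using C(2) CC fin by fastforce
  have ne: "C - ?D \<noteq> {}"
  proof
    assume "C - ?D = {}"
    then have "C = {} \<or> C = ?D" using circuit_minimal[OF theta_circuit[OF T(1)], of C] CC by blast
    then show False using CC evD by auto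
  qed
  have only: "Z = {} \<or> Z = ?D \<or> Z = C \<or> Z = sym_diff ?D C" if Z: "Z \<in> \<C>" "Z \<subseteq> C \<union> ?D" for Z
  proof -
    have *: "W = {} \<or> W = ?D" if "W \<in> \<C>" "W \<subseteq> A \<union> B \<union> P" "W \<subseteq> C \<union> ?D" for W
    proof -
      have "W = {} \<or> W = ?D \<or> W = A \<union> P \<or> W = B \<union> P"
        using T(1) that(1,2) unfolding theta_def by blast
      moreover have "\<not> P \<subseteq> W" using that(3) disj C(3) by blast
      ultimately show ?thesis by blast
    qed
    have "Z \<subseteq> A \<union> B \<union> P \<or> sym_diff Z C \<subseteq> A \<union> B \<union> P"
      using C(1) Z unfolding odd_ear_def by blast
    then show ?thesis
    proof
      assume "Z \<subseteq> A \<union> B \<union> P"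
      then show ?thesis using * Z by blast
    next
      assume "sym_diff Z C \<subseteq> A \<union> B \<union> P"
      moreover have "sym_diff Z C \<subseteq> C \<union> ?D" using Z by blast
      ultimately have "sym_diff Z C = {} \<or> sym_diff Z C = ?D"
        using * sym_diff_cycle[OF Z(1) CC(1)] by blast
      then show ?thesis by blast
    qed
  qed
  have "?D \<inter> C \<noteq> {}" using C(2) by (metis Int_commute card.empty even_zero)
  moreover have "?D - C \<noteq> {}" using o by (metis card.empty even_zero)
  ultimately have "theta (?D \<inter> C) (?D - C) (C - ?D)"
    using theta_of_two_cycles[OF CC(1) DC _ _ ne only] by blast
  then show ?thesis unfolding odd_theta_def using C(2) o e by (metis Int_commute)
qed

text \<open>Adding \<open>A \<union> B\<close> to \<open>C\<close> makes it meet
  \<open>A \<union> P\<close> in an odd set, and the elements of \<open>C \<inter> B\<close>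
  disappear from it, so it does not contain \<open>B\<close>. The crossing case now applies to the
  circuit \<open>A \<union> P\<close>, with \<open>B\<close> as the third branch.\<close>

lemma odd_theta_of_even_ear:
  assumes T: "theta A B P" "odd (card A)" "odd (card B)" "odd (card P)"
    and C: "odd_ear (A \<union> B \<union> P) C"
    and ev: "even (card (C \<inter> A))" "even (card (C \<inter> B))" "even (card (C \<inter> P))"
    and ne: "C \<inter> B \<noteq> {}"
  shows "\<exists>A B P. odd_theta A B P"
proof -
  let ?C = "sym_diff C (A \<union> B)"
  have fin: "finite A" "finite B" "finite P" "finite C"
    using theta_finite[OF T(1)] C finite_cycle by (auto simp: odd_ear_def)
  have disj: "A \<inter> B = {}" "A \<inter> P = {}" "B \<inter> P = {}" and AB: "A \<union> B \<in> \<C>"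
    using T by (auto simp: theta_def)
  have "even (card (A \<union> B))" using even_card_Un_disjoint[OF fin(1,2) disj(1)] T by simp
  then have ear: "odd_ear (A \<union> P \<union> B) ?C"
    using odd_ear_shift[OF C AB] by (simp only: Un_ac) blast
  have "odd (card (?C \<inter> (A \<union> P)))"
  proof -
    have "even (card (C \<inter> (A \<union> P)))"
      using even_card_Un_disjoint[of "C \<inter> A" "C \<inter> P"] ev fin disj by (simp add: Int_Un_distrib) blast
    moreover have "(A \<union> B) \<inter> (A \<union> P) = A" using disj by blast
    ultimately show ?thesis
      using even_card_sym_diff_Int[of C "A \<union> B" "A \<union> P"] fin T by auto
  qed
  moreover have "\<not> B \<subseteq> ?C" using ne by blast
  ultimately show ?thesis
    using odd_theta_of_crossing_ear[OF theta_swap(2)[OF T(1)] T(2,4) ear] by blast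
qed

text \<open>
  Adding \<open>A \<union> B\<close>, \<open>A \<union> P\<close> or \<open>B \<union> P\<close> to \<open>C\<close> flips the parities of its intersections with two of
  the branches, so two parity patterns remain up to symmetry.
\<close>

lemma odd_theta_of_odd_ear:
  assumes T: "theta A B P" "odd (card A)" "odd (card B)" "odd (card P)"
    and C: "odd_ear (A \<union> B \<union> P) C" and Q: "C - (A \<union> B \<union> P) \<notin> \<C>"
  shows "\<exists>A B P. odd_theta A B P"
proof -
  have CC: "C \<in> \<C>" using C by (simp add: odd_ear_def)
  have fin: "finite A" "finite B" "finite P" "finite C"
    using theta_finite[OF T(1)] CC finite_cycle by auto
  have disj: "A \<inter> B = {}" "A \<inter> P = {}" "B \<inter> P = {}"
    and cyc: "A \<union> B \<in> \<C>" "A \<union> P \<in> \<C>" "B \<union> P \<in> \<C>"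
    using T by (auto simp: theta_def)
  have evc: "even (card (A \<union> B))" "even (card (A \<union> P))" "even (card (B \<union> P))"
    using even_card_Un_disjoint fin disj T by auto
  have T': "theta A P B" "theta B P A" "theta P B A" "theta P A B" "theta B A P"
    using T(1) theta_swap by blast+
  have perm: "A \<union> P \<union> B = A \<union> B \<union> P" "B \<union> P \<union> A = A \<union> B \<union> P" "P \<union> B \<union> A = A \<union> B \<union> P"
    "P \<union> A \<union> B = A \<union> B \<union> P" "B \<union> A \<union> P = A \<union> B \<union> P" by blast+
  \<comment> \<open>If no branch can be met, \<open>C\<close> avoids the theta and equals
    \<open>C - (A \<union> B \<union> P)\<close>, which is not a cycle.\<close>
  have all_even: ?thesis
    if C: "odd_ear (A \<union> B \<union> P) C" "C - (A \<union> B \<union> P) \<notin> \<C>"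
      and ev: "even (card (C \<inter> A))" "even (card (C \<inter> B))" "even (card (C \<inter> P))" for C
  proof (rule ccontr)
    assume no: "\<not> ?thesis"
    have "C \<inter> B = {}" using odd_theta_of_even_ear[OF T C(1) ev] no by blast
    moreover have "C \<inter> A = {}"
      using odd_theta_of_even_ear[OF T'(5) T(3,2,4) _ ev(2,1,3)] C(1) no unfolding perm by blast
    moreover have "C \<inter> P = {}"
      using odd_theta_of_even_ear[OF T'(1) T(2,4,3) _ ev(1,3,2)] C(1) no unfolding perm by blast
    ultimately have "C - (A \<union> B \<union> P) = C" by blast
    then show False using C by (simp add: odd_ear_def)
  qed
  \<comment> \<open>The odd branch \<open>Z\<close> meets \<open>C\<close> in an even set, so it is
    not contained in \<open>C\<close>, and the crossing case applies to
    \<open>X \<union> Y\<close>.\<close>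
  have one_odd: ?thesis
    if C: "odd_ear (X \<union> Y \<union> Z) C" and th: "theta X Y Z" "odd (card X)" "odd (card Y)" "odd (card Z)"
      and p: "odd (card (C \<inter> X))" "even (card (C \<inter> Y))" "even (card (C \<inter> Z))" for X Y Z C
  proof -
    have "finite C" using C finite_cycle by (simp add: odd_ear_def)
    moreover have "X \<inter> Y = {}" using th by (simp add: theta_def)
    ultimately have "odd (card (C \<inter> (X \<union> Y)))"
      using even_card_Un_disjoint[of "C \<inter> X" "C \<inter> Y"] p by (simp add: Int_Un_distrib) blast
    moreover have "\<not> Z \<subseteq> C" using p th by (metis Int_absorb1)
    ultimately show ?thesis using odd_theta_of_crossing_ear[OF th(1-3) C] by blast
  qed
  have sh: "odd_ear (A \<union> B \<union> P) (sym_diff C W)" "sym_diff C W - (A \<union> B \<union> P) \<notin> \<C>"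
    if "W \<in> {A \<union> B, A \<union> P, B \<union> P}" for W
  proof -
    show "odd_ear (A \<union> B \<union> P) (sym_diff C W)" using odd_ear_shift[OF C] that cyc evc by blast
    have "sym_diff C W - (A \<union> B \<union> P) = C - (A \<union> B \<union> P)" using that by blast
    then show "sym_diff C W - (A \<union> B \<union> P) \<notin> \<C>" using Q by simp
  qed
  have par: "even (card (sym_diff C W \<inter> X)) \<longleftrightarrow> (even (card (C \<inter> X)) \<longleftrightarrow> even (card (W \<inter> X)))"
    if "finite W" for W X
    using even_card_sym_diff_Int[OF fin(4) that] .
  have cap: "(A \<union> B) \<inter> A = A" "(A \<union> B) \<inter> B = B" "(A \<union> B) \<inter> P = {}"
    "(A \<union> P) \<inter> A = A" "(A \<union> P) \<inter> B = {}" "(A \<union> P) \<inter> P = P"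
    "(B \<union> P) \<inter> A = {}" "(B \<union> P) \<inter> B = B" "(B \<union> P) \<inter> P = P" using disj by blast+
  have finU: "finite (A \<union> B)" "finite (A \<union> P)" "finite (B \<union> P)" using fin by auto
  have parities: "even (card (sym_diff C (A \<union> B) \<inter> A)) \<longleftrightarrow> odd (card (C \<inter> A))"
    "even (card (sym_diff C (A \<union> B) \<inter> B)) \<longleftrightarrow> odd (card (C \<inter> B))"
    "even (card (sym_diff C (A \<union> B) \<inter> P)) \<longleftrightarrow> even (card (C \<inter> P))"
    "even (card (sym_diff C (A \<union> P) \<inter> A)) \<longleftrightarrow> odd (card (C \<inter> A))"
    "even (card (sym_diff C (A \<union> P) \<inter> B)) \<longleftrightarrow> even (card (C \<inter> B))"
    "even (card (sym_diff C (A \<union> P) \<inter> P)) \<longleftrightarrow> odd (card (C \<inter> P))"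
    "even (card (sym_diff C (B \<union> P) \<inter> A)) \<longleftrightarrow> even (card (C \<inter> A))"
    "even (card (sym_diff C (B \<union> P) \<inter> B)) \<longleftrightarrow> odd (card (C \<inter> B))"
    "even (card (sym_diff C (B \<union> P) \<inter> P)) \<longleftrightarrow> odd (card (C \<inter> P))"
    using finU T by (simp_all only: par cap) auto
  have shU: "odd_ear (P \<union> A \<union> B) (sym_diff C (A \<union> B))"
    using sh(1)[of "A \<union> B"] unfolding perm by blast
  consider "even (card (C \<inter> A))" "even (card (C \<inter> B))" "even (card (C \<inter> P))"
    | "odd (card (C \<inter> A))" "odd (card (C \<inter> B))" "even (card (C \<inter> P))"
    | "odd (card (C \<inter> A))" "even (card (C \<inter> B))" "odd (card (C \<inter> P))"
    | "even (card (C \<inter> A))" "odd (card (C \<inter> B))" "odd (card (C \<inter> P))"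
    | "odd (card (C \<inter> A))" "odd (card (C \<inter> B))" "odd (card (C \<inter> P))"
    | "odd (card (C \<inter> A))" "even (card (C \<inter> B))" "even (card (C \<inter> P))"
    | "even (card (C \<inter> A))" "odd (card (C \<inter> B))" "even (card (C \<inter> P))"
    | "even (card (C \<inter> A))" "even (card (C \<inter> B))" "odd (card (C \<inter> P))" by blast
  then show ?thesis
  proof cases
    case 1 then show ?thesis using all_even C Q by blast
  next
    case 2 then show ?thesis using all_even[of "sym_diff C (A \<union> B)"] sh parities by blast
  next
    case 3 then show ?thesis using all_even[of "sym_diff C (A \<union> P)"] sh parities by blast
  next
    case 4 then show ?thesis using all_even[of "sym_diff C (B \<union> P)"] sh parities by blast
  next
    \<comment> \<open>Adding \<open>A \<union> B\<close> leaves \<open>P\<close> as the only branch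
      met in an odd set.\<close>
    case 5 then show ?thesis
      using one_odd[OF shU T'(4) T(4,2,3)] parities by blast
  next
    case 6 then show ?thesis using one_odd[OF C T] by blast
  next
    case 7 then show ?thesis using one_odd[of B A P C] C T'(5) T unfolding perm by blast
  next
    case 8 then show ?thesis using one_odd[of P A B C] C T'(4) T unfolding perm by blast
  qed
qed

text \<open>Among the odd circuits meeting the theta, take \<open>C\<close> with as few elements
  outside it as possible. For a cycle \<open>Z\<close> inside \<open>?T \<union> C\<close>, exactly
  one of \<open>Z\<close> and its sum with \<open>C\<close> is odd, and by minimality this one
  contains all of \<open>C - ?T\<close>; so the other one lies inside \<open>?T\<close>, and
  \<open>C\<close> is an odd ear.\<close>

lemma odd_theta_of_all_odd_theta:
  assumes T: "theta A B P" "odd (card A)" "odd (card B)" "odd (card P)"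
    and C: "circuit C" "odd (card C)" "C \<inter> (A \<union> B \<union> P) \<noteq> {}"
  shows "\<exists>A B P. odd_theta A B P"
proof -
  let ?T = "A \<union> B \<union> P"
  define R where "R W \<longleftrightarrow> circuit W \<and> odd (card W) \<and> W \<inter> ?T \<noteq> {}" for W
  have "R C" using C by (simp add: R_def)
  then obtain C where RC: "R C" and min: "\<And>W. R W \<Longrightarrow> card (C - ?T) \<le> card (W - ?T)"
    using obtain_minimizer[of R C "\<lambda>W. card (W - ?T)"] by blast
  have C: "circuit C" "odd (card C)" "C \<inter> ?T \<noteq> {}" using RC by (simp_all add: R_def)
  have CC: "C \<in> \<C>" and fin: "finite C" using C circuit_cycle finite_cycle by blast+
  have even_T: "even (card W)" if "W \<in> \<C>" "W \<subseteq> ?T" for W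
  proof -
    have "A \<inter> B = {}" "A \<inter> P = {}" "B \<inter> P = {}" using T(1) by (auto simp: theta_def)
    moreover have "finite A" "finite B" "finite P" using theta_finite[OF T(1)] by auto
    moreover have "W = {} \<or> W = A \<union> B \<or> W = A \<union> P \<or> W = B \<union> P"
      using that T(1) unfolding theta_def by blast
    ultimately show ?thesis using T(2-4) by (elim disjE) (simp_all add: even_card_Un_disjoint)
  qed
  \<comment> \<open>An odd cycle contains an odd circuit \<open>Y\<close>. If \<open>Y\<close>
    missed \<open>?T\<close>, it would lie inside \<open>C\<close>, hence equal \<open>C\<close>,
    which meets \<open>?T\<close>. So the minimality of \<open>C\<close> applies to
    \<open>Y\<close>.\<close>
  have odd_full: "Z - ?T = C - ?T" if Z: "Z \<in> \<C>" "odd (card Z)" "Z - ?T \<subseteq> C - ?T" for Z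
  proof -
    obtain Y where Y: "circuit Y" "odd (card Y)" "Y \<subseteq> Z" using odd_circuit_in_odd_cycle[OF Z(1,2)] by blast
    have "Y \<inter> ?T \<noteq> {}"
    proof
      assume *: "Y \<inter> ?T = {}"
      then have "Y \<subseteq> C" using Y Z by blast
      then have "Y = C" using circuit_minimal[OF C(1), of Y] Y circuit_cycle circuit_nonempty by blast
      then show False using * C by blast
    qed
    then have "card (C - ?T) \<le> card (Y - ?T)" using min[of Y] Y by (simp add: R_def)
    moreover have "card (Y - ?T) \<le> card (Z - ?T)"
      using Y Z fin by (intro card_mono) (auto intro: finite_subset)
    ultimately have "card (C - ?T) \<le> card (Z - ?T)" by linarith
    then show ?thesis using card_seteq[of "C - ?T" "Z - ?T"] fin Z by blast
  qed
  have "odd_ear ?T C"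
    unfolding odd_ear_def
  proof (intro conjI ballI impI CC C(2))
    fix Z assume Z: "Z \<in> \<C>" "Z \<subseteq> ?T \<union> C"
    have Z': "sym_diff Z C \<in> \<C>" using Z CC sym_diff_cycle by blast
    have "odd (card Z) \<or> odd (card (sym_diff Z C))"
      using even_card_sym_diff[of Z C] Z fin finite_cycle C by blast
    then show "Z \<subseteq> ?T \<or> sym_diff Z C \<subseteq> ?T"
    proof
      assume "odd (card Z)"
      then have "Z - ?T = C - ?T" using odd_full[OF Z(1)] Z by blast
      then show ?thesis by blast
    next
      assume "odd (card (sym_diff Z C))"
      then have "sym_diff Z C - ?T = C - ?T" using odd_full[OF Z'] Z by blast
      then show ?thesis using Z by blast
    qed
  qed
  \<comment> \<open>Otherwise the circuit \<open>C\<close> would equal \<open>C - ?T\<close> or lie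
    inside \<open>?T\<close>, where all cycles are even.\<close>
  moreover have "C - ?T \<notin> \<C>"
  proof
    assume *: "C - ?T \<in> \<C>"
    have "C - ?T \<noteq> {}" using even_T[OF CC] C(2) by blast
    then have "C - ?T = C" using circuit_minimal[OF C(1) *] by blast
    then show False using C(3) by blast
  qed
  ultimately show ?thesis using odd_theta_of_odd_ear[OF T] by blast
qed

section \<open>Components and the rerouting of odd circuits\<close>

lemma connected_sym: "(x, y) \<in> connected \<Longrightarrow> (y, x) \<in> connected"
  unfolding connected_def by (erule symD[OF sym_rtrancl, rotated]) (auto simp: sym_def)

lemma connected_trans: "(x, y) \<in> connected \<Longrightarrow> (y, z) \<in> connected \<Longrightarrow> (x, z) \<in> connected"
  unfolding connected_def by (rule rtrancl_trans)

lemma connected_circuit: "circuit Z \<Longrightarrow> x \<in> Z \<Longrightarrow> y \<in> Z \<Longrightarrow> (x, y) \<in> connected"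
  unfolding connected_def by (rule r_into_rtrancl) blast

text \<open>If \<open>f\<close> is outside \<open>C\<close>, take a circuit \<open>Z\<close> through
  \<open>f\<close> meeting \<open>C\<close> with \<open>Z - C\<close> smallest. If \<open>Z\<close>
  is even, its sum with \<open>C\<close> is odd and still contains \<open>f\<close>, and minimality
  makes this sum a circuit too.\<close>

lemma odd_circuit_step:
  assumes C: "circuit C" "odd (card C)" and F: "circuit F" "F \<inter> C \<noteq> {}" "f \<in> F"
  obtains C' where "circuit C'" "odd (card C')" "f \<in> C'" "C' \<inter> C \<noteq> {}"
proof (cases "f \<in> C")
  case True
  then show thesis using that[of C] C by blast
next
  case False
  define R where "R Z \<longleftrightarrow> circuit Z \<and> f \<in> Z \<and> Z \<inter> C \<noteq> {}" for Z
  have "R F" using F by (simp add: R_def)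
  then obtain Z where Z: "R Z" and min: "\<And>W. R W \<Longrightarrow> card (Z - C) \<le> card (W - C)"
    using obtain_minimizer[of R F "\<lambda>W. card (W - C)"] by blast
  have cyc: "Z \<in> \<C>" "C \<in> \<C>" and fin: "finite Z" "finite C"
    using Z C circuit_cycle finite_cycle by (auto simp: R_def)
  have full: "W - C = Z - C" if W: "W \<in> \<C>" "f \<in> W" "W - C \<subseteq> Z - C" for W
  proof -
    obtain Y where Y: "circuit Y" "f \<in> Y" "Y \<subseteq> W" using circuit_through[OF W(1,2)] by blast
    have "Y \<inter> C \<noteq> {}"
    proof
      assume *: "Y \<inter> C = {}"
      then have "Y \<subseteq> Z" using Y W by blast
      then have "Y = Z" using circuit_minimal[of Z Y] Z Y circuit_cycle by (auto simp: R_def)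
      then show False using * Z by (simp add: R_def)
    qed
    then have "card (Z - C) \<le> card (Y - C)" using min Y by (simp add: R_def)
    moreover have "Y - C \<subseteq> Z - C" using Y W by blast
    ultimately have "Y - C = Z - C" using fin by (intro card_seteq) auto
    then show ?thesis using Y W by blast
  qed
  have "odd (card (sym_diff Z C))" if "even (card Z)"
    using even_card_sym_diff[OF fin] that C by simp
  moreover have "circuit (sym_diff Z C)"
    unfolding circuit_def
  proof (intro conjI ballI impI)
    show "sym_diff Z C \<in> \<C>" using sym_diff_cycle cyc by blast
    show "sym_diff Z C \<noteq> {}" using Z False by (auto simp: R_def)
    fix Y assume Y: "Y \<in> \<C>" "Y \<subseteq> sym_diff Z C"
    \<comment> \<open>Such a \<open>W\<close> agrees with \<open>Z\<close> outside \<open>C\<close>,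
      so their sum is a cycle inside the circuit \<open>C\<close>. It is not empty, as
      \<open>Z\<close> meets \<open>C\<close> whereas \<open>W\<close> is contained in the sum of
      \<open>Z\<close> and \<open>C\<close>.\<close>
    have key: "W = sym_diff Z C" if W: "W \<in> \<C>" "W \<subseteq> sym_diff Z C" "f \<in> W" for W
    proof -
      have "W - C = Z - C" using full[OF W(1,3)] W by blast
      then have sub: "sym_diff W Z \<subseteq> C" by blast
      have "sym_diff W Z \<in> \<C>" using W cyc sym_diff_cycle by blast
      then have "sym_diff W Z = {} \<or> sym_diff W Z = C"
        using circuit_minimal[OF C(1)] sub by blast
      moreover have "sym_diff W Z \<noteq> {}" using W Z unfolding R_def by blast
      ultimately show ?thesis by blast
    qed
    show "Y = {} \<or> Y = sym_diff Z C"
    proof (cases "f \<in> Y")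
      case True
      then show ?thesis using key Y by blast
    next
      case f: False
      \<comment> \<open>The complement of \<open>Y\<close> contains \<open>f\<close>, hence is
        everything, so \<open>Y\<close> is empty.\<close>
      have "sym_diff Y (sym_diff Z C) \<in> \<C>" using Y cyc sym_diff_cycle by blast
      moreover have "f \<in> sym_diff Y (sym_diff Z C)" using f False Z by (auto simp: R_def)
      moreover have "sym_diff Y (sym_diff Z C) \<subseteq> sym_diff Z C" using Y by blast
      ultimately have "sym_diff Y (sym_diff Z C) = sym_diff Z C" using key by blast
      then show ?thesis by blast
    qed
  qed
  moreover have "f \<in> sym_diff Z C" using Z False by (auto simp: R_def)
  moreover have "sym_diff Z C \<inter> C \<noteq> {}"
    using circuit_minimal[of Z C] Z False cyc circuit_nonempty[OF C(1)] by (auto simp: R_def)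
  ultimately show thesis using that Z by (cases "odd (card Z)") (auto simp: R_def)
qed

lemma odd_circuit_through_connected:
  assumes "circuit C" "odd (card C)" "c \<in> C" "(c, f) \<in> connected"
  shows "\<exists>C'. circuit C' \<and> odd (card C') \<and> f \<in> C'"
  using assms(4) unfolding connected_def
proof (induction rule: rtrancl_induct)
  case base
  then show ?case using assms by blast
next
  case (step y z)
  then obtain F C' where "circuit F" "y \<in> F" "z \<in> F" "circuit C'" "odd (card C')" "y \<in> C'"
    by blast
  then show ?case using odd_circuit_step[of C' F z] by blast
qed

text \<open>A cycle crossing \<open>D\<close> oddly gives a theta whose branches on \<open>D\<close>
  are odd. The third branch must be odd as well, since there is no odd theta. But the component has
  an odd circuit through \<open>d\<close>, and it turns such a theta into an odd one.\<close>

lemma even_circuit_orthogonal: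
  assumes no: "\<not> (\<exists>A B P. odd_theta A B P)"
    and C: "circuit C" "odd (card C)" "c \<in> C"
    and D: "circuit D" "even (card D)" "d \<in> D" "(c, d) \<in> connected"
    and Z: "Z \<in> \<C>"
  shows "even (card (Z \<inter> D))"
proof (rule ccontr)
  assume "odd (card (Z \<inter> D))"
  then obtain A B P where T: "theta A B P" "A \<union> B = D" "odd (card A)" "odd (card B)"
    using odd_crossing_theta[OF D(1,2) Z] by blast
  have P: "odd (card P)" using no T unfolding odd_theta_def by blast
  obtain C' where "circuit C'" "odd (card C')" "d \<in> C'"
    using odd_circuit_through_connected[OF C D(4)] by blast
  moreover have "d \<in> A \<union> B \<union> P" using T(2) D(3) by blast
  ultimately show False using odd_theta_of_all_odd_theta[OF T(1,3,4) P, of C'] no by blast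
qed

text \<open>Rerouting \<open>C\<close> along a minimal ear inside \<open>D\<close> gives an odd
  circuit closer to \<open>D\<close>. The two differ by an even circuit, which is orthogonal to
  \<open>Z\<close>, so the parity of the intersection with \<open>Z\<close> is kept.\<close>

lemma intersecting_odd_circuits:
  assumes no: "\<not> (\<exists>A B P. odd_theta A B P)"
    and "circuit C" "odd (card C)" "circuit D" "odd (card D)" "C \<inter> D \<noteq> {}" "Z \<in> \<C>"
  shows "even (card (Z \<inter> C)) \<longleftrightarrow> even (card (Z \<inter> D))"
  using assms(2,3,6)
proof (induction "card (C - D)" arbitrary: C rule: less_induct)
  case less
  have cyc: "C \<in> \<C>" "D \<in> \<C>" using less.prems assms(4) circuit_cycle by blast+
  have fin: "finite C" "finite D" "finite Z" using cyc assms(7) finite_cycle by blast+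
  show ?case
  proof (cases "C = D")
    case False
    define R where "R W \<longleftrightarrow> W \<in> \<C> \<and> W \<subseteq> C \<union> D \<and> \<not> W \<subseteq> C" for W
    have "R D"
      using False circuit_minimal[OF less.prems(1) cyc(2)] circuit_nonempty[OF assms(4)] cyc
      by (auto simp: R_def)
    then obtain W where RW: "R W" and min: "\<And>V. R V \<Longrightarrow> card (W - C) \<le> card (V - C)"
      using obtain_minimizer[of R D "\<lambda>V. card (V - C)"] by blast
    have W: "W \<in> \<C>" "W \<subseteq> C \<union> D" "W - C \<noteq> {}" using RW by (auto simp: R_def)
    have finW: "finite W" using W finite_cycle by blast
    \<comment> \<open>By the choice of \<open>W\<close>, every cycle of \<open>W \<union> C\<close>
      that leaves \<open>C\<close> agrees with \<open>W\<close> outside \<open>C\<close>.\<close>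
    have only: "V = {} \<or> V = C \<or> V = W \<or> V = sym_diff C W" if V: "V \<in> \<C>" "V \<subseteq> W \<union> C" for V
    proof (cases "V \<subseteq> C")
      case True
      then show ?thesis using circuit_minimal[OF less.prems(1) V(1)] by blast
    next
      case False
      then have "R V" using V W by (auto simp: R_def)
      then have "V - C = W - C" using min V finW by (intro card_seteq) auto
      then have "sym_diff V W \<subseteq> C" by blast
      then have "sym_diff V W = {} \<or> sym_diff V W = C"
        using circuit_minimal[OF less.prems(1) sym_diff_cycle[OF V(1) W(1)]] by blast
      then show ?thesis by blast
    qed
    have "C \<inter> W \<noteq> {}"
    proof
      assume *: "C \<inter> W = {}"
      then have "W = D" using circuit_minimal[OF assms(4) W(1)] W by blast
      then show False using less.prems(3) * by blast
    qed
    moreover have "C - W \<noteq> {}"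
    proof
      assume *: "C - W = {}"
      then have "sym_diff W C = W - C" by blast
      then have "W - C \<in> \<C>" using sym_diff_cycle[OF W(1) cyc(1)] by simp
      then have "W - C = D" using circuit_minimal[OF assms(4), of "W - C"] W by blast
      then show False using less.prems(3) by blast
    qed
    ultimately have th: "theta (C \<inter> W) (C - W) (W - C)"
      using theta_of_two_cycles[OF W(1) cyc(1) _ _ W(3) only] by blast
    \<comment> \<open>The part \<open>X\<close> of \<open>C\<close> is replaced by \<open>P\<close>.
      The even circuit \<open>X \<union> P\<close> is not the odd circuit \<open>D\<close>, so
      \<open>X\<close> is not contained in \<open>D\<close> and \<open>C - D\<close> shrinks
      strictly.\<close>
    have reroute: ?thesis if th: "theta X Y P" and XY: "X \<union> Y = C" "P \<subseteq> D" "even (card (X \<union> P))"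
      for X Y P
    proof -
      have E: "circuit (X \<union> P)" and N: "circuit (Y \<union> P)"
        using theta_circuit th theta_swap by blast+
      have ne: "X \<noteq> {}" "P \<noteq> {}" "X \<inter> Y = {}" "X \<inter> P = {}" "Y \<inter> P = {}"
        using th by (auto simp: theta_def)
      have finXYP: "finite X" "finite Y" "finite P" using theta_finite[OF th] by auto
      have C: "C = sym_diff (X \<union> P) (Y \<union> P)" using XY ne by blast
      have odd_N: "odd (card (Y \<union> P))"
        using even_card_sym_diff[of "X \<union> P" "Y \<union> P"] finXYP C XY(3) less.prems(2) by simp
      obtain x where "x \<in> X" using ne by blast
      then have "even (card (Z \<inter> (X \<union> P)))"
        using even_circuit_orthogonal[OF no less.prems(1,2) _ E XY(3) _ _ assms(7), of x x] XY
        by (auto simp: connected_def)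
      then have "even (card (Z \<inter> C)) \<longleftrightarrow> even (card (Z \<inter> (Y \<union> P)))"
        using even_card_sym_diff_Int[of "X \<union> P" "Y \<union> P" Z] finXYP C by (simp add: Int_commute)
      moreover have "\<not> X \<subseteq> D"
      proof
        assume "X \<subseteq> D"
        then have "X \<union> P = D"
          using circuit_minimal[OF assms(4) circuit_cycle[OF E]] XY ne by blast
        then show False using XY(3) assms(5) by simp
      qed
      then have "(Y \<union> P) - D \<subset> C - D" using XY ne by blast
      then have "card ((Y \<union> P) - D) < card (C - D)" using fin by (intro psubset_card_mono) auto
      then have "even (card (Z \<inter> (Y \<union> P))) \<longleftrightarrow> even (card (Z \<inter> D))"
        using less.hyps[OF _ N odd_N] XY ne by blast
      ultimately show ?thesis by blast
    qed
    have eqs: "C \<inter> W \<union> (C - W) = C" "C - W \<union> C \<inter> W = C" "C \<inter> W \<union> (W - C) = W"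
      by blast+
    have "W - C \<subseteq> D" using W by blast
    \<comment> \<open>As \<open>C\<close> is odd, one of the two circuits through
      \<open>W - C\<close> is even; this decides which part of \<open>C\<close> is replaced.\<close>
    moreover have "even (card W) \<or> even (card (sym_diff C W))"
      using even_card_sym_diff[OF fin(1) finW] less.prems(2) by blast
    ultimately show ?thesis
      using reroute[OF th eqs(1)] reroute[OF theta_swap(1)[OF th] eqs(2)] unfolding eqs by blast
  qed simp
qed

text \<open>An odd circuit is moved along the chain of circuits from \<open>c\<close> to
  \<open>d\<close>, each new one meeting the previous one.\<close>

lemma connected_odd_circuit_equivalent:
  assumes no: "\<not> (\<exists>A B P. odd_theta A B P)"
    and C: "circuit C" "odd (card C)" "c \<in> C" and D: "circuit D" "odd (card D)" "d \<in> D"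
    and "(c, d) \<in> connected" and Z: "Z \<in> \<C>"
  shows "even (card (Z \<inter> C)) \<longleftrightarrow> even (card (Z \<inter> D))"
proof -
  have "\<exists>C'. circuit C' \<and> odd (card C') \<and> d \<in> C' \<and> (even (card (Z \<inter> C)) \<longleftrightarrow> even (card (Z \<inter> C')))"
    using assms(8) unfolding connected_def
  proof (induction rule: rtrancl_induct)
    case base
    then show ?case using C by blast
  next
    case (step y z)
    then obtain F C1 where F: "circuit F" "y \<in> F" "z \<in> F"
      and C1: "circuit C1" "odd (card C1)" "y \<in> C1" "even (card (Z \<inter> C)) \<longleftrightarrow> even (card (Z \<inter> C1))"
      by blast
    obtain C2 where C2: "circuit C2" "odd (card C2)" "z \<in> C2" "C2 \<inter> C1 \<noteq> {}"
      using odd_circuit_step[OF C1(1,2) F(1) _ F(3)] F C1 by blast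
    then show ?case using intersecting_odd_circuits[OF no C2(1,2) C1(1,2) C2(4) Z] C1(4) by blast
  qed
  then obtain C' where C': "circuit C'" "odd (card C')" "d \<in> C'"
    "even (card (Z \<inter> C)) \<longleftrightarrow> even (card (Z \<inter> C'))" by blast
  then have "C' \<inter> D \<noteq> {}" using D by blast
  then show ?thesis using intersecting_odd_circuits[OF no C'(1,2) D(1,2) _ Z] C'(4) by blast
qed

text \<open>If both circuits are odd, comparing them on the cycle \<open>C\<close> itself gives
  \<open>|C \<inter> D| \<equiv> |C \<inter> C|\<close> modulo 2. If one is even, it is orthogonal
  to the other; the odd circuit \<open>G\<close> makes this available.\<close>

lemma circuits_intersection_parity:
  assumes no: "\<not> (\<exists>A B P. odd_theta A B P)"
    and C: "circuit C" "c \<in> C" and D: "circuit D" "d \<in> D" and G: "circuit G" "odd (card G)" "g \<in> G"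
    and conn: "(g, c) \<in> connected" "(g, d) \<in> connected"
  shows "odd (card (C \<inter> D)) \<longleftrightarrow> odd (card C) \<and> odd (card D)"
proof -
  have cyc: "C \<in> \<C>" "D \<in> \<C>" using C D circuit_cycle by blast+
  show ?thesis
  proof (cases "odd (card C) \<and> odd (card D)")
    case True
    have "(c, d) \<in> connected" using conn connected_sym connected_trans by blast
    then have "even (card (C \<inter> C)) \<longleftrightarrow> even (card (C \<inter> D))"
      using connected_odd_circuit_equivalent[OF no C(1) _ C(2) D(1) _ D(2) _ cyc(1)] True by blast
    then show ?thesis using True by simp
  next
    case False
    moreover have "even (card (D \<inter> C))" if "even (card C)"
      using even_circuit_orthogonal[OF no G C(1) that C(2) conn(1) cyc(2)] .
    moreover have "even (card (C \<inter> D))" if "even (card D)"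
      using even_circuit_orthogonal[OF no G D(1) that D(2) conn(2) cyc(1)] .
    ultimately show ?thesis by (auto simp: Int_commute)
  qed
qed

end

section \<open>Fundamental circuits and the bilinear parity test\<close>

locale fundamental_circuits = cycle_space \<C> for \<C> :: "'a set set" +
  fixes S B :: "'a set" and F :: "'a \<Rightarrow> 'a set"
  assumes cycle_subset: "Z \<in> \<C> \<Longrightarrow> Z \<subseteq> S"
    and basis_indep: "Z \<in> \<C> \<Longrightarrow> Z \<subseteq> B \<Longrightarrow> Z = {}"
    and fund_cycle: "e \<in> S - B \<Longrightarrow> F e \<in> \<C>"
    and fund_mem: "e \<in> S - B \<Longrightarrow> e \<in> F e"
    and fund_subset: "e \<in> S - B \<Longrightarrow> F e \<subseteq> insert e B"
    and fund_empty: "e \<notin> S - B \<Longrightarrow> F e = {}"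
begin

lemma fund_circuit:
  assumes "e \<in> S - B"
  shows "circuit (F e)"
  unfolding circuit_def
proof (intro conjI ballI impI)
  fix Y assume Y: "Y \<in> \<C>" "Y \<subseteq> F e"
  show "Y = {} \<or> Y = F e"
  proof (cases "e \<in> Y")
    case True
    then have "sym_diff Y (F e) \<subseteq> B" using Y fund_subset[OF assms] by blast
    then have "sym_diff Y (F e) = {}"
      using basis_indep sym_diff_cycle[OF Y(1) fund_cycle[OF assms]] by blast
    then show ?thesis by blast
  next
    case False
    then have "Y \<subseteq> B" using Y fund_subset[OF assms] by blast
    then show ?thesis using basis_indep Y by blast
  qed
qed (use assms fund_cycle fund_mem in auto)

text \<open>A cycle is the sum of the fundamental circuits of its elements outside \<open>B\<close>:
  adding \<open>F e\<close> removes \<open>e\<close> and changes nothing else outside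
  \<open>B\<close>.\<close>

lemma fund_induct:
  assumes "Z \<in> \<C>" "R {}"
    and step: "\<And>Y e. Y \<in> \<C> \<Longrightarrow> e \<in> Z - B \<Longrightarrow> R Y \<Longrightarrow> R (sym_diff Y (F e))"
  shows "R Z"
proof -
  have "R Y" if "Y \<in> \<C>" "Y - B \<subseteq> Z - B" for Y
    using that
  proof (induction "card (Y - B)" arbitrary: Y rule: less_induct)
    case less
    show ?case
    proof (cases "Y - B = {}")
      case True
      then show ?thesis using basis_indep less.prems assms(2) by blast
    next
      case False
      then obtain e where e: "e \<in> Y - B" by blast
      then have eS: "e \<in> S - B" using cycle_subset less.prems by blast
      let ?Y = "sym_diff Y (F e)"
      have Y: "?Y \<in> \<C>" using sym_diff_cycle fund_cycle eS less.prems by blast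
      have sub: "?Y - B \<subset> Y - B" using e fund_mem[OF eS] fund_subset[OF eS] by blast
      then have "card (?Y - B) < card (Y - B)"
        using finite_cycle less.prems by (intro psubset_card_mono) auto
      then have "R ?Y" using less.hyps[OF _ Y] sub less.prems by blast
      then have "R (sym_diff ?Y (F e))" using step[OF Y] e less.prems by blast
      moreover have "sym_diff ?Y (F e) = Y" by blast
      ultimately show ?thesis by simp
    qed
  qed
  then show ?thesis using assms(1) by blast
qed

lemma finite_fund: "finite (F e)"
  using fund_cycle fund_empty finite_cycle by (cases "e \<in> S - B") auto

end

text \<open>Together the two conditions force the label classes on \<open>S\<close> to be the
  components, although only fundamental circuits are inspected.\<close>

locale labelled_fundamental_circuits = fundamental_circuits \<C> S B F
  for \<C> :: "'a set set" and S B F +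
  fixes L :: "'a \<Rightarrow> 'b"
  assumes label_fund: "i \<in> F e \<Longrightarrow> L i = L e"
    and label_connected: "i \<in> S \<Longrightarrow> j \<in> S \<Longrightarrow> L i = L j \<Longrightarrow> (i, j) \<in> connected"
begin

text \<open>Intersecting with a label class maps fundamental circuits to cycles, hence all cycles to
  cycles by linearity. So the part of \<open>D\<close> labelled like \<open>x\<close> is a nonempty
  cycle inside the circuit \<open>D\<close>.\<close>

lemma label_circuit:
  assumes "circuit D" "x \<in> D" "y \<in> D"
  shows "L x = L y"
proof -
  let ?K = "{i. L i = L x}"
  have "D \<inter> ?K \<in> \<C>"
  proof (rule fund_induct[of D "\<lambda>Y. Y \<inter> ?K \<in> \<C>"])
    fix Y e assume *: "e \<in> D - B" "Y \<inter> ?K \<in> \<C>"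
    have "F e \<inter> ?K = {} \<or> F e \<inter> ?K = F e" using label_fund by fastforce
    moreover have "F e \<in> \<C>" using fund_cycle fund_empty empty_cycle by (cases "e \<in> S - B") auto
    ultimately have "F e \<inter> ?K \<in> \<C>" using empty_cycle by auto
    then have "sym_diff (Y \<inter> ?K) (F e \<inter> ?K) \<in> \<C>" using * sym_diff_cycle by blast
    moreover have "sym_diff (Y \<inter> ?K) (F e \<inter> ?K) = sym_diff Y (F e) \<inter> ?K" by blast
    ultimately show "sym_diff Y (F e) \<inter> ?K \<in> \<C>" by simp
  qed (use assms circuit_cycle empty_cycle in auto)
  moreover have "D \<inter> ?K \<noteq> {}" using assms by blast
  ultimately have "D \<inter> ?K = D" using circuit_minimal[OF assms(1), of "D \<inter> ?K"] by blast
  then show ?thesis using assms(3) by (metis (mono_tags, lifting) IntD2 mem_Collect_eq)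
qed

text \<open>
  The form \<open>|X \<inter> Y| - |X| |Y|\<close> modulo 2 is bilinear in the cycles \<open>X\<close> and \<open>Y\<close>, so it is enough to
  evaluate it on fundamental circuits.
\<close>

theorem ex_odd_theta_iff:
  "(\<exists>A B P. odd_theta A B P) \<longleftrightarrow>
     (\<exists>e f g. L e = L f \<and> L f = L g \<and> odd (card (F g)) \<and>
       \<not> (odd (card (F e \<inter> F f)) \<longleftrightarrow> odd (card (F e)) \<and> odd (card (F f))))"
    (is "?theta \<longleftrightarrow> ?test")
proof
  assume ?theta
  then obtain A B' P where "odd_theta A B' P" by blast
  then have th: "theta A B' P" "odd (card A)" "odd (card B')" "even (card P)"
    by (auto simp: odd_theta_def)
  have fin: "finite A" "finite B'" "finite P" using theta_finite[OF th(1)] by auto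
  have disj: "A \<inter> B' = {}" "A \<inter> P = {}" "B' \<inter> P = {}" and ne: "A \<noteq> {}" using th(1) by (auto simp: theta_def)
  \<comment> \<open>The even circuit \<open>?D\<close> and the odd circuit \<open>?C\<close> share
    exactly the odd branch \<open>A\<close>, so the form is nonzero on this pair.\<close>
  let ?D = "A \<union> B'" and ?C = "A \<union> P"
  have circ: "circuit ?D" "circuit ?C" using theta_circuit th(1) theta_swap by blast+
  then have cyc: "?D \<in> \<C>" "?C \<in> \<C>" using circuit_cycle by blast+
  have D: "even (card ?D)" and C: "odd (card ?C)"
    using fin disj th(2-4) by (simp_all add: even_card_Un_disjoint)
  have "?C \<inter> ?D = A" using disj by blast
  then have CD: "odd (card (?C \<inter> ?D))" using th by simp
  obtain x where x: "x \<in> A" using ne by blast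
  have lab: "L e = L x" if "e \<in> ?C \<or> e \<in> ?D" for e
    using label_circuit circ x that by blast
  \<comment> \<open>Size modulo 2 is linear, so an odd cycle involves an odd fundamental
    circuit.\<close>
  have "\<exists>g\<in>?C. odd (card (F g))"
  proof (rule ccontr)
    assume no: "\<not> ?thesis"
    have "even (card ?C)"
    proof (rule fund_induct[of ?C "\<lambda>Y. even (card Y)"])
      fix Y e assume "Y \<in> \<C>" "e \<in> ?C - B" "even (card Y)"
      then show "even (card (sym_diff Y (F e)))"
        using even_card_sym_diff[of Y "F e"] finite_cycle finite_fund no by blast
    qed (use cyc in auto)
    then show False using C by blast
  qed
  then obtain g where g: "g \<in> ?C" "odd (card (F g))" by blast
  have "\<exists>e\<in>?C. \<exists>f\<in>?D. \<not> (odd (card (F e \<inter> F f)) \<longleftrightarrow> odd (card (F e)) \<and> odd (card (F f)))"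
  proof (rule ccontr)
    assume "\<not> ?thesis"
    then have no: "odd (card (F e \<inter> F f)) \<longleftrightarrow> odd (card (F e)) \<and> odd (card (F f))"
      if "e \<in> ?C" "f \<in> ?D" for e f using that by blast
    \<comment> \<open>Bilinearity is applied one argument at a time: here the second argument is a
      fundamental circuit, afterwards it is \<open>?C\<close>.\<close>
    have 1: "odd (card (?C \<inter> F f)) \<longleftrightarrow> odd (card ?C) \<and> odd (card (F f))" if "f \<in> ?D" for f
    proof (rule fund_induct[of ?C "\<lambda>Y. odd (card (Y \<inter> F f)) \<longleftrightarrow> odd (card Y) \<and> odd (card (F f))"])
      fix Y e assume "Y \<in> \<C>" "e \<in> ?C - B" "odd (card (Y \<inter> F f)) \<longleftrightarrow> odd (card Y) \<and> odd (card (F f))"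
      then show "odd (card (sym_diff Y (F e) \<inter> F f)) \<longleftrightarrow> odd (card (sym_diff Y (F e))) \<and> odd (card (F f))"
        using even_card_sym_diff[of Y "F e"] even_card_sym_diff_Int[of Y "F e" "F f"]
          finite_cycle[of Y] finite_fund[of e] no[of e f] that by blast
    qed (use cyc in auto)
    have "odd (card (?D \<inter> ?C)) \<longleftrightarrow> odd (card ?D) \<and> odd (card ?C)"
    proof (rule fund_induct[of ?D "\<lambda>Y. odd (card (Y \<inter> ?C)) \<longleftrightarrow> odd (card Y) \<and> odd (card ?C)"])
      fix Y e assume "Y \<in> \<C>" "e \<in> ?D - B" "odd (card (Y \<inter> ?C)) \<longleftrightarrow> odd (card Y) \<and> odd (card ?C)"
      moreover from this have "odd (card (F e \<inter> ?C)) \<longleftrightarrow> odd (card (F e)) \<and> odd (card ?C)"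
        using 1[of e] by (metis DiffD1 Int_commute)
      ultimately show "odd (card (sym_diff Y (F e) \<inter> ?C)) \<longleftrightarrow> odd (card (sym_diff Y (F e))) \<and> odd (card ?C)"
        using even_card_sym_diff[of Y "F e"] even_card_sym_diff_Int[of Y "F e" ?C]
          finite_cycle[of Y] finite_fund[of e] by blast
    qed (use cyc in auto)
    then show False using CD C D by (metis Int_commute)
  qed
  then show ?test using g lab by metis
next
  assume ?test
  then obtain e f g where lab: "L e = L f" "L f = L g" and g: "odd (card (F g))"
    and ef: "\<not> (odd (card (F e \<inter> F f)) \<longleftrightarrow> odd (card (F e)) \<and> odd (card (F f)))" by blast
  \<comment> \<open>An empty set would satisfy the tested equivalence, so the default value of
    \<open>F\<close> outside \<open>S - B\<close> cannot occur.\<close>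
  have "F e \<noteq> {}" "F f \<noteq> {}" "F g \<noteq> {}" using g ef by auto
  then have S: "e \<in> S - B" "f \<in> S - B" "g \<in> S - B" using fund_empty by blast+
  then have conn: "(g, e) \<in> connected" "(g, f) \<in> connected" using label_connected lab by auto
  show ?theta
  proof (rule ccontr)
    assume "\<not> ?theta"
    from circuits_intersection_parity[OF this fund_circuit[OF S(1)] fund_mem[OF S(1)]
        fund_circuit[OF S(2)] fund_mem[OF S(2)] fund_circuit[OF S(3)] g fund_mem[OF S(3)] conn]
    show False using ef by blast
  qed
qed

end

section \<open>Theta graphs\<close>

text \<open>Distinctness and membership in the graph are left out, so that concatenation and
  reversal can be treated before them.\<close>

definition walk :: "('v, 'e) pre_graph \<Rightarrow> 'v list \<Rightarrow> 'e list \<Rightarrow> bool" where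
  "walk G vs es \<longleftrightarrow> length vs = Suc (length es) \<and>
     (\<forall>i<length es. ends G (es ! i) = {vs ! i, vs ! Suc i})"

lemma is_path_walk:
  "is_path G vs es \<longleftrightarrow>
     walk G vs es \<and> distinct vs \<and> set vs \<subseteq> verts G \<and> set es \<subseteq> edges G"
  unfolding is_path_def walk_def by blast

lemma walk_append:
  assumes "walk G (vs @ [x]) es" "walk G (x # ws) fs"
  shows "walk G (vs @ x # ws) (es @ fs)"
  unfolding walk_def
proof (intro conjI allI impI)
  have len: "length vs = length es" "length ws = length fs" using assms by (auto simp: walk_def)
  then show "length (vs @ x # ws) = Suc (length (es @ fs))" by simp
  fix i assume i: "i < length (es @ fs)"
  show "ends G ((es @ fs) ! i) = {(vs @ x # ws) ! i, (vs @ x # ws) ! Suc i}"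
  proof (cases "i < length es")
    case True
    then have "ends G (es ! i) = {(vs @ [x]) ! i, (vs @ [x]) ! Suc i}"
      using assms by (simp add: walk_def)
    then show ?thesis using True len by (auto simp: nth_append nth_Cons split: nat.splits)
  next
    case False
    then have "ends G (fs ! (i - length es)) = {(x # ws) ! (i - length es), (x # ws) ! Suc (i - length es)}"
      using assms i by (simp add: walk_def)
    then show ?thesis using False len by (simp add: nth_append Suc_diff_le)
  qed
qed

lemma walk_rev:
  assumes "walk G vs es"
  shows "walk G (rev vs) (rev es)"
  unfolding walk_def
proof (intro conjI allI impI)
  have len: "length vs = Suc (length es)" using assms by (simp add: walk_def)
  then show "length (rev vs) = Suc (length (rev es))" by simp
  fix i assume i: "i < length (rev es)"
  then have "ends G (es ! (length es - Suc i)) = {vs ! (length es - Suc i), vs ! Suc (length es - Suc i)}"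
    using assms by (simp add: walk_def)
  moreover have "Suc (length es - Suc i) = length es - i" using i by simp
  ultimately show "ends G (rev es ! i) = {rev vs ! i, rev vs ! Suc i}"
    using i len by (auto simp: rev_nth)
qed

lemma is_path_rev: "is_path G vs es \<Longrightarrow> is_path G (rev vs) (rev es)"
  by (simp add: is_path_walk walk_rev)

lemma walk_edge_ends: "walk G vs es \<Longrightarrow> e \<in> set es \<Longrightarrow> ends G e \<subseteq> set vs"
  unfolding walk_def by (metis (no_types, lifting) Suc_less_eq in_set_conv_nth insertE less_SucI
      singletonD subsetI)

text \<open>Equal edges have equal pairs of ends, and in a list of distinct vertices a pair of
  neighbours determines its position.\<close>

lemma is_path_distinct_edges:
  assumes "is_path G vs es"
  shows "distinct es"
  unfolding distinct_conv_nth
proof (intro allI impI notI)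
  fix i j assume ij: "i < length es" "j < length es" "i \<noteq> j" "es ! i = es ! j"
  have len: "length vs = Suc (length es)" and d: "distinct vs" using assms by (auto simp: is_path_def)
  have "{vs ! i, vs ! Suc i} = {vs ! j, vs ! Suc j}"
    using assms ij unfolding is_path_def by metis
  then have "vs ! i = vs ! j \<or> vs ! i = vs ! Suc j \<and> vs ! Suc i = vs ! j"
    by (auto simp: doubleton_eq_iff)
  then show False
    using ij len d nth_eq_iff_index_eq[OF d] by (metis Suc_lessD Suc_mono less_Suc_eq n_not_Suc_n not_less_eq)
qed

text \<open>A subdivision prescribes the ends of a path only as a set, so the path may have to be
  reversed.\<close>

lemma path_orient:
  assumes "is_path G vs es" "es \<noteq> []" "{hd vs, last vs} = {x, y}"
  obtains js fs where "is_path G (x # js @ [y]) fs" "set js = inner_verts vs" "set fs = set es"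
    "length fs = length es"
proof -
  have "length vs \<ge> 2" using assms by (cases es) (auto simp: is_path_def)
  then obtain u js v where vs: "vs = u # js @ [v]"
    by (metis One_nat_def Suc_1 append_Nil append_butlast_last_id butlast.simps(2) le_SucI length_Cons
        list.exhaust list.size(3) not_less_eq_eq zero_le)
  have "inner_verts vs = set js" by (simp add: vs inner_verts_def)
  moreover have "x = u \<and> y = v \<or> x = v \<and> y = u" using assms(3) by (auto simp: vs doubleton_eq_iff)
  moreover have "is_path G (v # rev js @ [u]) (rev es)"
    using is_path_rev[OF assms(1)] by (simp add: vs)
  ultimately show thesis
    using that[of js es] that[of "rev js" "rev es"] assms(1) by (auto simp: vs)
qed

lemma cycle_of_two_paths:
  assumes p: "is_path G (u # js @ [v]) es" and q: "is_path G (u # ks @ [v]) fs"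
    and disj: "set js \<inter> set ks = {}" "set es \<inter> set fs = {}"
  shows "is_cycle G (u # js @ v # rev ks) (es @ rev fs)"
proof -
  let ?vs = "u # js @ v # rev ks" and ?es = "es @ rev fs"
  have len: "length es = Suc (length js)" "length fs = Suc (length ks)"
    using p q by (auto simp: is_path_def)
  have "walk G ((u # js) @ v # (rev ks @ [u])) ?es"
  proof (rule walk_append)
    show "walk G ((u # js) @ [v]) es" using p by (simp add: is_path_walk)
    show "walk G (v # rev ks @ [u]) (rev fs)"
      using walk_rev[of G "u # ks @ [v]" fs] q by (simp add: is_path_walk)
  qed
  \<comment> \<open>Repeating \<open>u\<close> at the end turns the cyclic successor into the plain
    one.\<close>
  then have w: "walk G (?vs @ [u]) ?es" by simp
  have "ends G (?es ! i) = {?vs ! i, ?vs ! (Suc i mod length ?es)}" if i: "i < length ?es" for i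
  proof -
    have lvs: "length ?vs = length ?es" using len by simp
    have e: "ends G (?es ! i) = {(?vs @ [u]) ! i, (?vs @ [u]) ! Suc i}"
      using w i unfolding walk_def by blast
    have "(?vs @ [u]) ! i = ?vs ! i" using i lvs by (metis nth_append)
    moreover have "(?vs @ [u]) ! Suc i = ?vs ! (Suc i mod length ?es)"
    proof (cases "Suc i = length ?es")
      case True
      then show ?thesis using lvs by (metis mod_self nth_Cons_0 nth_append_length)
    next
      case False
      then have "Suc i < length ?es" using i by simp
      then show ?thesis using lvs by (metis mod_less nth_append)
    qed
    ultimately show ?thesis using e by simp
  qed
  then show ?thesis
    unfolding is_cycle_def
    using p q disj len is_path_distinct_edges[OF p] is_path_distinct_edges[OF q]
    by (auto simp: is_path_def)
qed

text \<open>Apart from nonemptiness, this is all that is used of a cycle to locate it in a theta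
  graph.\<close>

lemma cycle_even_degree:
  assumes "is_cycle G vs es"
  shows "even (card {e \<in> set es. x \<in> ends G e})"
proof (cases "x \<in> set vs")
  case True
  let ?m = "length es"
  have m: "2 \<le> ?m" "length vs = ?m" and dv: "distinct vs" and de: "distinct es"
    and en: "\<And>i. i < ?m \<Longrightarrow> ends G (es ! i) = {vs ! i, vs ! (Suc i mod ?m)}"
    using assms by (auto simp: is_cycle_def)
  obtain j where j: "j < ?m" "vs ! j = x" using True m by (metis in_set_conv_nth)
  \<comment> \<open>The cyclic predecessor of \<open>j\<close>; it differs from \<open>j\<close>
    because a cycle has at least two edges.\<close>
  define k where "k = (if j = 0 then ?m - 1 else j - 1)"
  have k: "k < ?m" "Suc k mod ?m = j" "k \<noteq> j" using m j by (auto simp: k_def)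
  have kuniq: "i = k" if "i < ?m" "Suc i mod ?m = j" for i
    using that m by (cases "Suc i = ?m") (auto simp: k_def)
  have "{e \<in> set es. x \<in> ends G e} = {es ! j, es ! k}"
  proof (intro equalityI subsetI)
    fix e assume "e \<in> {e \<in> set es. x \<in> ends G e}"
    then obtain i where i: "i < ?m" "e = es ! i" "x \<in> ends G (es ! i)" by (auto simp: in_set_conv_nth)
    have lt: "Suc i mod ?m < ?m" using m by (intro mod_less_divisor) linarith
    have "vs ! i = vs ! j \<or> vs ! (Suc i mod ?m) = vs ! j" using i en j by auto
    then have "i = j \<or> Suc i mod ?m = j"
      using nth_eq_iff_index_eq[OF dv] i j m lt by metis
    then show "e \<in> {es ! j, es ! k}" using i kuniq by blast
  next
    fix e assume "e \<in> {es ! j, es ! k}"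
    then show "e \<in> {e \<in> set es. x \<in> ends G e}" using en[OF j(1)] en[OF k(1)] j k by auto
  qed
  moreover have "es ! j \<noteq> es ! k" using nth_eq_iff_index_eq[OF de] j k by auto
  ultimately show ?thesis by simp
next
  case False
  have "x \<notin> ends G e" if e: "e \<in> set es" for e
  proof -
    obtain i where i: "i < length es" "e = es ! i" using e by (auto simp: in_set_conv_nth)
    have "Suc i mod length es < length es" using i by (intro mod_less_divisor) linarith
    then show ?thesis using i False assms by (auto simp: is_cycle_def)
  qed
  then have "{e \<in> set es. x \<in> ends G e} = {}" by blast
  then show ?thesis by (simp only: card.empty even_zero)
qed

text \<open>At an inner vertex only the two path edges can belong to \<open>Z\<close>, so even
  degree puts both or neither into \<open>Z\<close>, and this propagates along the path.\<close>

lemma path_all_or_nothing: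
  assumes p: "is_path G (u # js @ [v]) es"
    and ev: "\<And>x. x \<in> set js \<Longrightarrow> even (card {e \<in> Z. x \<in> ends G e})"
    and inc: "\<And>x e. x \<in> set js \<Longrightarrow> e \<in> Z \<Longrightarrow> x \<in> ends G e \<Longrightarrow> e \<in> set es"
    and e: "e \<in> set es" "e \<in> Z"
  shows "set es \<subseteq> Z"
proof -
  let ?vs = "u # js @ [v]"
  have len: "length es = Suc (length js)" and d: "distinct ?vs"
    and en: "\<And>i. i < length es \<Longrightarrow> ends G (es ! i) = {?vs ! i, ?vs ! Suc i}"
    using p by (auto simp: is_path_def)
  have step: "es ! i \<in> Z \<longleftrightarrow> es ! Suc i \<in> Z" if i: "Suc i < length es" for i
  proof -
    let ?x = "?vs ! Suc i"
    have x: "?x \<in> set js" using i len by (auto simp: nth_append)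
    have "{e \<in> Z. ?x \<in> ends G e} = Z \<inter> {es ! i, es ! Suc i}"
    proof (intro equalityI subsetI)
      fix e assume e: "e \<in> {e \<in> Z. ?x \<in> ends G e}"
      then obtain k where k: "k < length es" "e = es ! k" using inc[OF x] by (auto simp: in_set_conv_nth)
      then have "?x = ?vs ! k \<or> ?x = ?vs ! Suc k" using e en by auto
      then have "Suc i = k \<or> Suc i = Suc k"
        using nth_eq_iff_index_eq[OF d, of "Suc i"] i k len by (metis Suc_less_eq less_SucI length_Cons length_append_singleton)
      then show "e \<in> Z \<inter> {es ! i, es ! Suc i}" using e k by auto
    next
      fix e assume "e \<in> Z \<inter> {es ! i, es ! Suc i}"
      then show "e \<in> {e \<in> Z. ?x \<in> ends G e}" using en[of i] en[of "Suc i"] i by auto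
    qed
    moreover have "es ! i \<noteq> es ! Suc i"
      using nth_eq_iff_index_eq[OF is_path_distinct_edges[OF p], of i "Suc i"] i by simp
    ultimately have "even (card (Z \<inter> {es ! i, es ! Suc i}))" "es ! i \<noteq> es ! Suc i" using ev[OF x] by auto
    then show ?thesis by (auto simp: Int_insert_right split: if_splits)
  qed
  have all: "es ! i \<in> Z \<longleftrightarrow> es ! 0 \<in> Z" if "i < length es" for i
    using that by (induction i) (use step in auto)
  show ?thesis using e all by (metis in_set_conv_nth subsetI)
qed

lemma path_first_edge:
  assumes p: "is_path G (u # js @ [v]) es" and "e \<in> set es" "u \<in> ends G e"
  shows "e = es ! 0"
proof -
  obtain i where i: "i < length es" "e = es ! i" using assms(2) by (auto simp: in_set_conv_nth)
  have "distinct (u # js @ [v])" and len: "length (u # js @ [v]) = Suc (length es)"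
    and "ends G e = {(u # js @ [v]) ! i, (u # js @ [v]) ! Suc i}"
    using p i by (auto simp: is_path_def)
  then have "(u # js @ [v]) ! 0 = (u # js @ [v]) ! i \<or> (u # js @ [v]) ! 0 = (u # js @ [v]) ! Suc i"
    using assms(3) by auto
  then have "i = 0"
    using nth_eq_iff_index_eq[OF \<open>distinct _\<close>, of 0] i len
    by (metis Suc_less_eq less_SucI nat.distinct(1) zero_less_Suc)
  then show ?thesis using i by simp
qed

lemma first_edge_incident:
  assumes "is_path G (u # js @ [v]) es"
  shows "es ! 0 \<in> set es \<and> u \<in> ends G (es ! 0)"
proof -
  have "0 < length es" using assms by (auto simp: is_path_def)
  moreover from this have "ends G (es ! 0) = {(u # js @ [v]) ! 0, (u # js @ [v]) ! Suc 0}"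
    using assms unfolding is_path_def by blast
  ultimately show ?thesis by simp
qed

text \<open>A cycle contains each path entirely or not at all. Even degree at \<open>u\<close> makes
  it use an even number of the three first edges, hence at least two of the paths.\<close>

lemma theta_graph_cycles:
  assumes p1: "is_path G (u # js1 @ [v]) es1" and p2: "is_path G (u # js2 @ [v]) es2"
    and p3: "is_path G (u # js3 @ [v]) es3"
    and dj: "set js1 \<inter> set js2 = {}" "set js1 \<inter> set js3 = {}" "set js2 \<inter> set js3 = {}"
    and de: "set es1 \<inter> set es2 = {}" "set es1 \<inter> set es3 = {}" "set es2 \<inter> set es3 = {}"
    and edges: "edges G = set es1 \<union> set es2 \<union> set es3"
  shows "(\<exists>vs es. is_cycle G vs es \<and> set es \<subseteq> F) \<longleftrightarrow>
    set es1 \<union> set es2 \<subseteq> F \<or> set es1 \<union> set es3 \<subseteq> F \<or> set es2 \<union> set es3 \<subseteq> F"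
proof
  assume "\<exists>vs es. is_cycle G vs es \<and> set es \<subseteq> F"
  then obtain vs es where c: "is_cycle G vs es" "set es \<subseteq> F" by blast
  let ?Z = "set es"
  have Z: "?Z \<subseteq> set es1 \<union> set es2 \<union> set es3" and ne: "?Z \<noteq> {}"
    using c edges by (auto simp: is_cycle_def)
  have ends1: "ends G e \<subseteq> insert u (insert v (set js1))" if "e \<in> set es1" for e
    using walk_edge_ends[of G "u # js1 @ [v]"] p1 that by (auto simp: is_path_walk)
  have ends2: "ends G e \<subseteq> insert u (insert v (set js2))" if "e \<in> set es2" for e
    using walk_edge_ends[of G "u # js2 @ [v]"] p2 that by (auto simp: is_path_walk)
  have ends3: "ends G e \<subseteq> insert u (insert v (set js3))" if "e \<in> set es3" for e
    using walk_edge_ends[of G "u # js3 @ [v]"] p3 that by (auto simp: is_path_walk)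
  have uv: "u \<notin> set js1" "v \<notin> set js1" "u \<notin> set js2" "v \<notin> set js2" "u \<notin> set js3" "v \<notin> set js3"
    using p1 p2 p3 by (auto simp: is_path_def)
  have a1: "set es1 \<subseteq> ?Z" if "e \<in> set es1" "e \<in> ?Z" for e
  proof (rule path_all_or_nothing[OF p1 cycle_even_degree[OF c(1)] _ that])
    fix x e assume x: "x \<in> set js1" "e \<in> ?Z" "x \<in> ends G e"
    moreover have "x \<notin> insert u (insert v (set js2))" "x \<notin> insert u (insert v (set js3))"
      using x uv dj by auto
    ultimately show "e \<in> set es1" using Z ends2[of e] ends3[of e] by blast
  qed
  have a2: "set es2 \<subseteq> ?Z" if "e \<in> set es2" "e \<in> ?Z" for e
  proof (rule path_all_or_nothing[OF p2 cycle_even_degree[OF c(1)] _ that])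
    fix x e assume x: "x \<in> set js2" "e \<in> ?Z" "x \<in> ends G e"
    moreover have "x \<notin> insert u (insert v (set js1))" "x \<notin> insert u (insert v (set js3))"
      using x uv dj by auto
    ultimately show "e \<in> set es2" using Z ends1[of e] ends3[of e] by blast
  qed
  have a3: "set es3 \<subseteq> ?Z" if "e \<in> set es3" "e \<in> ?Z" for e
  proof (rule path_all_or_nothing[OF p3 cycle_even_degree[OF c(1)] _ that])
    fix x e assume x: "x \<in> set js3" "e \<in> ?Z" "x \<in> ends G e"
    moreover have "x \<notin> insert u (insert v (set js1))" "x \<notin> insert u (insert v (set js2))"
      using x uv dj by auto
    ultimately show "e \<in> set es3" using Z ends1[of e] ends2[of e] by blast
  qed
  let ?a = "es1 ! 0" and ?b = "es2 ! 0" and ?c = "es3 ! 0"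
  have mem: "?a \<in> set es1" "?b \<in> set es2" "?c \<in> set es3"
    and uends: "u \<in> ends G ?a" "u \<in> ends G ?b" "u \<in> ends G ?c"
    using first_edge_incident[OF p1] first_edge_incident[OF p2] first_edge_incident[OF p3] by auto
  have "{e \<in> ?Z. u \<in> ends G e} = ?Z \<inter> {?a, ?b, ?c}"
  proof (intro equalityI subsetI)
    fix e assume "e \<in> {e \<in> ?Z. u \<in> ends G e}"
    then show "e \<in> ?Z \<inter> {?a, ?b, ?c}"
      using Z path_first_edge[OF p1, of e] path_first_edge[OF p2, of e] path_first_edge[OF p3, of e] by blast
  qed (use uends in blast)
  then have "even (card (?Z \<inter> {?a, ?b, ?c}))" using cycle_even_degree[OF c(1), of u] by simp
  moreover have "?a \<noteq> ?b" "?a \<noteq> ?c" "?b \<noteq> ?c" using mem de by (metis disjoint_iff)+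
  moreover have "?a \<in> ?Z \<or> ?b \<in> ?Z \<or> ?c \<in> ?Z"
  proof -
    obtain e where "e \<in> ?Z" using ne by (metis ex_in_conv)
    then show ?thesis using Z a1[of e] a2[of e] a3[of e] mem by blast
  qed
  ultimately have "?a \<in> ?Z \<and> ?b \<in> ?Z \<or> ?a \<in> ?Z \<and> ?c \<in> ?Z \<or> ?b \<in> ?Z \<and> ?c \<in> ?Z"
    by (auto simp: Int_insert_right split: if_splits)
  then show "set es1 \<union> set es2 \<subseteq> F \<or> set es1 \<union> set es3 \<subseteq> F \<or> set es2 \<union> set es3 \<subseteq> F"
    using a1[OF mem(1)] a2[OF mem(2)] a3[OF mem(3)] c(2) by blast
next
  assume "set es1 \<union> set es2 \<subseteq> F \<or> set es1 \<union> set es3 \<subseteq> F \<or> set es2 \<union> set es3 \<subseteq> F"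
  then show "\<exists>vs es. is_cycle G vs es \<and> set es \<subseteq> F"
    using cycle_of_two_paths[OF p1 p2 dj(1) de(1)] cycle_of_two_paths[OF p1 p3 dj(2) de(2)]
      cycle_of_two_paths[OF p2 p3 dj(3) de(3)] by (metis set_append set_rev)
qed

text \<open>
  The edges of \<open>C\<^sub>3\<^sup>+\<close> numbered 0 and 3 are parallel, and its edges 2 and 1 form a path with the same
  ends.
\<close>

lemma C3_plus_subdivision_indep:
  assumes inj: "inj_on \<phi> {0, 1, 2 :: nat}"
    and path: "\<And>e. e \<in> edges C3_plus \<Longrightarrow> is_path G (vs e) (es e) \<and> odd (length (es e)) \<and>
           {hd (vs e), last (vs e)} = \<phi> ` ends C3_plus e \<and>
           inner_verts (vs e) \<inter> \<phi> ` {0, 1, 2} = {}"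
    and disj: "\<And>e f. e \<in> edges C3_plus \<Longrightarrow> f \<in> edges C3_plus \<Longrightarrow> e \<noteq> f \<Longrightarrow>
           inner_verts (vs e) \<inter> inner_verts (vs f) = {} \<and> set (es e) \<inter> set (es f) = {}"
    and edges: "edges G = (\<Union>e\<in>edges C3_plus. set (es e))"
    and F: "F \<subseteq> edges G"
  shows "indep (cycle_matroid G) F \<longleftrightarrow>
    \<not> (set (es 0) \<union> set (es 3) \<subseteq> F \<or> set (es 0) \<union> (set (es 1) \<union> set (es 2)) \<subseteq> F \<or>
       set (es 3) \<union> (set (es 1) \<union> set (es 2)) \<subseteq> F)"
proof -
  have E: "0 \<in> edges C3_plus" "1 \<in> edges C3_plus" "2 \<in> edges C3_plus" "3 \<in> edges C3_plus"
    and E': "edges C3_plus = {0, 1, 2, 3}"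
    and en: "ends C3_plus 0 = {0, 1}" "ends C3_plus 1 = {1, 2}" "ends C3_plus 2 = {0, 2}"
      "ends C3_plus 3 = {0, 1}"
    by (auto simp: C3_plus_def)
  have ne: "es e \<noteq> []" if "e \<in> edges C3_plus" for e using path[OF that] by auto
  let ?u = "\<phi> 0" and ?v = "\<phi> 1" and ?w = "\<phi> 2"
  have uvw: "?u \<noteq> ?v" "?u \<noteq> ?w" "?v \<noteq> ?w" using inj by (auto simp: inj_on_def)
  have hl: "{hd (vs 0), last (vs 0)} = {?u, ?v}" "{hd (vs 1), last (vs 1)} = {?w, ?v}"
    "{hd (vs 2), last (vs 2)} = {?u, ?w}" "{hd (vs 3), last (vs 3)} = {?u, ?v}"
    using path[OF E(1)] path[OF E(2)] path[OF E(3)] path[OF E(4)]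
    by (simp_all only: en image_insert image_empty) (simp add: insert_commute)
  obtain js0 fs0 where 0: "is_path G (?u # js0 @ [?v]) fs0" "set js0 = inner_verts (vs 0)" "set fs0 = set (es 0)"
    using path_orient[of G "vs 0" "es 0"] path[OF E(1)] ne[OF E(1)] hl(1) by metis
  obtain js1 fs1 where 1: "is_path G (?w # js1 @ [?v]) fs1" "set js1 = inner_verts (vs 1)" "set fs1 = set (es 1)"
    using path_orient[of G "vs 1" "es 1"] path[OF E(2)] ne[OF E(2)] hl(2) by metis
  obtain js2 fs2 where 2: "is_path G (?u # js2 @ [?w]) fs2" "set js2 = inner_verts (vs 2)" "set fs2 = set (es 2)"
    using path_orient[of G "vs 2" "es 2"] path[OF E(3)] ne[OF E(3)] hl(3) by metis
  obtain js3 fs3 where 3: "is_path G (?u # js3 @ [?v]) fs3" "set js3 = inner_verts (vs 3)" "set fs3 = set (es 3)"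
    using path_orient[of G "vs 3" "es 3"] path[OF E(4)] ne[OF E(4)] hl(4) by metis
  have br: "set js0 \<inter> {?u, ?v, ?w} = {}" "set js1 \<inter> {?u, ?v, ?w} = {}" "set js2 \<inter> {?u, ?v, ?w} = {}"
    "set js3 \<inter> {?u, ?v, ?w} = {}"
    using path[OF E(1)] path[OF E(2)] path[OF E(3)] path[OF E(4)] by (simp_all add: 0 1 2 3)
  have dj: "set js0 \<inter> set js1 = {}" "set js0 \<inter> set js2 = {}" "set js0 \<inter> set js3 = {}"
    "set js3 \<inter> set js1 = {}" "set js3 \<inter> set js2 = {}" "set js2 \<inter> set js1 = {}"
    using disj E by (simp_all add: 0 1 2 3)
  have de: "set fs0 \<inter> set fs1 = {}" "set fs0 \<inter> set fs2 = {}" "set fs0 \<inter> set fs3 = {}"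
    "set fs3 \<inter> set fs1 = {}" "set fs3 \<inter> set fs2 = {}" "set fs2 \<inter> set fs1 = {}"
    using disj E by (simp_all add: 0 1 2 3)
  \<comment> \<open>The image \<open>?w\<close> of the vertex 2 becomes an inner vertex of the third
    path.\<close>
  have "walk G ((?u # js2) @ ?w # js1 @ [?v]) (fs2 @ fs1)"
    using 1(1) 2(1) by (intro walk_append) (simp_all add: is_path_walk)
  then have "is_path G (?u # (js2 @ ?w # js1) @ [?v]) (fs2 @ fs1)"
    using 1(1) 2(1) dj(6) br(2,3) uvw by (auto simp: is_path_walk)
  moreover have "edges G = set fs0 \<union> set fs3 \<union> set (fs2 @ fs1)"
    using edges by (auto simp: E' 0(3) 1(3) 2(3) 3(3))
  moreover have "set js0 \<inter> set (js2 @ ?w # js1) = {}" "set js3 \<inter> set (js2 @ ?w # js1) = {}"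
    using dj br by auto
  moreover have "set fs0 \<inter> set (fs2 @ fs1) = {}" "set fs3 \<inter> set (fs2 @ fs1) = {}"
    using de by auto
  ultimately have "(\<exists>vs es. is_cycle G vs es \<and> set es \<subseteq> F) \<longleftrightarrow>
      set fs0 \<union> set fs3 \<subseteq> F \<or> set fs0 \<union> set (fs2 @ fs1) \<subseteq> F \<or> set fs3 \<union> set (fs2 @ fs1) \<subseteq> F"
    using theta_graph_cycles[OF 0(1) 3(1) _ dj(3) _ _ de(3)] by blast
  then show ?thesis
    using F by (auto simp: cycle_matroid_def 0(3) 1(3) 2(3) 3(3))
qed

section \<open>Odd-\<open>C\<^sub>3\<^sup>+\<close>s and cycles of binary matroids\<close>

locale matroid_cycle_space = cycle_space \<C> for \<C> :: "'a set set" +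
  fixes M :: "'a pre_matroid"
  assumes cycle_ground: "Z \<in> \<C> \<Longrightarrow> Z \<subseteq> ground M"
    and indep_iff: "X \<subseteq> ground M \<Longrightarrow> indep M X \<longleftrightarrow> (\<forall>Z\<in>\<C>. Z \<subseteq> X \<longrightarrow> Z = {})"

text \<open>Over \<open>bit\<close> a coefficient vector is the indicator of its support, so linear
  dependencies among the columns are themselves sets, and the kernel of the matrix is the cycle
  space.\<close>

lemma binary_matroid_cycle_space:
  assumes "binary_matroid M"
  shows "\<exists>\<C>. matroid_cycle_space \<C> M"
proof -
  obtain r and A :: "nat \<Rightarrow> 'a \<Rightarrow> bit" where A: "represents r A M" and M: "matroid M"
    using assms by (auto simp: binary_matroid_def)
  have fin: "finite (ground M)" using M by (simp add: matroid_def)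
  define \<C> where "\<C> = {Z. Z \<subseteq> ground M \<and> (\<forall>i<r. (\<Sum>e\<in>Z. A i e) = 0)}"
  have "matroid_cycle_space \<C> M"
  proof
    show "finite Z" if "Z \<in> \<C>" for Z
      using that fin finite_subset by (auto simp: \<C>_def)
    show "{} \<in> \<C>" by (simp add: \<C>_def)
    show "Z \<subseteq> ground M" if "Z \<in> \<C>" for Z using that by (simp add: \<C>_def)
    show "sym_diff Y Z \<in> \<C>" if YZ: "Y \<in> \<C>" "Z \<in> \<C>" for Y Z
    proof -
      have f: "finite Y" "finite Z" using YZ fin finite_subset by (auto simp: \<C>_def)
      have "(\<Sum>e\<in>sym_diff Y Z. A i e) = 0" if "i < r" for i
      proof -
        have "(\<Sum>e\<in>sym_diff Y Z. A i e) = (\<Sum>e\<in>Y - Z. A i e) + (\<Sum>e\<in>Z - Y. A i e)"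
          using f by (intro sum.union_disjoint) auto
        moreover have "(\<Sum>e\<in>Y. A i e) = (\<Sum>e\<in>Y \<inter> Z. A i e) + (\<Sum>e\<in>Y - Z. A i e)"
          using f(1) by (rule sum.Int_Diff)
        moreover have "(\<Sum>e\<in>Z. A i e) = (\<Sum>e\<in>Y \<inter> Z. A i e) + (\<Sum>e\<in>Z - Y. A i e)"
          using f sum.Int_Diff[of Z "A i" Y] by (simp add: Int_commute)
        moreover have "(\<Sum>e\<in>Y. A i e) = 0" "(\<Sum>e\<in>Z. A i e) = 0" using YZ that by (auto simp: \<C>_def)
        \<comment> \<open>In characteristic 2 both \<open>y\<close> and \<open>z\<close> equal
          \<open>x\<close>, so they cancel.\<close>
        moreover have "y + z = 0" if "0 = x + y" "0 = x + z" for x y z :: bit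
          using that by (cases "x = 0"; cases "y = 0"; cases "z = 0") auto
        ultimately show ?thesis by metis
      qed
      then show ?thesis using YZ by (auto simp: \<C>_def)
    qed
    show "indep M X \<longleftrightarrow> (\<forall>Z\<in>\<C>. Z \<subseteq> X \<longrightarrow> Z = {})" if X: "X \<subseteq> ground M" for X
    proof -
      have fX: "finite X" using X fin finite_subset by blast
      have "columns_lin_indep r A X \<longleftrightarrow> (\<forall>Z\<in>\<C>. Z \<subseteq> X \<longrightarrow> Z = {})"
      proof
        assume L: "columns_lin_indep r A X"
        show "\<forall>Z\<in>\<C>. Z \<subseteq> X \<longrightarrow> Z = {}"
        proof (intro ballI impI)
          fix Z assume Z: "Z \<in> \<C>" "Z \<subseteq> X"
          define c :: "'a \<Rightarrow> bit" where "c e = of_bool (e \<in> Z)" for e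
          have "(\<Sum>e\<in>X. c e * A i e) = 0" if "i < r" for i
          proof -
            have "(\<Sum>e\<in>X. c e * A i e) = (\<Sum>e\<in>Z. A i e)"
              using Z fX by (intro sum.mono_neutral_cong_right) (auto simp: c_def)
            then show ?thesis using Z that by (simp add: \<C>_def)
          qed
          then have "\<forall>e\<in>X. c e = 0" using L by (auto simp: columns_lin_indep_def)
          then show "Z = {}" using Z by (auto simp: c_def)
        qed
      next
        assume R: "\<forall>Z\<in>\<C>. Z \<subseteq> X \<longrightarrow> Z = {}"
        show "columns_lin_indep r A X"
          unfolding columns_lin_indep_def
        proof (intro allI impI)
          fix c :: "'a \<Rightarrow> bit" assume c: "\<forall>i<r. (\<Sum>e\<in>X. c e * A i e) = 0"
          let ?Z = "{e \<in> X. c e \<noteq> 0}"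
          have "(\<Sum>e\<in>X. c e * A i e) = (\<Sum>e\<in>?Z. A i e)" for i
            using fX by (intro sum.mono_neutral_cong_right) auto
          then have "\<forall>i<r. (\<Sum>e\<in>?Z. A i e) = 0" using c by metis
          moreover have "?Z \<subseteq> ground M" using X by blast
          ultimately have "?Z \<in> \<C>" unfolding \<C>_def by blast
          then have "?Z = {}" by (rule R[rule_format]) (rule Collect_restrict)
          then show "\<forall>e\<in>X. c e = 0" by simp
        qed
      qed
      then show ?thesis using A X by (simp add: represents_def)
    qed
  qed
  then show ?thesis by blast
qed

context matroid_cycle_space
begin

text \<open>An isomorphism of matroids is given in terms of independent sets, so thetas have to be
  expressed through them before they can be transported.\<close>

lemma theta_iff_indep:
  assumes ne: "A \<noteq> {}" "B \<noteq> {}" "P \<noteq> {}" and disj: "A \<inter> B = {}" "A \<inter> P = {}" "B \<inter> P = {}"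
    and ground: "A \<union> B \<union> P \<subseteq> ground M"
  shows "theta A B P \<longleftrightarrow>
    (\<forall>Y\<subseteq>A \<union> B \<union> P. indep M Y \<longleftrightarrow> \<not> (A \<union> B \<subseteq> Y \<or> A \<union> P \<subseteq> Y \<or> B \<union> P \<subseteq> Y))"
proof
  assume th: "theta A B P"
  show "\<forall>Y\<subseteq>A \<union> B \<union> P. indep M Y \<longleftrightarrow> \<not> (A \<union> B \<subseteq> Y \<or> A \<union> P \<subseteq> Y \<or> B \<union> P \<subseteq> Y)"
  proof (intro allI impI)
    fix Y assume Y: "Y \<subseteq> A \<union> B \<union> P"
    have "Y \<subseteq> ground M" using Y ground by (rule subset_trans)
    then have iff: "indep M Y \<longleftrightarrow> (\<forall>Z\<in>\<C>. Z \<subseteq> Y \<longrightarrow> Z = {})" by (rule indep_iff)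
    have cyc: "A \<union> B \<in> \<C>" "A \<union> P \<in> \<C>" "B \<union> P \<in> \<C>" using th by (auto simp: theta_def)
    have only: "Z = {} \<or> Z = A \<union> B \<or> Z = A \<union> P \<or> Z = B \<union> P" if "Z \<in> \<C>" "Z \<subseteq> Y" for Z
      using th that Y unfolding theta_def by (metis subset_trans)
    show "indep M Y \<longleftrightarrow> \<not> (A \<union> B \<subseteq> Y \<or> A \<union> P \<subseteq> Y \<or> B \<union> P \<subseteq> Y)"
      unfolding iff using cyc only ne by (metis Un_empty)
  qed
next
  assume R: "\<forall>Y\<subseteq>A \<union> B \<union> P. indep M Y \<longleftrightarrow> \<not> (A \<union> B \<subseteq> Y \<or> A \<union> P \<subseteq> Y \<or> B \<union> P \<subseteq> Y)"
  have big: "A \<union> B \<subseteq> Z \<or> A \<union> P \<subseteq> Z \<or> B \<union> P \<subseteq> Z" if Z: "Z \<in> \<C>" "Z \<subseteq> A \<union> B \<union> P" "Z \<noteq> {}" for Z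
  proof -
    have "Z \<subseteq> ground M" using Z ground by blast
    then have "\<not> indep M Z" using Z indep_iff by blast
    then show ?thesis using R Z by blast
  qed
  have ex: "\<exists>Z\<in>\<C>. Z \<subseteq> Y \<and> Z \<noteq> {}"
    if "Y \<subseteq> A \<union> B \<union> P" "A \<union> B \<subseteq> Y \<or> A \<union> P \<subseteq> Y \<or> B \<union> P \<subseteq> Y" for Y
  proof -
    have "\<not> indep M Y" using R that by blast
    moreover have "Y \<subseteq> ground M" using that ground by blast
    ultimately show ?thesis using indep_iff by blast
  qed
  have notin: "\<not> P \<subseteq> A \<union> B" "\<not> B \<subseteq> A \<union> P" "\<not> A \<subseteq> B \<union> P" using ne disj by blast+
  have cyc: "A \<union> B \<in> \<C>" "A \<union> P \<in> \<C>" "B \<union> P \<in> \<C>"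
  proof -
    obtain Z where Z: "Z \<in> \<C>" "Z \<subseteq> A \<union> B" "Z \<noteq> {}" using ex[of "A \<union> B"] by blast
    \<comment> \<open>The other two unions do not fit into \<open>A \<union> B\<close>.\<close>
    then have "A \<union> B \<subseteq> Z" using big[of Z] notin by blast
    then show "A \<union> B \<in> \<C>" using Z by (metis subset_antisym)
  next
    obtain Z where Z: "Z \<in> \<C>" "Z \<subseteq> A \<union> P" "Z \<noteq> {}" using ex[of "A \<union> P"] by blast
    then have "A \<union> P \<subseteq> Z" using big[of Z] notin by blast
    then show "A \<union> P \<in> \<C>" using Z by (metis subset_antisym)
  next
    obtain Z where Z: "Z \<in> \<C>" "Z \<subseteq> B \<union> P" "Z \<noteq> {}" using ex[of "B \<union> P"] by blast
    then have "B \<union> P \<subseteq> Z" using big[of Z] notin by blast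
    then show "B \<union> P \<in> \<C>" using Z by (metis subset_antisym)
  qed
  have "Z = {} \<or> Z = A \<union> B \<or> Z = A \<union> P \<or> Z = B \<union> P" if Z: "Z \<in> \<C>" "Z \<subseteq> A \<union> B \<union> P" for Z
  proof (cases "Z = {}")
    case False
    \<comment> \<open>The cycle \<open>Z - Y\<close> misses two of the branches, so it contains none
      of the three unions and must be empty.\<close>
    have eq: "Z = Y" if Y: "Y \<in> {A \<union> B, A \<union> P, B \<union> P}" "Y \<subseteq> Z" for Y
    proof -
      have "Z - Y \<in> \<C>"
        using sym_diff_cycle[of Z Y] Y cyc Z by (auto simp: Diff_eq_empty_iff[THEN iffD2])
      moreover have "\<not> (A \<union> B \<subseteq> Z - Y \<or> A \<union> P \<subseteq> Z - Y \<or> B \<union> P \<subseteq> Z - Y)"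
        using Y Z ne disj by auto
      ultimately have "Z - Y = {}" using big[of "Z - Y"] Z by blast
      then show ?thesis using Y by blast
    qed
    then show ?thesis using big[OF Z False] by blast
  qed simp
  then show "theta A B P" unfolding theta_def using ne disj cyc by blast
qed

text \<open>The branches are the preimages of the subdivided edges. \<open>P\<close> is even because
  it comes from two edges of the triangle, each replaced by an odd path.\<close>

lemma theta_of_odd_C3_plus:
  assumes "is_odd_C3_plus_of X M"
  shows "\<exists>A B P. odd_theta A B P \<and> X = A \<union> B \<union> P"
proof -
  from assms obtain G :: "(nat, nat) pre_graph" where X: "X \<subseteq> ground M"
    and G: "totally_odd_subdivision C3_plus G" and iso: "matroid_iso (restriction M X) (cycle_matroid G)"
    by (auto simp: is_odd_C3_plus_of_def odd_C3_plus_graph_def)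
  have V: "verts C3_plus = {0, 1, 2}" and E: "edges C3_plus = {0, 1, 2, 3}" by (auto simp: C3_plus_def)
  from G obtain \<phi> vs es where inj: "inj_on \<phi> {0, 1, 2}" and
    *: "\<forall>e\<in>edges C3_plus. is_path G (vs e) (es e) \<and> odd (length (es e)) \<and>
          {hd (vs e), last (vs e)} = \<phi> ` ends C3_plus e \<and> inner_verts (vs e) \<inter> \<phi> ` {0, 1, 2} = {}"
       "\<forall>e\<in>edges C3_plus. \<forall>f\<in>edges C3_plus. e \<noteq> f \<longrightarrow>
          inner_verts (vs e) \<inter> inner_verts (vs f) = {} \<and> set (es e) \<inter> set (es f) = {}" and
    edges: "edges G = (\<Union>e\<in>edges C3_plus. set (es e))"
    unfolding totally_odd_subdivision_def V by (elim exE conjE) (rule that, assumption+)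
  note path = bspec[OF *(1)] and disj = *(2)[THEN bspec, THEN bspec, THEN mp]
  from iso obtain f where bij: "bij_betw f X (edges G)"
    and f: "\<And>Y. Y \<subseteq> X \<Longrightarrow> indep M Y \<longleftrightarrow> indep (cycle_matroid G) (f ` Y)"
    by (auto simp: matroid_iso_def restriction_def cycle_matroid_def)
  have fi: "inj_on f X" and img: "f ` X = edges G" using bij by (auto simp: bij_betw_def)
  define pre where "pre D = {x \<in> X. f x \<in> D}" for D
  have fpre: "f ` pre D = D" if "D \<subseteq> edges G" for D using that img by (auto simp: pre_def)
  have cpre: "card (pre D) = card D" if "D \<subseteq> edges G" for D
    using card_image[of f "pre D"] fpre[OF that] fi by (metis (no_types, lifting) inj_on_subset mem_Collect_eq pre_def subsetI)
  have sub: "D \<subseteq> f ` Y \<longleftrightarrow> pre D \<subseteq> Y" if "D \<subseteq> edges G" "Y \<subseteq> X" for D Y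
  proof
    assume *: "D \<subseteq> f ` Y"
    show "pre D \<subseteq> Y"
    proof
      fix x assume x: "x \<in> pre D"
      then obtain y where "y \<in> Y" "f x = f y" using * by (auto simp: pre_def)
      then show "x \<in> Y" using x that fi by (auto simp: pre_def inj_on_def)
    qed
  next
    assume "pre D \<subseteq> Y"
    then show "D \<subseteq> f ` Y" using fpre[OF that(1)] by blast
  qed
  let ?a = "set (es 0)" and ?b = "set (es 3)" and ?p = "set (es 1) \<union> set (es 2)"
  have edges': "edges G = ?a \<union> ?b \<union> ?p" using edges by (auto simp: E)
  have de: "?a \<inter> ?b = {}" "?a \<inter> ?p = {}" "?b \<inter> ?p = {}" "set (es 1) \<inter> set (es 2) = {}"
    using disj[of 0 3] disj[of 0 1] disj[of 0 2] disj[of 3 1] disj[of 3 2] disj[of 1 2] by (auto simp: E)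
  have len: "card (set (es e)) = length (es e)" if "e \<in> edges C3_plus" for e
    using is_path_distinct_edges path[OF that] distinct_card by blast
  have odd: "odd (card (set (es e)))" if "e \<in> edges C3_plus" for e
    using len[OF that] path[OF that] by simp
  have pp: "even (card ?p)"
    using even_card_Un_disjoint[of "set (es 1)" "set (es 2)"] de(4) odd by (simp add: E)
  let ?A = "pre ?a" and ?B = "pre ?b" and ?P = "pre ?p"
  have ne: "?a \<noteq> {}" "?b \<noteq> {}" "?p \<noteq> {}" using odd[of 0] odd[of 3] odd[of 1] by (auto simp: E)
  have neP: "?A \<noteq> {}" "?B \<noteq> {}" "?P \<noteq> {}"
    using ne fpre edges' by (metis Un_upper1 Un_upper2 image_is_empty subset_trans)+
  have djP: "?A \<inter> ?B = {}" "?A \<inter> ?P = {}" "?B \<inter> ?P = {}" using de by (auto simp: pre_def)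
  have XP: "X = ?A \<union> ?B \<union> ?P" using img edges' by (auto simp: pre_def)
  have preU: "pre (C \<union> D) = pre C \<union> pre D" for C D by (auto simp: pre_def)
  have "theta ?A ?B ?P"
    unfolding theta_iff_indep[OF neP djP X[unfolded XP]]
  proof (intro allI impI)
    fix Y assume "Y \<subseteq> ?A \<union> ?B \<union> ?P"
    then have Y: "Y \<subseteq> X" using XP by simp
    then have "f ` Y \<subseteq> edges G" using img by blast
    then have "indep M Y \<longleftrightarrow> \<not> (?a \<union> ?b \<subseteq> f ` Y \<or> ?a \<union> ?p \<subseteq> f ` Y \<or> ?b \<union> ?p \<subseteq> f ` Y)"
      using C3_plus_subdivision_indep[OF inj path disj edges] f[OF Y] by blast
    moreover have "?a \<union> ?b \<subseteq> edges G" "?a \<union> ?p \<subseteq> edges G" "?b \<union> ?p \<subseteq> edges G" using edges' by blast+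
    ultimately show "indep M Y \<longleftrightarrow> \<not> (?A \<union> ?B \<subseteq> Y \<or> ?A \<union> ?P \<subseteq> Y \<or> ?B \<union> ?P \<subseteq> Y)"
      using sub[OF _ Y] preU by metis
  qed
  moreover have "odd (card ?A)" "odd (card ?B)" "even (card ?P)"
  proof -
    have "?a \<subseteq> edges G" "?b \<subseteq> edges G" "?p \<subseteq> edges G" using edges' by blast+
    then have "card ?A = card ?a" "card ?B = card ?b" "card ?P = card ?p" using cpre by blast+
    then show "odd (card ?A)" "odd (card ?B)" "even (card ?P)"
      using odd[of 0] odd[of 3] pp by (simp_all add: E)
  qed
  ultimately show ?thesis using XP odd_theta_def by blast
qed

end

text \<open>
  The branches of the theta become the subdivided edges of \<open>C\<^sub>3\<^sup>+\<close>, where the even branch is split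
  after its first element; the inner vertex at the end of the edge \<open>e\<close> is named \<open>e + 3\<close>.
\<close>

lemma odd_C3_plus_of_theta:
  assumes "matroid_cycle_space \<C> M" "cycle_space.odd_theta \<C> A B P"
    and X: "X = A \<union> B \<union> (P :: nat set)"
  shows "is_odd_C3_plus_of X M"
proof -
  interpret matroid_cycle_space \<C> M by fact
  have th: "theta A B P" "odd (card A)" "odd (card B)" "even (card P)"
    using assms(2) by (auto simp: odd_theta_def)
  have ne: "A \<noteq> {}" "B \<noteq> {}" "P \<noteq> {}" and dj: "A \<inter> B = {}" "A \<inter> P = {}" "B \<inter> P = {}"
    using th(1) by (auto simp: theta_def)
  have "A \<union> B \<in> \<C>" "A \<union> P \<in> \<C>" using th(1) by (auto simp: theta_def)
  then have gr: "A \<union> B \<union> P \<subseteq> ground M" using cycle_ground by blast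
  have fin: "finite A" "finite B" "finite P" using theta_finite[OF th(1)] by auto
  obtain la lb lp where l: "set la = A" "distinct la" "set lb = B" "distinct lb" "set lp = P" "distinct lp"
    using finite_distinct_list fin by metis
  \<comment> \<open>\<open>P\<close> is even and nonempty, so one element and the remaining ones
    both give paths of odd length.\<close>
  obtain p lp' where lp: "lp = p # lp'" using l ne by (cases lp) auto
  have P: "P = insert p (set lp')" and plp: "p \<notin> set lp'" "distinct lp'" using l lp by auto
  define es where "es k = (if k = 0 then la else if k = 3 then lb else if k = 1 then [p] else lp')" for k :: nat
  define st where "st k = (if k = 1 then 1 else 0 :: nat)" for k :: nat
  define fi where "fi k = (if k = 1 \<or> k = 2 then 2 else 1 :: nat)" for k :: nat
  \<comment> \<open>\<open>butlast\<close>, because the last edge ends at the branch vertex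
    \<open>fi k\<close>; the shift by 3 keeps inner vertices apart from the branch vertices 0, 1,
    2.\<close>
  define vs where "vs k = st k # map (\<lambda>e. e + 3) (butlast (es k)) @ [fi k]" for k
  \<comment> \<open>The ends of an edge are read off from its position in the lists, which is unique
    because the lists are distinct and disjoint.\<close>
  define pos where "pos e = (SOME ki. fst ki < 4 \<and> snd ki < length (es (fst ki)) \<and> es (fst ki) ! snd ki = e)" for e
  define G :: "(nat, nat) pre_graph" where
    "G = \<lparr>verts = {0, 1, 2} \<union> (\<Union>k\<in>{0, 1, 2, 3}. inner_verts (vs k)),
          edges = (\<Union>k\<in>{0, 1, 2, 3}. set (es k)),
          ends = (\<lambda>e. {vs (fst (pos e)) ! snd (pos e), vs (fst (pos e)) ! Suc (snd (pos e))})\<rparr>"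
  have V: "verts C3_plus = {0, 1, 2}" and E: "edges C3_plus = {0, 1, 2, 3}" by (auto simp: C3_plus_def)
  have k4: "k < 4 \<longleftrightarrow> k \<in> {0, 1, 2, 3}" for k :: nat by auto
  have odd_len: "odd (length (es k))" if "k \<in> {0, 1, 2, 3}" for k
  proof -
    have "length la = card A" "length lb = card B" "Suc (length lp') = card P"
      using l lp distinct_card by fastforce+
    moreover from this have "odd (length lp')" using th(4) by (metis even_Suc)
    ultimately show ?thesis using th that by (auto simp: es_def)
  qed
  have des: "distinct (es k)" for k using l plp by (auto simp: es_def)
  have disj: "set (es k) \<inter> set (es m) = {}" if "k \<in> {0, 1, 2, 3}" "m \<in> {0, 1, 2, 3}" "k \<noteq> m" for k m
    using that l dj plp P by (auto simp: es_def)
  have inner: "inner_verts (vs k) = (\<lambda>e. e + 3) ` set (butlast (es k))" for k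
    by (simp add: vs_def inner_verts_def)
  have inner_sub: "inner_verts (vs k) \<subseteq> (\<lambda>e. e + 3) ` set (es k)" for k
    unfolding inner by (auto dest: in_set_butlastD)
  have disj_inner: "inner_verts (vs k) \<inter> inner_verts (vs m) = {}"
    if "k \<in> {0, 1, 2, 3}" "m \<in> {0, 1, 2, 3}" "k \<noteq> m" for k m
  proof -
    have "(\<lambda>e. e + 3) ` set (es k) \<inter> (\<lambda>e. e + 3) ` set (es m) = {}"
      using disj[OF that] by auto
    then show ?thesis using inner_sub[of k] inner_sub[of m] by (metis Int_mono subset_empty)
  qed
  have small: "st k < 3" "fi k < 3" "st k \<noteq> fi k" for k by (auto simp: st_def fi_def)
  have dvs: "distinct (vs k)" for k
    using small[of k] des[of k] by (auto simp: vs_def distinct_map distinct_butlast)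
  have lvs: "length (vs k) = Suc (length (es k))" if "k \<in> {0, 1, 2, 3}" for k
  proof -
    have "es k \<noteq> []" using odd_len[OF that] by auto
    then show ?thesis by (simp add: vs_def)
  qed
  have pos: "pos (es k ! i) = (k, i)" if k: "k \<in> {0, 1, 2, 3}" and i: "i < length (es k)" for k i
    unfolding pos_def
  proof (rule some_equality)
    show "fst (k, i) < 4 \<and> snd (k, i) < length (es (fst (k, i))) \<and> es (fst (k, i)) ! snd (k, i) = es k ! i"
      using k i by auto
    fix mj assume *: "fst mj < 4 \<and> snd mj < length (es (fst mj)) \<and> es (fst mj) ! snd mj = es k ! i"
    then have m: "fst mj \<in> {0, 1, 2, 3}" unfolding k4 by blast
    have "es k ! i \<in> set (es k) \<inter> set (es (fst mj))" using * i by (metis IntI nth_mem)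
    then have "fst mj = k" using disj[OF m k] by blast
    moreover from this have "snd mj = i" using * i nth_eq_iff_index_eq[OF des[of k]] by auto
    ultimately show "mj = (k, i)" by (simp add: prod_eq_iff)
  qed
  have en: "ends G (es k ! i) = {vs k ! i, vs k ! Suc i}" if "k \<in> {0, 1, 2, 3}" "i < length (es k)" for k i
    using pos[OF that] by (simp add: G_def)
  have svs: "set (vs k) \<subseteq> verts G" if "k \<in> {0, 1, 2, 3}" for k
  proof -
    have "set (vs k) = {st k, fi k} \<union> inner_verts (vs k)" by (auto simp: vs_def inner_verts_def)
    moreover have "st k \<in> {0, 1, 2}" "fi k \<in> {0, 1, 2}" by (auto simp: st_def fi_def)
    ultimately show ?thesis using that unfolding G_def by fastforce
  qed
  have path: "is_path G (vs k) (es k)" if "k \<in> {0, 1, 2, 3}" for k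
    unfolding is_path_def using lvs[OF that] dvs svs[OF that] en[OF that] that by (auto simp: G_def)
  have edges: "edges G = (\<Union>e\<in>edges C3_plus. set (es e))" by (simp add: G_def E)
  have edgesX: "edges G = A \<union> B \<union> P" using l lp by (auto simp: G_def es_def)
  have props: "is_path G (vs k) (es k) \<and> odd (length (es k)) \<and>
      {hd (vs k), last (vs k)} = id ` ends C3_plus k \<and> inner_verts (vs k) \<inter> id ` {0, 1, 2} = {}"
    if "k \<in> edges C3_plus" for k
  proof -
    have "inner_verts (vs k) \<inter> {0, 1, 2} = {}" using inner by auto
    moreover have "{hd (vs k), last (vs k)} = ends C3_plus k"
      using that by (auto simp: vs_def E st_def fi_def C3_plus_def)
    ultimately show ?thesis using path odd_len that by (simp add: E)
  qed
  have disj': "inner_verts (vs k) \<inter> inner_verts (vs m) = {} \<and> set (es k) \<inter> set (es m) = {}"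
    if "k \<in> edges C3_plus" "m \<in> edges C3_plus" "k \<noteq> m" for k m
    by (intro conjI disj disj_inner that[unfolded E])
  have "totally_odd_subdivision C3_plus G"
    unfolding totally_odd_subdivision_def
  proof (intro exI conjI ballI impI)
    show "inj_on id (verts C3_plus)" by simp
    show "verts G = id ` verts C3_plus \<union> (\<Union>e\<in>edges C3_plus. inner_verts (vs e))"
      by (simp add: G_def E V)
    show "edges G = (\<Union>e\<in>edges C3_plus. set (es e))" by (rule edges)
  qed (use props disj' V in blast)+
  moreover have "multigraph G"
    unfolding multigraph_def
  proof (intro conjI ballI)
    show "finite (verts G)" "finite (edges G)" by (auto simp: G_def inner)
    fix e assume "e \<in> edges G"
    then obtain k i where k: "k \<in> {0, 1, 2, 3}" "i < length (es k)" "e = es k ! i"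
      by (auto simp: G_def in_set_conv_nth)
    have ends: "ends G e = {vs k ! i, vs k ! Suc i}" using en[OF k(1,2)] k(3) by simp
    moreover have "vs k ! i \<in> set (vs k)" "vs k ! Suc i \<in> set (vs k)"
      using lvs[OF k(1)] k(2) by (auto intro: nth_mem)
    ultimately show "ends G e \<subseteq> verts G" using svs[OF k(1)] by auto
    have "vs k ! i \<noteq> vs k ! Suc i" using nth_eq_iff_index_eq[OF dvs[of k]] lvs[OF k(1)] k(2) by simp
    then show "card (ends G e) = 2" using ends by simp
  qed
  moreover have "matroid_iso (restriction M X) (cycle_matroid G)"
    unfolding matroid_iso_def
  proof (intro exI[of _ id] conjI allI impI)
    show "bij_betw id (ground (restriction M X)) (ground (cycle_matroid G))"
      using edgesX X by (simp add: restriction_def cycle_matroid_def)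
    fix Y assume "Y \<subseteq> ground (restriction M X)"
    then have Y: "Y \<subseteq> A \<union> B \<union> P" using X by (simp add: restriction_def)
    have "set (es 0) = A" "set (es 3) = B" "set (es 1) \<union> set (es 2) = P"
      using l P by (auto simp: es_def)
    then have "indep (cycle_matroid G) Y \<longleftrightarrow> \<not> (A \<union> B \<subseteq> Y \<or> A \<union> P \<subseteq> Y \<or> B \<union> P \<subseteq> Y)"
      using C3_plus_subdivision_indep[OF _ props disj' edges, of Y] Y edgesX by simp
    moreover have "indep M Y \<longleftrightarrow> \<not> (A \<union> B \<subseteq> Y \<or> A \<union> P \<subseteq> Y \<or> B \<union> P \<subseteq> Y)"
      using theta_iff_indep[OF ne dj gr] th(1) Y by blast
    ultimately show "indep (restriction M X) Y \<longleftrightarrow> indep (cycle_matroid G) (id ` Y)"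
      using Y X by (simp add: restriction_def)
  qed
  ultimately show ?thesis
    unfolding is_odd_C3_plus_of_def odd_C3_plus_graph_def using gr X by blast
qed

section \<open>Programs with bounded loops\<close>

text \<open>
  For \<open>While\<close> this bounds the running time only if the loop is executed at most \<open>n\<close> times.
\<close>

fun cost :: "nat \<Rightarrow> com \<Rightarrow> nat" where
  "cost n Skip = 1"
| "cost n (Assign x e) = 1"
| "cost n (Store a e f) = 1"
| "cost n (Query x a) = n + 1"
| "cost n (Seq c d) = cost n c + cost n d"
| "cost n (Cond b c d) = cost n c + cost n d + 1"
| "cost n (While b c) = n * (cost n c + 1) + 1"

lemma cost_poly: "\<exists>p. \<forall>n. cost n c = poly p n"
proof (induction c)
  case (Query x a)
  have "cost n (Query x a) = poly [:1, 1:] n" for n by simp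
  then show ?case by blast
next
  case (Seq c d)
  then obtain p q where "\<And>n. cost n c = poly p n" "\<And>n. cost n d = poly q n" by blast
  then have "cost n (Seq c d) = poly (p + q) n" for n by simp
  then show ?case by blast
next
  case (Cond b c d)
  then obtain p q where "\<And>n. cost n c = poly p n" "\<And>n. cost n d = poly q n" by blast
  then have "cost n (Cond b c d) = poly (p + q + 1) n" for n by simp
  then show ?case by blast
next
  case (While b c)
  then obtain p where "\<And>n. cost n c = poly p n" by blast
  then have "cost n (While b c) = poly ([:0, 1:] * (p + 1) + 1) n" for n by simp
  then show ?case by blast
qed (auto intro: exI[of _ 1])

section \<open>Frame conditions and rules for total correctness with time bounds\<close>

fun mod_regs :: "com \<Rightarrow> vname set" where
  "mod_regs (Assign x e) = {x}"
| "mod_regs (Query x a) = {x}"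
| "mod_regs (Seq c d) = mod_regs c \<union> mod_regs d"
| "mod_regs (Cond b c d) = mod_regs c \<union> mod_regs d"
| "mod_regs (While b c) = mod_regs c"
| "mod_regs _ = {}"

fun mod_arrs :: "com \<Rightarrow> aname set" where
  "mod_arrs (Store a e f) = {a}"
| "mod_arrs (Seq c d) = mod_arrs c \<union> mod_arrs d"
| "mod_arrs (Cond b c d) = mod_arrs c \<union> mod_arrs d"
| "mod_arrs (While b c) = mod_arrs c"
| "mod_arrs _ = {}"

lemma reg_set_reg [simp]: "reg (set_reg x k s) = (reg s)(x := k)"
  and arr_set_reg [simp]: "arr (set_reg x k s) = arr s"
  and reg_set_arr [simp]: "reg (set_arr a i k s) = reg s"
  and arr_set_arr [simp]: "arr (set_arr a i k s) = (arr s)(a := (arr s a)(i := k))"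
  by (simp_all add: set_reg_def set_arr_def)

lemma array_set_set_reg [simp]: "array_set n a (set_reg x k s) = array_set n a s"
  by (simp add: array_set_def)

lemma array_set_set_arr [simp]:
  "i < n \<Longrightarrow> array_set n a (set_arr b i k s) =
     (if a = b then if k = 0 then array_set n a s - {i} else insert i (array_set n a s)
      else array_set n a s)"
  by (auto simp: array_set_def)

lemma array_set_iff: "i < n \<Longrightarrow> i \<in> array_set n a s \<longleftrightarrow> arr s a i \<noteq> 0"
  by (simp add: array_set_def)

lemma array_set_subset: "array_set n a s \<subseteq> {..<n}"
  by (auto simp: array_set_def)

definition unchanged :: "com \<Rightarrow> state \<Rightarrow> state \<Rightarrow> bool" where
  "unchanged c s s' \<longleftrightarrow> (\<forall>x. x \<notin> mod_regs c \<longrightarrow> reg s' x = reg s x) \<and>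
     (\<forall>a. a \<notin> mod_arrs c \<longrightarrow> arr s' a = arr s a)"

lemma unchanged_reg: "unchanged c s s' \<Longrightarrow> x \<notin> mod_regs c \<Longrightarrow> reg s' x = reg s x"
  by (simp add: unchanged_def)

lemma unchanged_arr: "unchanged c s s' \<Longrightarrow> a \<notin> mod_arrs c \<Longrightarrow> arr s' a = arr s a"
  by (simp add: unchanged_def)

lemma unchanged_array_set:
  "unchanged c s s' \<Longrightarrow> a \<notin> mod_arrs c \<Longrightarrow> array_set n a s' = array_set n a s"
  by (simp add: unchanged_def array_set_def)

lemma exec_unchanged: "exec orc n c s t q s' \<Longrightarrow> unchanged c s s'"
  by (induction rule: exec.induct) (auto simp: unchanged_def)

text \<open>Each call is charged at least one step, so a time bound also bounds the number of
  calls.\<close>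

lemma exec_calls_le_time: "exec orc n c s t q s' \<Longrightarrow> q \<le> t"
  by (induction rule: exec.induct) auto

text \<open>Total correctness with the time bound built in. As \<open>cost\<close> is read off from
  the program text, the proofs of concrete programs never mention time.\<close>

definition runs :: "(nat set \<Rightarrow> bool) \<Rightarrow> nat \<Rightarrow> com \<Rightarrow> state \<Rightarrow> (state \<Rightarrow> bool) \<Rightarrow> bool" where
  "runs orc n c s Q \<longleftrightarrow> (\<exists>t q s'. exec orc n c s t q s' \<and> t \<le> cost n c \<and> Q s')"

text \<open>The frame condition is supplied here, so specifications only describe what a program
  computes.\<close>

lemma runs_conseq:
  assumes "runs orc n c s P" "\<And>s'. P s' \<Longrightarrow> unchanged c s s' \<Longrightarrow> Q s'"
  shows "runs orc n c s Q"
  using assms exec_unchanged unfolding runs_def by blast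

lemma runs_Skip: "Q s \<Longrightarrow> runs orc n Skip s Q"
  unfolding runs_def by (metis cost.simps(1) exec_Skip order_refl)

lemma runs_Assign: "Q (set_reg x (aval e s) s) \<Longrightarrow> runs orc n (Assign x e) s Q"
  unfolding runs_def by (metis cost.simps(2) exec_Assign order_refl)

lemma runs_Store: "Q (set_arr a (aval e s) (aval f s) s) \<Longrightarrow> runs orc n (Store a e f) s Q"
  unfolding runs_def by (metis cost.simps(3) exec_Store order_refl)

lemma runs_Query:
  "Q (set_reg x (if orc (array_set n a s) then 1 else 0) s) \<Longrightarrow> runs orc n (Query x a) s Q"
  unfolding runs_def by (metis cost.simps(4) exec_Query order_refl)

lemma runs_Seq:
  assumes "runs orc n c s (\<lambda>s'. runs orc n d s' Q)"
  shows "runs orc n (Seq c d) s Q"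
proof -
  obtain t q s' t' q' s'' where "exec orc n c s t q s'" "exec orc n d s' t' q' s''"
    "t \<le> cost n c" "t' \<le> cost n d" "Q s''"
    using assms unfolding runs_def by blast
  moreover from this have "exec orc n (Seq c d) s (t + t') (q + q') s''" by (blast intro: exec_Seq)
  ultimately show ?thesis unfolding runs_def
    by (intro exI[of _ "t + t'"] exI[of _ "q + q'"] exI[of _ s'']) simp
qed

lemma runs_Cond:
  assumes "bval b s \<Longrightarrow> runs orc n c s Q" "\<not> bval b s \<Longrightarrow> runs orc n d s Q"
  shows "runs orc n (Cond b c d) s Q"
proof (cases "bval b s")
  case True
  then obtain t q s' where "exec orc n c s t q s'" "t \<le> cost n c" "Q s'"
    using assms unfolding runs_def by blast
  moreover from this have "exec orc n (Cond b c d) s (t + 1) q s'" using True by (blast intro: exec_CondTrue)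
  ultimately show ?thesis unfolding runs_def by fastforce
next
  case False
  then obtain t q s' where "exec orc n d s t q s'" "t \<le> cost n d" "Q s'"
    using assms unfolding runs_def by blast
  moreover from this have "exec orc n (Cond b c d) s (t + 1) q s'" using False by (blast intro: exec_CondFalse)
  ultimately show ?thesis unfolding runs_def by fastforce
qed

text \<open>All loops share the bound in register 0. As long as the body leaves \<open>x\<close> and
  register 0 alone, there are exactly \<open>n\<close> passes, the number that \<open>cost\<close>
  assumes.\<close>

definition For :: "vname \<Rightarrow> com \<Rightarrow> com" where
  "For x c = Seq (Assign x (Const 0))
     (While (Less (Reg x) (Reg 0)) (Seq c (Assign x (Plus (Reg x) (Const 1)))))"

lemma mod_For [simp]:
  "mod_regs (For x c) = insert x (mod_regs c)" "mod_arrs (For x c) = mod_arrs c"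
  by (auto simp: For_def)

lemma runs_For:
  assumes n: "reg s 0 = n" and x: "x \<noteq> 0" "x \<notin> mod_regs c" "0 \<notin> mod_regs c"
    and init: "I 0 (set_reg x 0 s)"
    and step: "\<And>k s'. k < n \<Longrightarrow> reg s' x = k \<Longrightarrow> reg s' 0 = n \<Longrightarrow> unchanged (For x c) s s' \<Longrightarrow> I k s' \<Longrightarrow>
      runs orc n c s' (\<lambda>s''. I (Suc k) (set_reg x (Suc k) s''))"
    and post: "\<And>s'. reg s' 0 = n \<Longrightarrow> unchanged (For x c) s s' \<Longrightarrow> I n s' \<Longrightarrow> Q s'"
  shows "runs orc n (For x c) s Q"
proof -
  let ?b = "Less (Reg x) (Reg 0)" and ?d = "Seq c (Assign x (Plus (Reg x) (Const 1)))"
  have loop: "\<exists>t q s''. exec orc n (While ?b ?d) s' t q s'' \<and> t \<le> (n - k) * (cost n ?d + 1) + 1 \<and>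
      I n s'' \<and> reg s'' 0 = n \<and> unchanged (For x c) s s''"
    if "k \<le> n" "reg s' x = k" "reg s' 0 = n" "unchanged (For x c) s s'" "I k s'" for k s'
    using that
  proof (induction "n - k" arbitrary: k s')
    case 0
    then have "exec orc n (While ?b ?d) s' 1 0 s'" by (intro exec_WhileFalse) simp
    then show ?case using 0 by (intro exI[of _ 1] exI[of _ 0] exI[of _ s']) auto
  next
    case (Suc m)
    then have k: "k < n" by simp
    obtain t q s1 where s1: "exec orc n c s' t q s1" "t \<le> cost n c" "I (Suc k) (set_reg x (Suc k) s1)"
      using step[OF k Suc.prems(2-5)] unfolding runs_def by blast
    have un: "unchanged c s' s1" using exec_unchanged s1 by blast
    then have regs: "reg s1 x = k" "reg s1 0 = n" using x Suc.prems by (auto simp: unchanged_def)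
    let ?s2 = "set_reg x (Suc k) s1"
    have "exec orc n (Assign x (Plus (Reg x) (Const 1))) s1 1 0 ?s2"
      using exec_Assign[of orc n x "Plus (Reg x) (Const 1)" s1] regs by simp
    then have d: "exec orc n ?d s' (t + 1) (q + 0) ?s2" using s1 by (blast intro: exec_Seq)
    have un2: "unchanged (For x c) s ?s2"
      using un Suc.prems(4) by (auto simp: unchanged_def)
    have "m = n - Suc k" using Suc.hyps(2) by simp
    from Suc.hyps(1)[OF this _ _ _ un2 s1(3)] k regs x obtain t' q' s'' where
      w: "exec orc n (While ?b ?d) ?s2 t' q' s''" "t' \<le> (n - Suc k) * (cost n ?d + 1) + 1"
      "I n s''" "reg s'' 0 = n" "unchanged (For x c) s s''" by auto
    have "exec orc n (While ?b ?d) s' (t + 1 + t' + 1) (q + 0 + q') s''"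
      using Suc.prems k by (intro exec_WhileTrue[OF _ d w(1)]) simp
    moreover have "t + 1 + t' + 1 \<le> (n - k) * (cost n ?d + 1) + 1"
    proof -
      have "n - k = Suc (n - Suc k)" using k by simp
      then have "(n - k) * (cost n ?d + 1) = (n - Suc k) * (cost n ?d + 1) + (cost n ?d + 1)" by simp
      moreover have "cost n ?d = cost n c + 1" by simp
      ultimately show ?thesis using w(2) s1(2) by linarith
    qed
    ultimately show ?case using w by blast
  qed
  have "unchanged (For x c) s (set_reg x 0 s)" by (simp add: unchanged_def)
  then obtain t q s'' where w: "exec orc n (While ?b ?d) (set_reg x 0 s) t q s''"
    "t \<le> n * (cost n ?d + 1) + 1" "I n s''" "reg s'' 0 = n" "unchanged (For x c) s s''"
    using loop[of 0 "set_reg x 0 s"] n x init by auto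
  have "exec orc n (Assign x (Const 0)) s 1 0 (set_reg x 0 s)"
    using exec_Assign[of orc n x "Const 0" s] by simp
  then have "exec orc n (For x c) s (1 + t) (0 + q) s''"
    unfolding For_def using w(1) by (rule exec_Seq)
  moreover have "1 + t \<le> cost n (For x c)" using w(2) by (simp add: For_def)
  ultimately show ?thesis unfolding runs_def using post w by blast
qed

section \<open>The algorithm\<close>

text \<open>
  Register 0 holds \<open>n\<close>. Array 0 holds the current set \<open>S\<close>, array 1 a basis of \<open>S\<close>, array 2 the
  argument of oracle calls, array 3 the labels and arrays 4 to 6 fundamental circuits. The verdict
  for \<open>S\<close> is returned in register 1, and register 14 is reserved for the deletion loop.
\<close>

abbreviation nonzero :: "aname \<Rightarrow> vname \<Rightarrow> bexp" where
  "nonzero a x \<equiv> Neg (Eq (Elem a (Reg x)) (Const 0))"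

lemmas runs_intros = runs_Seq runs_Cond runs_Assign runs_Store runs_Query runs_Skip

section \<open>Greedy bases and fundamental circuits by oracle calls\<close>

definition find_basis :: com where
  "find_basis = Seq (For 2 (Store 1 (Reg 2) (Const 0)))
     (For 2 (Cond (nonzero 0 2)
        (Seq (Store 1 (Reg 2) (Const 1)) (Seq (Query 3 1)
          (Cond (Eq (Reg 3) (Const 0)) (Store 1 (Reg 2) (Const 0)) Skip)))
        Skip))"

lemma mod_find_basis [simp]: "mod_regs find_basis = {2, 3}" "mod_arrs find_basis = {1}"
  by (auto simp: find_basis_def)

text \<open>A rejected element is dependent on the elements chosen so far, and by monotonicity also
  on the final set. So a single pass yields a maximal independent subset.\<close>

lemma find_basis_runs:
  assumes n: "reg s 0 = n" and "orc {}" and mono: "\<And>X Y. orc X \<Longrightarrow> Y \<subseteq> X \<Longrightarrow> orc Y"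
  shows "runs orc n find_basis s (\<lambda>s'. array_set n 1 s' \<subseteq> array_set n 0 s \<and> orc (array_set n 1 s') \<and>
    (\<forall>e\<in>array_set n 0 s - array_set n 1 s'. \<not> orc (insert e (array_set n 1 s'))))"
  unfolding find_basis_def
\<comment> \<open>The first loop clears array 1, which holds an old basis when the program is run
  again.\<close>
proof (rule runs_Seq, rule runs_For[where I = "\<lambda>k s'. array_set n 1 s' \<inter> {..<k} = {}"])
  fix s1 assume s1: "reg s1 0 = n" "unchanged (For 2 (Store 1 (Reg 2) (Const 0))) s s1"
    "array_set n 1 s1 \<inter> {..<n} = {}"
  have empty: "array_set n 1 s1 = {}" using s1(3) array_set_subset by blast
  define S where "S = array_set n 0 s"
  have S: "array_set n 0 s1 = S" using unchanged_array_set[OF s1(2), of 0 n] by (simp add: S_def)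
  define I where "I k s' \<longleftrightarrow> array_set n 1 s' \<subseteq> S \<inter> {..<k} \<and> orc (array_set n 1 s') \<and>
    (\<forall>e\<in>S \<inter> {..<k} - array_set n 1 s'. \<not> orc (insert e (array_set n 1 s')))" for k s'
  show "runs orc n (For 2 (Cond (nonzero 0 2)
      (Seq (Store 1 (Reg 2) (Const 1)) (Seq (Query 3 1)
        (Cond (Eq (Reg 3) (Const 0)) (Store 1 (Reg 2) (Const 0)) Skip))) Skip)) s1
    (\<lambda>s'. array_set n 1 s' \<subseteq> array_set n 0 s \<and> orc (array_set n 1 s') \<and>
      (\<forall>e\<in>array_set n 0 s - array_set n 1 s'. \<not> orc (insert e (array_set n 1 s'))))"
    (is "runs orc n ?c s1 ?Q")
  proof (rule runs_For[where I = I])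
    fix k s' assume k: "k < n" and r: "reg s' 2 = k" and un: "unchanged ?c s1 s'" and I: "I k s'"
    have S': "array_set n 0 s' = S" using unchanged_array_set[OF un, of 0 n] S by simp
    let ?B = "array_set n 1 s'"
    have kS: "arr s' 0 k \<noteq> 0 \<longleftrightarrow> k \<in> S" using array_set_iff[OF k, of 0 s'] S' by simp
    have B: "?B \<subseteq> S \<inter> {..<k}" "orc ?B" "\<And>e. e \<in> S \<inter> {..<k} - ?B \<Longrightarrow> \<not> orc (insert e ?B)"
      using I by (auto simp: I_def)
    have kB: "k \<notin> ?B" using B(1) by auto
    have "I (Suc k) t" if "k \<notin> S" "array_set n 1 t = ?B" for t
      using that B by (auto simp: I_def lessThan_Suc)
    moreover have "I (Suc k) t" if "\<not> orc (insert k ?B)" "array_set n 1 t = ?B" for t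
      using that B by (auto simp: I_def lessThan_Suc)
    moreover have "I (Suc k) t" if "k \<in> S" "orc (insert k ?B)" "array_set n 1 t = insert k ?B" for t
    proof -
      have "\<not> orc (insert e (insert k ?B))" if "e \<in> S \<inter> {..<k} - ?B" for e
        using B(3)[OF that] mono by (metis insert_commute subset_insertI)
      then show ?thesis using that B by (auto simp: I_def lessThan_Suc)
    qed
    ultimately show "runs orc n (Cond (nonzero 0 2)
        (Seq (Store 1 (Reg 2) (Const 1)) (Seq (Query 3 1)
          (Cond (Eq (Reg 3) (Const 0)) (Store 1 (Reg 2) (Const 0)) Skip))) Skip) s'
        (\<lambda>s''. I (Suc k) (set_reg 2 (Suc k) s''))"
      using k r kS kB by (intro runs_intros) (simp_all split: if_splits)
  next
    show "I 0 (set_reg 2 0 s1)" using empty assms(2) by (simp add: I_def)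
    fix s' assume "I n s'"
    moreover have "S \<inter> {..<n} = S" using array_set_subset by (auto simp: S_def)
    ultimately show "?Q s'" by (simp add: I_def S_def)
  qed (use s1 in auto)
next
  fix k s' assume "k < n" "reg s' 2 = k" "array_set n 1 s' \<inter> {..<k} = {}"
  then show "runs orc n (Store 1 (Reg 2) (Const 0)) s'
      (\<lambda>s''. array_set n 1 (set_reg 2 (Suc k) s'') \<inter> {..<Suc k} = {})"
    by (intro runs_intros) (auto simp: lessThan_Suc)
qed (use n in auto)

text \<open>A basis element \<open>i\<close> lies on the circuit closed by \<open>e\<close> exactly
  if exchanging \<open>i\<close> for \<open>e\<close> preserves independence. The empty default lets
  the loops range over all \<open>e < n\<close>.\<close>

definition fundamental :: "(nat set \<Rightarrow> bool) \<Rightarrow> nat set \<Rightarrow> nat set \<Rightarrow> nat \<Rightarrow> nat set" where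
  "fundamental orc S B e =
     (if e \<in> S - B then insert e {i \<in> B. orc (insert e (B - {i}))} else {})"

definition fundamental_circuit :: "vname \<Rightarrow> vname \<Rightarrow> aname \<Rightarrow> com" where
  "fundamental_circuit e x a =
     Seq (For x (Seq (Store 2 (Reg x) (Elem 1 (Reg x))) (Store a (Reg x) (Const 0))))
       (Cond (Conj (nonzero 0 e) (Eq (Elem 1 (Reg e)) (Const 0)))
         (Seq (Store 2 (Reg e) (Const 1))
           (Seq (For x (Cond (nonzero 1 x)
               (Seq (Store 2 (Reg x) (Const 0)) (Seq (Query 3 2)
                 (Seq (Store a (Reg x) (Reg 3)) (Store 2 (Reg x) (Const 1)))))
               Skip))
             (Store a (Reg e) (Const 1))))
         Skip)"

lemma mod_fundamental_circuit [simp]: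
  "mod_regs (fundamental_circuit e x a) = {x, 3}" "mod_arrs (fundamental_circuit e x a) = {2, a}"
  by (auto simp: fundamental_circuit_def)

lemma fundamental_circuit_runs:
  assumes n: "reg s 0 = n" and e: "reg s e < n"
    and distinct: "x \<noteq> 0" "x \<noteq> 3" "e \<noteq> x" "e \<noteq> 3" "a \<notin> {0, 1, 2}"
  shows "runs orc n (fundamental_circuit e x a) s (\<lambda>s'.
    array_set n a s' = fundamental orc (array_set n 0 s) (array_set n 1 s) (reg s e))"
proof -
  let ?e = "reg s e"
  define S where "S = array_set n 0 s"
  define B where "B = array_set n 1 s"
  let ?c1 = "Seq (Store 2 (Reg x) (Elem 1 (Reg x))) (Store a (Reg x) (Const 0))"
  let ?c2 = "Cond (nonzero 1 x) (Seq (Store 2 (Reg x) (Const 0)) (Seq (Query 3 2)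
       (Seq (Store a (Reg x) (Reg 3)) (Store 2 (Reg x) (Const 1))))) Skip"
  let ?Q = "\<lambda>s'. array_set n a s' = fundamental orc S B ?e"
  have "runs orc n (fundamental_circuit e x a) s ?Q"
    unfolding fundamental_circuit_def
  proof (rule runs_Seq, rule runs_For[where I = "\<lambda>k s'. array_set n 2 s' \<inter> {..<k} = B \<inter> {..<k} \<and>
      array_set n a s' \<inter> {..<k} = {}"])
    fix s1 assume s1: "reg s1 0 = n" "unchanged (For x ?c1) s s1"
      "array_set n 2 s1 \<inter> {..<n} = B \<inter> {..<n} \<and> array_set n a s1 \<inter> {..<n} = {}"
    have sub: "array_set n 2 s1 \<subseteq> {..<n}" "array_set n a s1 \<subseteq> {..<n}" "B \<subseteq> {..<n}"
      unfolding B_def by (rule array_set_subset)+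
    have 2: "array_set n 2 s1 = B" and a: "array_set n a s1 = {}" using s1(3) sub by blast+
    have S1: "array_set n 0 s1 = S" and B1: "array_set n 1 s1 = B" and e1: "reg s1 e = ?e"
      using unchanged_array_set[OF s1(2), of _ n] unchanged_reg[OF s1(2), of e] distinct
      by (auto simp: S_def B_def)
    show "runs orc n (Cond (Conj (nonzero 0 e) (Eq (Elem 1 (Reg e)) (Const 0)))
         (Seq (Store 2 (Reg e) (Const 1)) (Seq (For x ?c2) (Store a (Reg e) (Const 1)))) Skip) s1 ?Q"
    proof (rule runs_Cond)
      assume "bval (Conj (nonzero 0 e) (Eq (Elem 1 (Reg e)) (Const 0))) s1"
      then have eSB: "?e \<in> S - B"
        using S1 B1 e1 array_set_iff[OF e, of 0 s1] array_set_iff[OF e, of 1 s1] by auto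
      define s2 where "s2 = set_arr 2 (reg s1 e) 1 s1"
      have s2: "array_set n 2 s2 = insert ?e B" "array_set n a s2 = {}" "array_set n 1 s2 = B"
        "reg s2 = reg s1"
        using 2 a B1 e1 e distinct by (auto simp: s2_def)
      define I where "I k s' \<longleftrightarrow> array_set n 2 s' = insert ?e B \<and>
        array_set n a s' = {i \<in> B. i < k \<and> orc (insert ?e (B - {i}))}" for k s'
      have "runs orc n (For x ?c2) s2 (\<lambda>s'. runs orc n (Store a (Reg e) (Const 1)) s' ?Q)"
      proof (rule runs_For[where I = I])
        fix k s' assume k: "k < n" and r: "reg s' x = k" and un: "unchanged (For x ?c2) s2 s'" and I: "I k s'"
        have B': "array_set n 1 s' = B" using unchanged_array_set[OF un, of 1 n] distinct s2 by auto
        then have kB: "arr s' 1 k \<noteq> 0 \<longleftrightarrow> k \<in> B" using array_set_iff[OF k, of 1 s'] by simp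
        show "runs orc n ?c2 s' (\<lambda>s''. I (Suc k) (set_reg x (Suc k) s''))"
        proof (rule runs_Cond)
          assume "bval (nonzero 1 x) s'"
          then have kB: "k \<in> B" using kB r by simp
          then have ke: "k \<noteq> ?e" using eSB by blast
          \<comment> \<open>Array 2 holds \<open>insert ?e B\<close> between passes;
            \<open>k\<close> is taken out for the query and then put back.\<close>
          have "insert ?e B - {k} = insert ?e (B - {k})" "insert k (insert ?e (B - {k})) = insert ?e B"
            using ke kB by auto
          then show "runs orc n (Seq (Store 2 (Reg x) (Const 0)) (Seq (Query 3 2)
              (Seq (Store a (Reg x) (Reg 3)) (Store 2 (Reg x) (Const 1))))) s'
              (\<lambda>s''. I (Suc k) (set_reg x (Suc k) s''))"
            using I k r kB distinct
            by (intro runs_intros) (auto simp: I_def less_Suc_eq)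
        next
          assume "\<not> bval (nonzero 1 x) s'"
          then have "k \<notin> B" using kB r by simp
          then have "{i \<in> B. i < Suc k \<and> orc (insert ?e (B - {i}))} = {i \<in> B. i < k \<and> orc (insert ?e (B - {i}))}"
            by (auto simp: less_Suc_eq)
          then show "runs orc n Skip s' (\<lambda>s''. I (Suc k) (set_reg x (Suc k) s''))"
            using I by (intro runs_intros) (simp add: I_def)
        qed
      next
        fix s' assume un: "unchanged (For x ?c2) s2 s'" and I: "I n s'"
        have e': "reg s' e = ?e" using unchanged_reg[OF un, of e] distinct s2 e1 by auto
        have "{i \<in> B. i < n \<and> orc (insert ?e (B - {i}))} = {i \<in> B. orc (insert ?e (B - {i}))}"
          using sub(3) by auto
        then show "runs orc n (Store a (Reg e) (Const 1)) s' ?Q"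
          using I e e' eSB by (intro runs_intros) (simp add: I_def fundamental_def)
      qed (use s1 s2 distinct in \<open>auto simp: I_def\<close>)
      then show "runs orc n (Seq (Store 2 (Reg e) (Const 1)) (Seq (For x ?c2) (Store a (Reg e) (Const 1)))) s1 ?Q"
        by (intro runs_Seq runs_Store) (simp add: s2_def)
    next
      assume "\<not> bval (Conj (nonzero 0 e) (Eq (Elem 1 (Reg e)) (Const 0))) s1"
      then have "?e \<notin> S - B"
        using S1 B1 e1 array_set_iff[OF e, of 0 s1] array_set_iff[OF e, of 1 s1] by auto
      then show "runs orc n Skip s1 ?Q" using a by (intro runs_Skip) (simp add: fundamental_def)
    qed
  next
    fix k s' assume k: "k < n" and r: "reg s' x = k" and un: "unchanged (For x ?c1) s s'"
      and I: "array_set n 2 s' \<inter> {..<k} = B \<inter> {..<k} \<and> array_set n a s' \<inter> {..<k} = {}"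
    have "array_set n 1 s' = B" using unchanged_array_set[OF un, of 1 n] distinct by (simp add: B_def)
    then have kB: "arr s' 1 k \<noteq> 0 \<longleftrightarrow> k \<in> B" using array_set_iff[OF k, of 1 s'] by simp
    then show "runs orc n ?c1 s' (\<lambda>s''. array_set n 2 (set_reg x (Suc k) s'') \<inter> {..<Suc k} = B \<inter> {..<Suc k} \<and>
        array_set n a (set_reg x (Suc k) s'') \<inter> {..<Suc k} = {})"
      using I k r distinct by (intro runs_intros) (auto simp: lessThan_Suc)
  qed (use n distinct in auto)
  then show ?thesis by (simp add: S_def B_def)
qed

text \<open>
  Identifies the labels of the elements in registers 2 and 4. Labels that have become equal stay
  equal, so a single pass over all pairs suffices.
\<close>

definition merge :: com where
  "merge = Seq (Assign 5 (Elem 3 (Reg 4))) (Seq (Assign 6 (Elem 3 (Reg 2)))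
     (For 7 (Cond (Eq (Elem 3 (Reg 7)) (Reg 5)) (Store 3 (Reg 7) (Reg 6)) Skip)))"

lemma mod_merge [simp]: "mod_regs merge = {5, 6, 7}" "mod_arrs merge = {3}"
  by (auto simp: merge_def)

text \<open>Both labels are copied to registers first, since the pass may overwrite the array entry
  from which the old label was read.\<close>

lemma merge_runs:
  assumes n: "reg s 0 = n"
  shows "runs orc n merge s (\<lambda>s'. \<forall>j<n. arr s' 3 j =
    (if arr s 3 j = arr s 3 (reg s 4) then arr s 3 (reg s 2) else arr s 3 j))"
proof -
  let ?L = "arr s 3" and ?old = "arr s 3 (reg s 4)" and ?new = "arr s 3 (reg s 2)"
  let ?c = "Cond (Eq (Elem 3 (Reg 7)) (Reg 5)) (Store 3 (Reg 7) (Reg 6)) Skip"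
  define s1 where "s1 = set_reg 6 ?new (set_reg 5 ?old s)"
  have "runs orc n (For 7 ?c) s1 (\<lambda>s'. \<forall>j<n. arr s' 3 j = (if ?L j = ?old then ?new else ?L j))"
  proof (rule runs_For[where I = "\<lambda>k s'. \<forall>j<n. arr s' 3 j = (if j < k \<and> ?L j = ?old then ?new else ?L j)"])
    fix k s' assume k: "k < n" "reg s' 7 = k" "unchanged (For 7 ?c) s1 s'"
      "\<forall>j<n. arr s' 3 j = (if j < k \<and> ?L j = ?old then ?new else ?L j)"
    have "reg s' 5 = ?old" "reg s' 6 = ?new"
      using unchanged_reg[OF k(3), of 5] unchanged_reg[OF k(3), of 6] by (auto simp: s1_def)
    then show "runs orc n ?c s' (\<lambda>s''. \<forall>j<n. arr (set_reg 7 (Suc k) s'') 3 j =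
        (if j < Suc k \<and> ?L j = ?old then ?new else ?L j))"
      using k by (intro runs_intros) (auto simp: less_Suc_eq)
  qed (use n in \<open>auto simp: s1_def\<close>)
  then show ?thesis unfolding merge_def by (intro runs_intros) (simp add: s1_def)
qed

definition find_labels :: com where
  "find_labels = Seq (For 2 (Store 3 (Reg 2) (Reg 2)))
     (For 2 (Seq (fundamental_circuit 2 4 4) (For 4 (Cond (nonzero 4 4) merge Skip))))"

lemma mod_find_labels [simp]:
  "mod_regs find_labels = {2, 3, 4, 5, 6, 7}" "mod_arrs find_labels = {2, 3, 4}"
  by (auto simp: find_labels_def)

text \<open>Initially all labels differ, so elements with equal labels are trivially related.
  Merging \<open>e\<close> with the members of \<open>F e\<close> preserves this for any equivalence
  relation \<open>R\<close> containing these pairs; in use, \<open>R\<close> is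
  \<open>connected\<close>.\<close>

lemma find_labels_runs:
  assumes n: "reg s 0 = n"
    and F: "F = fundamental orc (array_set n 0 s) (array_set n 1 s)"
    and R: "equiv UNIV R" "\<And>e i. i \<in> F e \<Longrightarrow> (i, e) \<in> R"
  shows "runs orc n find_labels s (\<lambda>s'.
    (\<forall>e<n. \<forall>i\<in>F e. arr s' 3 i = arr s' 3 e) \<and>
    (\<forall>i<n. \<forall>j<n. arr s' 3 i = arr s' 3 j \<longrightarrow> (i, j) \<in> R))"
proof -
  have F_less: "i < n" if "i \<in> F e" for i e
    using that array_set_subset[of n] by (auto simp: F fundamental_def split: if_splits)
  have refl: "(i, i) \<in> R" and sym: "(i, j) \<in> R \<Longrightarrow> (j, i) \<in> R"
    and trans: "(i, j) \<in> R \<Longrightarrow> (j, k) \<in> R \<Longrightarrow> (i, k) \<in> R" for i j k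
    using R(1) by (auto simp: equiv_def refl_on_def sym_def intro: transD)
  define sound where "sound L \<longleftrightarrow> (\<forall>i<n. \<forall>j<n. L i = L j \<longrightarrow> (i, j) \<in> R)" for L :: "nat \<Rightarrow> nat"
  define I where "I k s' \<longleftrightarrow> sound (arr s' 3) \<and> (\<forall>e<k. \<forall>i\<in>F e. arr s' 3 i = arr s' 3 e)"
    for k and s' :: state
  let ?inner = "For 4 (Cond (nonzero 4 4) merge Skip)"
  let ?body = "Seq (fundamental_circuit 2 4 4) ?inner"
  have "runs orc n find_labels s (\<lambda>s'. I n s')"
    unfolding find_labels_def
  proof (rule runs_Seq, rule runs_For[where I = "\<lambda>k s'. \<forall>j<k. arr s' 3 j = j"])
    fix s1 assume s1: "reg s1 0 = n" "unchanged (For 2 (Store 3 (Reg 2) (Reg 2))) s s1" "\<forall>j<n. arr s1 3 j = j"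
    show "runs orc n (For 2 ?body) s1 (I n)"
    proof (rule runs_For[where I = I])
      fix k s2 assume k: "k < n" and s2: "reg s2 2 = k" "reg s2 0 = n" "unchanged (For 2 ?body) s1 s2" "I k s2"
      have F2: "fundamental orc (array_set n 0 s2) (array_set n 1 s2) = F"
        using unchanged_array_set[OF s2(3), of _ n] unchanged_array_set[OF s1(2), of _ n] by (simp add: F)
      show "runs orc n ?body s2 (\<lambda>s''. I (Suc k) (set_reg 2 (Suc k) s''))"
      proof (rule runs_Seq, rule runs_conseq[OF fundamental_circuit_runs])
        fix s3 assume s3: "array_set n 4 s3 = fundamental orc (array_set n 0 s2) (array_set n 1 s2) (reg s2 2)"
          "unchanged (fundamental_circuit 2 4 4) s2 s3"
        have r3: "reg s3 0 = n" "reg s3 2 = k" "arr s3 3 = arr s2 3" and F3: "array_set n 4 s3 = F k"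
          using unchanged_reg[OF s3(2)] unchanged_arr[OF s3(2)] s2 s3(1) F2 by auto
        define J where "J m s' \<longleftrightarrow> I k s' \<and> (\<forall>i\<in>F k. i < m \<longrightarrow> arr s' 3 i = arr s' 3 k)"
          for m and s' :: state
        show "runs orc n ?inner s3 (\<lambda>s''. I (Suc k) (set_reg 2 (Suc k) s''))"
        proof (rule runs_For[where I = J])
          fix m s4 assume m: "m < n" and s4: "reg s4 4 = m" "reg s4 0 = n" "unchanged ?inner s3 s4" "J m s4"
          have r4: "reg s4 2 = k" and mF: "arr s4 4 m \<noteq> 0 \<longleftrightarrow> m \<in> F k"
            using unchanged_reg[OF s4(3), of 2] unchanged_array_set[OF s4(3), of 4 n] r3 F3
              array_set_iff[OF m, of 4 s4] by auto
          show "runs orc n (Cond (nonzero 4 4) merge Skip) s4 (\<lambda>s''. J (Suc m) (set_reg 4 (Suc m) s''))"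
          proof (rule runs_Cond)
            assume "bval (nonzero 4 4) s4"
            then have mk: "m \<in> F k" using mF s4 by simp
            let ?L = "arr s4 3"
            show "runs orc n merge s4 (\<lambda>s''. J (Suc m) (set_reg 4 (Suc m) s''))"
            proof (rule runs_conseq[OF merge_runs])
              fix s5 :: state assume s5: "\<forall>j<n. arr s5 3 j = (if ?L j = ?L (reg s4 4) then ?L (reg s4 2) else ?L j)"
              let ?L' = "arr s5 3"
              have L': "?L' j = (if ?L j = ?L m then ?L k else ?L j)" if "j < n" for j
                using s5 that s4 r4 by simp
              have kR: "(m, k) \<in> R" using R(2) mk by blast
              have so: "sound ?L" using s4(4) by (simp add: J_def I_def)
              have "sound ?L'"
                unfolding sound_def
              proof (intro allI impI)
                fix i j assume ij: "i < n" "j < n" "?L' i = ?L' j"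
                have 1: "(a, b) \<in> R" if "a < n" "b < n" "?L a = ?L b" for a b
                  using so that by (simp add: sound_def)
                \<comment> \<open>A new coincidence of labels links the classes of \<open>m\<close>
                  and \<open>k\<close>, and \<open>(m, k)\<close> is in \<open>R\<close>.\<close>
                show "(i, j) \<in> R"
                  using ij 1[OF ij(1,2)] 1[OF ij(1) m] 1[OF ij(2) m] 1[OF ij(1) k] 1[OF ij(2) k] kR sym trans
                  unfolding L'[OF ij(1)] L'[OF ij(2)] by (metis (full_types))
              qed
              moreover have keep: "?L' i = ?L' j" if "i < n" "j < n" "?L i = ?L j" for i j
                using that by (simp add: L')
              have "?L' i = ?L' e" if "e < k" "i \<in> F e" for e i
                using keep[of i e] that F_less[OF that(2)] k s4(4) by (simp add: J_def I_def)
              moreover have "?L' i = ?L' k" if "i \<in> F k" "i < Suc m" for i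
              proof (cases "i = m")
                case True
                then show ?thesis using L'[OF m] L'[OF k] by simp
              next
                case False
                then show ?thesis
                  using keep[of i k] that F_less[OF that(1)] k s4(4) by (simp add: J_def)
              qed
              ultimately show "J (Suc m) (set_reg 4 (Suc m) s5)" by (simp add: J_def I_def)
            qed (use s4 in simp)
          next
            assume "\<not> bval (nonzero 4 4) s4"
            then have "m \<notin> F k" using mF s4 by simp
            then show "runs orc n Skip s4 (\<lambda>s''. J (Suc m) (set_reg 4 (Suc m) s''))"
              using s4 by (intro runs_Skip) (auto simp: J_def I_def less_Suc_eq)
          qed
        next
          fix s4 assume "J n s4"
          then show "I (Suc k) (set_reg 2 (Suc k) s4)"
            using F_less by (auto simp: J_def I_def less_Suc_eq)
        qed (use r3 s2 in \<open>auto simp: J_def I_def\<close>)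
      qed (use k s2 in auto)
    next
      show "I 0 (set_reg 2 0 s1)" using s1 refl by (simp add: I_def sound_def)
    qed (use s1 in auto)
  next
    fix k and s' :: state assume "k < n" "reg s' 2 = k" "\<forall>j<k. arr s' 3 j = j"
    then show "runs orc n (Store 3 (Reg 2) (Reg 2)) s' (\<lambda>s''. \<forall>j<Suc k. arr (set_reg 2 (Suc k) s'') 3 j = j)"
      by (intro runs_intros) (auto simp: less_Suc_eq)
  qed (use n in auto)
  then show ?thesis by (rule runs_conseq) (auto simp: I_def sound_def)
qed

section \<open>Testing the parity condition on triples\<close>

definition intersection_parity :: "aname \<Rightarrow> aname \<Rightarrow> vname \<Rightarrow> com" where
  "intersection_parity a b x = Seq (Assign x (Const 0))
     (For 4 (Cond (Conj (nonzero a 4) (nonzero b 4)) (Assign x (Minus (Const 1) (Reg x))) Skip))"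

lemma mod_intersection_parity [simp]:
  "mod_regs (intersection_parity a b x) = {4, x}" "mod_arrs (intersection_parity a b x) = {}"
  by (auto simp: intersection_parity_def)

lemma intersection_parity_runs:
  assumes n: "reg s 0 = n" and x: "x \<noteq> 0" "x \<noteq> 4"
  shows "runs orc n (intersection_parity a b x) s
    (\<lambda>s'. reg s' x = card (array_set n a s \<inter> array_set n b s) mod 2)"
  unfolding intersection_parity_def
proof (intro runs_Seq runs_Assign)
  define D where "D = array_set n a s \<inter> array_set n b s"
  define s1 where "s1 = set_reg x (aval (Const 0) s) s"
  let ?c = "Cond (Conj (nonzero a 4) (nonzero b 4)) (Assign x (Minus (Const 1) (Reg x))) Skip"
  have D: "D \<subseteq> {..<n}" using array_set_subset by (auto simp: D_def)
  have "runs orc n (For 4 ?c) s1 (\<lambda>s'. reg s' x = card D mod 2)"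
  proof (rule runs_For[where I = "\<lambda>k s'. reg s' x = card (D \<inter> {..<k}) mod 2"])
    fix k s' assume k: "k < n" "reg s' 4 = k" "unchanged (For 4 ?c) s1 s'" "reg s' x = card (D \<inter> {..<k}) mod 2"
    have kD: "arr s' a k \<noteq> 0 \<and> arr s' b k \<noteq> 0 \<longleftrightarrow> k \<in> D"
      using unchanged_arr[OF k(3)] k(1) by (simp add: D_def s1_def array_set_iff)
    show "runs orc n ?c s' (\<lambda>s''. reg (set_reg 4 (Suc k) s'') x = card (D \<inter> {..<Suc k}) mod 2)"
    proof (rule runs_Cond)
      assume "bval (Conj (nonzero a 4) (nonzero b 4)) s'"
      then have "D \<inter> {..<Suc k} = insert k (D \<inter> {..<k})" using kD k by (auto simp: lessThan_Suc)
      then have "card (D \<inter> {..<Suc k}) = Suc (card (D \<inter> {..<k}))" by simp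
      then show "runs orc n (Assign x (Minus (Const 1) (Reg x))) s'
          (\<lambda>s''. reg (set_reg 4 (Suc k) s'') x = card (D \<inter> {..<Suc k}) mod 2)"
        using k x by (intro runs_intros) (simp add: mod_Suc)
    next
      assume "\<not> bval (Conj (nonzero a 4) (nonzero b 4)) s'"
      then have "k \<notin> D" using kD k by auto
      then have "D \<inter> {..<Suc k} = D \<inter> {..<k}" by (auto simp: lessThan_Suc)
      then show "runs orc n Skip s' (\<lambda>s''. reg (set_reg 4 (Suc k) s'') x = card (D \<inter> {..<Suc k}) mod 2)"
        using k x by (intro runs_intros) simp
    qed
  next
    fix s' assume "reg s' x = card (D \<inter> {..<n}) mod 2"
    then show "reg s' x = card D mod 2" using D by (simp add: Int_absorb2)
  qed (use n x in \<open>auto simp: s1_def\<close>)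
  then show "runs orc n (For 4 ?c) (set_reg x (aval (Const 0) s) s)
      (\<lambda>s'. reg s' x = card (array_set n a s \<inter> array_set n b s) mod 2)"
    by (simp add: s1_def D_def)
qed

definition bad_triple :: "(nat \<Rightarrow> nat set) \<Rightarrow> (nat \<Rightarrow> nat) \<Rightarrow> nat \<Rightarrow> nat \<Rightarrow> nat \<Rightarrow> bool" where
  "bad_triple F L e f g \<longleftrightarrow> L e = L f \<and> L f = L g \<and> odd (card (F g)) \<and>
     \<not> (odd (card (F e \<inter> F f)) \<longleftrightarrow> odd (card (F e)) \<and> odd (card (F f)))"

text \<open>The parity of a single circuit is computed by intersecting its array with
  itself.\<close>

definition check_triple :: com where
  "check_triple =
     Seq (fundamental_circuit 2 4 4) (Seq (fundamental_circuit 8 4 5) (Seq (fundamental_circuit 9 4 6)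
     (Seq (intersection_parity 4 4 10) (Seq (intersection_parity 5 5 11)
     (Seq (intersection_parity 4 5 12) (Seq (intersection_parity 6 6 13)
       (Cond (Conj (Conj (Eq (Elem 3 (Reg 2)) (Elem 3 (Reg 8))) (Eq (Elem 3 (Reg 8)) (Elem 3 (Reg 9))))
           (Conj (Eq (Reg 13) (Const 1)) (Neg (Eq (Reg 12) (Minus (Plus (Reg 10) (Reg 11)) (Const 1))))))
         (Assign 1 (Const 1)) Skip)))))))"

lemma mod_check_triple [simp]:
  "mod_regs check_triple = {1, 3, 4, 10, 11, 12, 13}" "mod_arrs check_triple = {2, 4, 5, 6}"
  by (auto simp: check_triple_def)

text \<open>For bits, the truncated difference \<open>x + y - 1\<close> is their product; the
  machine has no multiplication.\<close>

lemma parity_product: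
  fixes a b c :: nat
  shows "a mod 2 = b mod 2 + c mod 2 - 1 \<longleftrightarrow> (odd a \<longleftrightarrow> odd b \<and> odd c)"
  by (cases "even a"; cases "even b"; cases "even c") (simp_all add: odd_iff_mod_2_eq_one)

text \<open>Register 1 is raised and never lowered, so it accumulates the verdict over successive
  triples; \<open>b\<close> is the verdict so far.\<close>

lemma check_triple_runs:
  assumes n: "reg s 0 = n" and less: "reg s 2 < n" "reg s 8 < n" "reg s 9 < n" and b: "reg s 1 = of_bool b"
    and F: "F = fundamental orc (array_set n 0 s) (array_set n 1 s)"
  shows "runs orc n check_triple s
    (\<lambda>s'. reg s' 1 = of_bool (b \<or> bad_triple F (arr s 3) (reg s 2) (reg s 8) (reg s 9)))"
  unfolding check_triple_def
proof (rule runs_Seq, rule runs_conseq[OF fundamental_circuit_runs],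
    goal_cases n2 less2 a2 b2 c2 d2 e2 post)
  case (post s1)
  have 1: "reg s1 0 = n" "reg s1 2 = reg s 2" "reg s1 8 = reg s 8" "reg s1 9 = reg s 9" "reg s1 1 = of_bool b"
    "array_set n 0 s1 = array_set n 0 s" "array_set n 1 s1 = array_set n 1 s" "arr s1 3 = arr s 3"
    "array_set n 4 s1 = F (reg s 2)"
    using post(1) unchanged_reg[OF post(2)] unchanged_arr[OF post(2)] unchanged_array_set[OF post(2), of _ n]
    by (simp_all add: n b F del: One_nat_def)
  show ?case
  proof (rule runs_Seq, rule runs_conseq[OF fundamental_circuit_runs],
      goal_cases n2 less2 a2 b2 c2 d2 e2 post)
    case (post s2)
    have 2: "reg s2 0 = n" "reg s2 2 = reg s 2" "reg s2 8 = reg s 8" "reg s2 9 = reg s 9" "reg s2 1 = of_bool b"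
      "array_set n 0 s2 = array_set n 0 s" "array_set n 1 s2 = array_set n 1 s" "arr s2 3 = arr s 3"
      "array_set n 4 s2 = F (reg s 2)" "array_set n 5 s2 = F (reg s 8)"
      using post(1) unchanged_reg[OF post(2)] unchanged_arr[OF post(2)] unchanged_array_set[OF post(2), of _ n]
      by (simp_all add: 1 F del: One_nat_def)
    show ?case
    proof (rule runs_Seq, rule runs_conseq[OF fundamental_circuit_runs],
        goal_cases n2 less2 a2 b2 c2 d2 e2 post)
      case (post s3)
      have 3: "reg s3 0 = n" "reg s3 2 = reg s 2" "reg s3 8 = reg s 8" "reg s3 9 = reg s 9" "reg s3 1 = of_bool b"
        "arr s3 3 = arr s 3"
        "array_set n 4 s3 = F (reg s 2)" "array_set n 5 s3 = F (reg s 8)" "array_set n 6 s3 = F (reg s 9)"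
        using post(1) unchanged_reg[OF post(2)] unchanged_arr[OF post(2)] unchanged_array_set[OF post(2), of _ n]
        by (simp_all add: 2 F del: One_nat_def)
      show ?case
      proof (rule runs_Seq, rule runs_conseq[OF intersection_parity_runs], goal_cases n2 a2 b2 post)
        case (post s4)
        have 4: "reg s4 0 = n" "reg s4 2 = reg s 2" "reg s4 8 = reg s 8" "reg s4 9 = reg s 9" "reg s4 1 = of_bool b"
          "arr s4 3 = arr s 3" "array_set n 4 s4 = F (reg s 2)" "array_set n 5 s4 = F (reg s 8)"
          "array_set n 6 s4 = F (reg s 9)" "reg s4 10 = card (F (reg s 2)) mod 2"
          using post(1) unchanged_reg[OF post(2)] unchanged_arr[OF post(2)] unchanged_array_set[OF post(2), of _ n]
          by (simp_all add: 3 del: One_nat_def)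
        show ?case
        proof (rule runs_Seq, rule runs_conseq[OF intersection_parity_runs], goal_cases n2 a2 b2 post)
          case (post s5)
          have 5: "reg s5 0 = n" "reg s5 2 = reg s 2" "reg s5 8 = reg s 8" "reg s5 9 = reg s 9" "reg s5 1 = of_bool b"
            "arr s5 3 = arr s 3" "array_set n 4 s5 = F (reg s 2)" "array_set n 5 s5 = F (reg s 8)"
            "array_set n 6 s5 = F (reg s 9)" "reg s5 10 = card (F (reg s 2)) mod 2"
            "reg s5 11 = card (F (reg s 8)) mod 2"
            using post(1) unchanged_reg[OF post(2)] unchanged_arr[OF post(2)] unchanged_array_set[OF post(2), of _ n]
            by (simp_all add: 4 del: One_nat_def)
          show ?case
          proof (rule runs_Seq, rule runs_conseq[OF intersection_parity_runs], goal_cases n2 a2 b2 post)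
            case (post s6)
            have 6: "reg s6 0 = n" "reg s6 2 = reg s 2" "reg s6 8 = reg s 8" "reg s6 9 = reg s 9" "reg s6 1 = of_bool b"
              "arr s6 3 = arr s 3" "array_set n 6 s6 = F (reg s 9)" "reg s6 10 = card (F (reg s 2)) mod 2"
              "reg s6 11 = card (F (reg s 8)) mod 2" "reg s6 12 = card (F (reg s 2) \<inter> F (reg s 8)) mod 2"
              using post(1) unchanged_reg[OF post(2)] unchanged_arr[OF post(2)] unchanged_array_set[OF post(2), of _ n]
              by (simp_all add: 5 del: One_nat_def)
            show ?case
            proof (rule runs_Seq, rule runs_conseq[OF intersection_parity_runs], goal_cases n2 a2 b2 post)
              case (post s7)
              have 7: "reg s7 0 = n" "reg s7 2 = reg s 2" "reg s7 8 = reg s 8" "reg s7 9 = reg s 9" "reg s7 1 = of_bool b"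
                "arr s7 3 = arr s 3" "reg s7 10 = card (F (reg s 2)) mod 2"
                "reg s7 11 = card (F (reg s 8)) mod 2" "reg s7 12 = card (F (reg s 2) \<inter> F (reg s 8)) mod 2"
                "reg s7 13 = card (F (reg s 9)) mod 2"
                using post(1) unchanged_reg[OF post(2)] unchanged_arr[OF post(2)] unchanged_array_set[OF post(2), of _ n]
                by (simp_all add: 6 del: One_nat_def)
              show ?case
                by (intro runs_intros)
                  (auto simp: 7 parity_product bad_triple_def odd_iff_mod_2_eq_one[symmetric]
                    simp del: One_nat_def)
            qed (simp_all add: 6)
          qed (simp_all add: 5)
        qed (simp_all add: 4)
      qed (simp_all add: 3)
    qed (simp_all add: 2 less)
  qed (simp_all add: 1 less)
qed (simp_all add: n less)

definition search :: com where
  "search = Seq (Assign 1 (Const 0)) (For 2 (For 8 (For 9 check_triple)))"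

lemma mod_search [simp]:
  "mod_regs search = {1, 2, 3, 4, 8, 9, 10, 11, 12, 13}" "mod_arrs search = {2, 4, 5, 6}"
  by (auto simp: search_def)

lemma search_runs:
  assumes n: "reg s 0 = n" and F: "F = fundamental orc (array_set n 0 s) (array_set n 1 s)"
  shows "runs orc n search s
    (\<lambda>s'. reg s' 1 = of_bool (\<exists>e<n. \<exists>f<n. \<exists>g<n. bad_triple F (arr s 3) e f g))"
  unfolding search_def
proof (intro runs_Seq runs_Assign)
  let ?T = "bad_triple F (arr s 3)"
  let ?s0 = "set_reg 1 (aval (Const 0) s) s"
  \<comment> \<open>\<open>I\<close>, \<open>J\<close> and \<open>K\<close> successively refine the
    set of triples seen so far, in lexicographic order.\<close>
  define I where "I k s' \<longleftrightarrow> reg s' 1 = of_bool (\<exists>e<k. \<exists>f<n. \<exists>g<n. ?T e f g)" for k and s' :: state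
  show "runs orc n (For 2 (For 8 (For 9 check_triple))) ?s0
    (\<lambda>s'. reg s' 1 = of_bool (\<exists>e<n. \<exists>f<n. \<exists>g<n. ?T e f g))"
  proof (rule runs_For[where I = I])
    fix e s1 assume e: "e < n" "reg s1 2 = e" "reg s1 0 = n" "unchanged (For 2 (For 8 (For 9 check_triple))) ?s0 s1"
      "I e s1"
    define J where "J m s' \<longleftrightarrow> reg s' 1 = of_bool ((\<exists>e'<e. \<exists>f<n. \<exists>g<n. ?T e' f g) \<or> (\<exists>f<m. \<exists>g<n. ?T e f g))"
      for m and s' :: state
    have s1: "arr s1 3 = arr s 3" "fundamental orc (array_set n 0 s1) (array_set n 1 s1) = F"
      using unchanged_arr[OF e(4)] unchanged_array_set[OF e(4), of _ n] by (simp_all add: F)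
    show "runs orc n (For 8 (For 9 check_triple)) s1 (\<lambda>s''. I (Suc e) (set_reg 2 (Suc e) s''))"
    proof (rule runs_For[where I = J])
      fix f s2 assume f: "f < n" "reg s2 8 = f" "reg s2 0 = n" "unchanged (For 8 (For 9 check_triple)) s1 s2" "J f s2"
      define K where "K m s' \<longleftrightarrow> reg s' 1 = of_bool ((\<exists>e'<e. \<exists>f<n. \<exists>g<n. ?T e' f g) \<or>
          (\<exists>f'<f. \<exists>g<n. ?T e f' g) \<or> (\<exists>g<m. ?T e f g))"
        for m and s' :: state
      have s2: "reg s2 2 = e" "arr s2 3 = arr s 3" "fundamental orc (array_set n 0 s2) (array_set n 1 s2) = F"
        using unchanged_arr[OF f(4)] unchanged_reg[OF f(4)] unchanged_array_set[OF f(4), of _ n] s1 e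
        by simp_all
      show "runs orc n (For 9 check_triple) s2 (\<lambda>s''. J (Suc f) (set_reg 8 (Suc f) s''))"
      proof (rule runs_For[where I = K])
        fix g s3 assume g: "g < n" "reg s3 9 = g" "reg s3 0 = n" "unchanged (For 9 check_triple) s2 s3" "K g s3"
        have s3: "reg s3 2 = e" "reg s3 8 = f" "arr s3 3 = arr s 3"
          "fundamental orc (array_set n 0 s3) (array_set n 1 s3) = F"
          using unchanged_arr[OF g(4)] unchanged_reg[OF g(4)] unchanged_array_set[OF g(4), of _ n] s2 f
          by simp_all
        show "runs orc n check_triple s3 (\<lambda>s''. K (Suc g) (set_reg 9 (Suc g) s''))"
        proof (rule runs_conseq[OF check_triple_runs[OF g(3) _ _ _ g(5)[unfolded K_def] s3(4)[symmetric]]])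
          fix s4 :: state assume "reg s4 1 = of_bool (((\<exists>e'<e. \<exists>f<n. \<exists>g<n. ?T e' f g) \<or>
            (\<exists>f'<f. \<exists>g<n. ?T e f' g) \<or> (\<exists>g'<g. ?T e f g')) \<or>
            bad_triple F (arr s3 3) (reg s3 2) (reg s3 8) (reg s3 9))"
          then show "K (Suc g) (set_reg 9 (Suc g) s4)"
            using s3 g by (auto simp: K_def less_Suc_eq)
        qed (use s3 g e f in simp_all)
      qed (use f in \<open>auto simp: J_def K_def less_Suc_eq\<close>)
    qed (use e in \<open>auto simp: I_def J_def less_Suc_eq\<close>)
  qed (use n in \<open>auto simp: I_def\<close>)
qed

section \<open>Decision procedure and greedy deletion\<close>

definition decide :: com where
  "decide = Seq find_basis (Seq find_labels search)"

lemma mod_decide [simp]: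
  "mod_regs decide = {1, 2, 3, 4, 5, 6, 7, 8, 9, 10, 11, 12, 13}" "mod_arrs decide = {1, 2, 3, 4, 5, 6}"
  by (auto simp: decide_def)

text \<open>Register 0 receives the verdict only as the last action, since all loops read their
  bound from it. Each call of \<open>decide\<close> recomputes basis and labels for the current set
  in array 0.\<close>

definition find_odd_C3_plus :: com where
  "find_odd_C3_plus = Seq (For 14 (Store 0 (Reg 14) (Const 1))) (Seq decide
     (Cond (Eq (Reg 1) (Const 0)) (Assign 0 (Const 0))
       (Seq (For 14 (Seq (Store 0 (Reg 14) (Const 0)) (Seq decide
          (Cond (Eq (Reg 1) (Const 0)) (Store 0 (Reg 14) (Const 1)) Skip))))
        (Assign 0 (Const 1)))))"

context matroid_cycle_space
begin

definition odd_theta_in :: "'a set \<Rightarrow> bool" where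
  "odd_theta_in S \<longleftrightarrow> (\<exists>A B P. odd_theta A B P \<and> A \<union> B \<union> P \<subseteq> S)"

lemma cycle_space_restrict: "cycle_space (\<C> \<inter> Pow S)"
  by standard (auto intro: finite_cycle empty_cycle sym_diff_cycle)

text \<open>A theta only involves cycles inside its own branches, so discarding the cycles that
  leave \<open>S\<close> does not affect the thetas inside \<open>S\<close>.\<close>

lemma odd_theta_restrict:
  "cycle_space.odd_theta (\<C> \<inter> Pow S) A B P \<longleftrightarrow> odd_theta A B P \<and> A \<union> B \<union> P \<subseteq> S"
proof -
  interpret r: cycle_space "\<C> \<inter> Pow S" by (rule cycle_space_restrict)
  have "r.theta A B P \<longleftrightarrow> theta A B P \<and> A \<union> B \<union> P \<subseteq> S"
  proof (cases "A \<union> B \<union> P \<subseteq> S")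
    case True
    then have "(\<forall>Z\<in>\<C> \<inter> Pow S. Z \<subseteq> A \<union> B \<union> P \<longrightarrow> R Z) \<longleftrightarrow> (\<forall>Z\<in>\<C>. Z \<subseteq> A \<union> B \<union> P \<longrightarrow> R Z)" for R
      by blast
    then show ?thesis unfolding r.theta_def theta_def using True by simp
  next
    case False
    moreover have "\<not> r.theta A B P"
    proof
      assume "r.theta A B P"
      then have "A \<union> B \<subseteq> S" "A \<union> P \<subseteq> S" by (simp_all add: r.theta_def)
      then show False using False by blast
    qed
    ultimately show ?thesis by blast
  qed
  then show ?thesis by (auto simp: r.odd_theta_def odd_theta_def)
qed

end

text \<open>Two nonempty cycles inside \<open>insert e B\<close> both contain \<open>e\<close>, so
  their sum lies in the independent set \<open>B\<close> and is empty. The unique cycle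
  \<open>Z\<close> decides the exchanges: removing \<open>i\<close> from \<open>insert e B\<close>
  restores independence exactly if \<open>i\<close> is in \<open>Z\<close>.\<close>

lemma fundamental_circuits_restrict:
  assumes "matroid_cycle_space \<C> M" and S: "S \<subseteq> ground M"
    and B: "B \<subseteq> S" "indep M B" "\<And>e. e \<in> S - B \<Longrightarrow> \<not> indep M (insert e B)"
  shows "fundamental_circuits (\<C> \<inter> Pow S) S B (fundamental (indep M) S B)"
proof -
  interpret matroid_cycle_space \<C> M by fact
  have indepB: "Z = {}" if "Z \<in> \<C>" "Z \<subseteq> B" for Z
    using that B S indep_iff[of B] by blast
  have fund: "fundamental (indep M) S B e \<in> \<C>" if e: "e \<in> S - B" for e
  proof -
    have "insert e B \<subseteq> ground M" using e B S by blast
    then obtain Z where Z: "Z \<in> \<C>" "Z \<subseteq> insert e B" "Z \<noteq> {}"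
      using B(3)[OF e] indep_iff[of "insert e B"] by blast
    have eZ: "e \<in> Z" using Z indepB[of Z] by blast
    have uniq: "Y = Z" if Y: "Y \<in> \<C>" "Y \<subseteq> insert e B" "Y \<noteq> {}" for Y
    proof -
      have "e \<in> Y" using Y indepB[of Y] by blast
      then have "sym_diff Y Z \<subseteq> B" using eZ Y Z by blast
      then have "sym_diff Y Z = {}" using indepB sym_diff_cycle[OF Y(1) Z(1)] by blast
      then show ?thesis by blast
    qed
    have "indep M (insert e (B - {i})) \<longleftrightarrow> i \<in> Z" if i: "i \<in> B" for i
    proof -
      have sub: "insert e (B - {i}) \<subseteq> ground M" using e B S by blast
      have "(\<forall>Y\<in>\<C>. Y \<subseteq> insert e (B - {i}) \<longrightarrow> Y = {}) \<longleftrightarrow> \<not> Z \<subseteq> insert e (B - {i})"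
      proof
        assume "\<forall>Y\<in>\<C>. Y \<subseteq> insert e (B - {i}) \<longrightarrow> Y = {}"
        then show "\<not> Z \<subseteq> insert e (B - {i})" using Z by blast
      next
        assume "\<not> Z \<subseteq> insert e (B - {i})"
        then show "\<forall>Y\<in>\<C>. Y \<subseteq> insert e (B - {i}) \<longrightarrow> Y = {}"
          using uniq by (metis Diff_subset insert_mono subset_trans)
      qed
      moreover have "Z \<subseteq> insert e (B - {i}) \<longleftrightarrow> i \<notin> Z" using Z e i by blast
      ultimately show ?thesis using indep_iff[OF sub] by blast
    qed
    then have "fundamental (indep M) S B e = Z"
      using e eZ Z(2) by (auto simp: fundamental_def)
    then show ?thesis using Z by simp
  qed
  interpret r: cycle_space "\<C> \<inter> Pow S" by (rule cycle_space_restrict)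
  show ?thesis
  proof
    show "fundamental (indep M) S B e \<in> \<C> \<inter> Pow S" if "e \<in> S - B" for e
      using fund[OF that] that B(1) by (auto simp: fundamental_def)
  qed (use indepB in \<open>auto simp: fundamental_def\<close>)
qed

lemma decide_runs:
  assumes C: "matroid_cycle_space \<C> M" and M: "matroid M" "ground M = {..<n}" and n: "reg s 0 = n"
  shows "runs (indep M) n decide s
    (\<lambda>s'. reg s' 1 = of_bool (matroid_cycle_space.odd_theta_in \<C> (array_set n 0 s)))"
  unfolding decide_def
proof (rule runs_Seq, rule runs_conseq[OF find_basis_runs])
  interpret matroid_cycle_space \<C> M by fact
  define S where "S = array_set n 0 s"
  have S: "S \<subseteq> ground M" using array_set_subset M(2) by (auto simp: S_def)
  fix s1 assume s1: "array_set n 1 s1 \<subseteq> array_set n 0 s \<and> indep M (array_set n 1 s1) \<and>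
    (\<forall>e\<in>array_set n 0 s - array_set n 1 s1. \<not> indep M (insert e (array_set n 1 s1)))"
    "unchanged find_basis s s1"
  define B where "B = array_set n 1 s1"
  have B: "B \<subseteq> S" "indep M B" "\<And>e. e \<in> S - B \<Longrightarrow> \<not> indep M (insert e B)"
    using s1(1) by (auto simp: S_def B_def)
  define F where "F = fundamental (indep M) S B"
  interpret fc: fundamental_circuits "\<C> \<inter> Pow S" S B F
    unfolding F_def by (rule fundamental_circuits_restrict[OF C S B])
  have r1: "reg s1 0 = n" "array_set n 0 s1 = S"
    using unchanged_reg[OF s1(2), of 0] unchanged_array_set[OF s1(2), of 0 n] n by (simp_all add: S_def)
  then have F1: "F = fundamental (indep M) (array_set n 0 s1) (array_set n 1 s1)"
    by (simp add: F_def B_def)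
  have equiv: "equiv UNIV fc.connected"
  proof (rule equivI)
    show "refl fc.connected" by (auto simp: fc.connected_def refl_on_def)
    show "sym fc.connected" using fc.connected_sym by (auto simp: sym_def)
    show "trans fc.connected" using fc.connected_trans by (auto simp: trans_def)
  qed simp
  have conn: "(i, e) \<in> fc.connected" if "i \<in> F e" for i e
  proof -
    have "e \<in> S - B" using that fc.fund_empty by blast
    then show ?thesis using fc.connected_circuit fc.fund_circuit fc.fund_mem that by blast
  qed
  show "runs (indep M) n (Seq find_labels search) s1
    (\<lambda>s'. reg s' 1 = of_bool (odd_theta_in (array_set n 0 s)))"
  proof (rule runs_Seq, rule runs_conseq[OF find_labels_runs[OF r1(1) F1 equiv conn]])
    fix s2 :: state assume s2: "(\<forall>e<n. \<forall>i\<in>F e. arr s2 3 i = arr s2 3 e) \<and>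
      (\<forall>i<n. \<forall>j<n. arr s2 3 i = arr s2 3 j \<longrightarrow> (i, j) \<in> fc.connected)" "unchanged find_labels s1 s2"
    have Sn: "i < n" if "i \<in> S" for i using that S M(2) by auto
    have FS: "e \<in> S" if "i \<in> F e" for i e using that fc.fund_empty by blast
    interpret lf: labelled_fundamental_circuits "\<C> \<inter> Pow S" S B F "arr s2 3"
    proof
      show "arr s2 3 i = arr s2 3 e" if "i \<in> F e" for i e using s2(1) that Sn FS by blast
      show "(i, j) \<in> fc.connected" if "i \<in> S" "j \<in> S" "arr s2 3 i = arr s2 3 j" for i j
        using s2(1) that Sn by blast
    qed
    have less: "e < n" if "F e \<noteq> {}" for e using that Sn FS by blast
    \<comment> \<open>The circuits of a bad triple are nonempty, so its indices lie in
      \<open>S\<close> and a search below \<open>n\<close> misses none.\<close>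
    have "(\<exists>e<n. \<exists>f<n. \<exists>g<n. bad_triple F (arr s2 3) e f g) \<longleftrightarrow> (\<exists>e f g. bad_triple F (arr s2 3) e f g)"
    proof -
      have "e < n \<and> f < n \<and> g < n" if "bad_triple F (arr s2 3) e f g" for e f g
      proof -
        have "F e \<noteq> {}" "F f \<noteq> {}" "F g \<noteq> {}" using that by (auto simp: bad_triple_def)
        then show ?thesis using less by blast
      qed
      then show ?thesis by blast
    qed
    also have "\<dots> \<longleftrightarrow> odd_theta_in S"
      unfolding bad_triple_def lf.ex_odd_theta_iff[symmetric] odd_theta_restrict odd_theta_in_def ..
    finally have iff: "(\<exists>e<n. \<exists>f<n. \<exists>g<n. bad_triple F (arr s2 3) e f g) \<longleftrightarrow> odd_theta_in S" .
    have r2: "reg s2 0 = n" using unchanged_reg[OF s2(2), of 0] r1 by simp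
    have F2: "F = fundamental (indep M) (array_set n 0 s2) (array_set n 1 s2)"
      using unchanged_array_set[OF s2(2), of _ n] F1 by simp
    show "runs (indep M) n search s2 (\<lambda>s'. reg s' 1 = of_bool (odd_theta_in (array_set n 0 s)))"
      using search_runs[OF r2 F2] unfolding iff S_def .
  qed
qed (use n M(1) in \<open>auto simp: matroid_def\<close>)

text \<open>Containing an odd theta is monotone, so an element that could not be deleted stays
  indispensable when the set shrinks further. At the end every remaining element is indispensable,
  hence lies in any odd theta inside the set, and the set is that theta.\<close>

lemma find_odd_C3_plus_runs:
  fixes n :: nat
  assumes C: "matroid_cycle_space \<C> M" and M: "matroid M" "ground M = {..<n}"
  shows "runs (indep M) n find_odd_C3_plus (input_state n) (\<lambda>s.
    case result_of n s of None \<Rightarrow> odd_C3_plus_free M | Some X \<Rightarrow> is_odd_C3_plus_of X M)"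
    (is "runs _ _ _ _ ?Q")
proof -
  interpret matroid_cycle_space \<C> M by fact
  let ?D = odd_theta_in and ?S = "array_set n 0"
  have D_mono: "?D T" if "?D S" "S \<subseteq> T" for S T using that unfolding odd_theta_in_def by blast
  let ?del = "Seq (Store 0 (Reg 14) (Const 0)) (Seq decide
        (Cond (Eq (Reg 1) (Const 0)) (Store 0 (Reg 14) (Const 1)) Skip))"
  show ?thesis
    unfolding find_odd_C3_plus_def
  proof (rule runs_Seq, rule runs_For[where I = "\<lambda>k s. {..<k} \<subseteq> ?S s"])
    fix s1 assume s1: "reg s1 0 = n" "{..<n} \<subseteq> ?S s1"
    have S1: "?S s1 = {..<n}" using s1(2) array_set_subset by blast
    show "runs (indep M) n (Seq decide (Cond (Eq (Reg 1) (Const 0)) (Assign 0 (Const 0))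
       (Seq (For 14 ?del) (Assign 0 (Const 1))))) s1 ?Q"
    proof (rule runs_Seq, rule runs_conseq[OF decide_runs[OF C M s1(1)]])
      fix s2 :: state assume s2: "reg s2 1 = of_bool (?D (?S s1))" "unchanged decide s1 s2"
      have r2: "reg s2 0 = n" "?S s2 = {..<n}"
        using unchanged_reg[OF s2(2), of 0] unchanged_array_set[OF s2(2), of 0 n] s1(1) S1 by simp_all
      show "runs (indep M) n (Cond (Eq (Reg 1) (Const 0)) (Assign 0 (Const 0))
       (Seq (For 14 ?del) (Assign 0 (Const 1)))) s2 ?Q"
      proof (rule runs_Cond)
        assume "bval (Eq (Reg 1) (Const 0)) s2"
        then have no: "\<not> ?D {..<n}" using s2(1) S1 by (auto split: if_splits)
        have "odd_C3_plus_free M"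
          unfolding odd_C3_plus_free_def
        proof
          assume "\<exists>X. is_odd_C3_plus_of X M"
          then obtain X A B P where "X \<subseteq> ground M" "odd_theta A B P" "X = A \<union> B \<union> P"
            using theta_of_odd_C3_plus by (metis is_odd_C3_plus_of_def)
          then have "?D {..<n}" unfolding odd_theta_in_def using M(2) by blast
          then show False using no by blast
        qed
        then show "runs (indep M) n (Assign 0 (Const 0)) s2 ?Q"
          by (intro runs_Assign) (simp add: result_of_def)
      next
        assume "\<not> bval (Eq (Reg 1) (Const 0)) s2"
        then have yes: "?D {..<n}" using s2(1) S1 by (auto split: if_splits)
        define I where "I k s \<longleftrightarrow> ?D (?S s) \<and> {k..<n} \<subseteq> ?S s \<and> (\<forall>i\<in>?S s. i < k \<longrightarrow> \<not> ?D (?S s - {i}))" for k s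
        show "runs (indep M) n (Seq (For 14 ?del) (Assign 0 (Const 1))) s2 ?Q"
        proof (rule runs_Seq, rule runs_For[where I = I])
          fix k s3 assume k: "k < n" "reg s3 14 = k" "reg s3 0 = n" and I: "I k s3"
          let ?T = "?S s3"
          define s4 where "s4 = set_arr 0 k 0 s3"
          have S4: "?S s4 = ?T - {k}" using k by (simp add: s4_def)
          have kT: "k \<in> ?T" using I k by (auto simp: I_def)
          have "runs (indep M) n (Seq decide (Cond (Eq (Reg 1) (Const 0)) (Store 0 (Reg 14) (Const 1)) Skip)) s4
            (\<lambda>s. I (Suc k) (set_reg 14 (Suc k) s))"
          proof (rule runs_Seq, rule runs_conseq[OF decide_runs[OF C M]])
            show "reg s4 0 = n" using k by (simp add: s4_def)
            fix s5 :: state assume s5: "reg s5 1 = of_bool (?D (?S s4))" "unchanged decide s4 s5"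
            have r5: "reg s5 14 = k" "?S s5 = ?T - {k}"
              using unchanged_reg[OF s5(2), of 14] unchanged_array_set[OF s5(2), of 0 n] k S4
              by (simp_all add: s4_def)
            have ins: "insert k (?T - {k}) = ?T" using kT by blast
            have keep: "I (Suc k) t" if "?S t = ?T" "\<not> ?D (?T - {k})" for t
              using I that unfolding I_def by (auto simp: less_Suc_eq)
            have del: "I (Suc k) t" if t: "?S t = ?T - {k}" "?D (?T - {k})" for t
            proof -
              \<comment> \<open>An odd theta in this set would also be one in
                \<open>?T - {i}\<close>, where the invariant excludes it.\<close>
              have "\<not> ?D (?T - {k} - {i})" if "i \<in> ?T" "i < k" for i
                using I that D_mono[of "?T - {k} - {i}" "?T - {i}"] by (auto simp: I_def)
              then show ?thesis using I t by (auto simp: I_def less_Suc_eq)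
            qed
            show "runs (indep M) n (Cond (Eq (Reg 1) (Const 0)) (Store 0 (Reg 14) (Const 1)) Skip) s5
              (\<lambda>s. I (Suc k) (set_reg 14 (Suc k) s))"
            proof (rule runs_Cond)
              assume "bval (Eq (Reg 1) (Const 0)) s5"
              then have "\<not> ?D (?T - {k})" using s5(1) S4 by (auto split: if_splits)
              then show "runs (indep M) n (Store 0 (Reg 14) (Const 1)) s5
                  (\<lambda>s. I (Suc k) (set_reg 14 (Suc k) s))"
                using k r5 ins by (intro runs_Store keep) simp_all
            next
              assume "\<not> bval (Eq (Reg 1) (Const 0)) s5"
              then have "?D (?T - {k})" using s5(1) S4 by (auto split: if_splits)
              then show "runs (indep M) n Skip s5 (\<lambda>s. I (Suc k) (set_reg 14 (Suc k) s))"
                using r5 by (intro runs_Skip del) simp_all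
            qed
          qed
          then show "runs (indep M) n ?del s3 (\<lambda>s. I (Suc k) (set_reg 14 (Suc k) s))"
            using k by (intro runs_Seq[of _ _ "Store 0 _ _"] runs_Store) (simp add: s4_def)
        next
          fix s3 assume I: "I n s3"
          let ?T = "?S s3"
          obtain A B P where th: "odd_theta A B P" "A \<union> B \<union> P \<subseteq> ?T"
            using I unfolding I_def odd_theta_in_def by (elim conjE exE)
          have "?T \<subseteq> A \<union> B \<union> P"
          proof
            fix i assume i: "i \<in> ?T"
            then have "i < n" using array_set_subset by blast
            then have "\<not> ?D (?T - {i})" using I i by (simp add: I_def)
            then show "i \<in> A \<union> B \<union> P" using th unfolding odd_theta_in_def by blast
          qed
          then have "?T = A \<union> B \<union> P" using th(2) by (rule subset_antisym)
          then have "is_odd_C3_plus_of ?T M" by (rule odd_C3_plus_of_theta[OF C th(1)])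
          then show "runs (indep M) n (Assign 0 (Const 1)) s3 ?Q"
            by (intro runs_Assign) (simp add: result_of_def)
        qed (use r2 yes in \<open>simp_all add: I_def atLeast0LessThan\<close>)
      qed
    qed
  next
    fix k s assume "k < n" "reg s 14 = k" "{..<k} \<subseteq> ?S s"
    then show "runs (indep M) n (Store 0 (Reg 14) (Const 1)) s
        (\<lambda>s'. {..<Suc k} \<subseteq> ?S (set_reg 14 (Suc k) s'))"
      by (intro runs_Store) (auto simp: lessThan_Suc)
  qed (auto simp: input_state_def)
qed

theorem theorem2p7:
  shows "\<exists>(c :: com) (time_bound :: nat poly) (call_bound :: nat poly).
    \<forall>(n :: nat) (M :: nat pre_matroid).
      binary_matroid M \<and> loopless M \<and> ground M = {..<n} \<longrightarrow>
      (\<exists>t q s. exec (indep M) n c (input_state n) t q s \<and>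
         t \<le> poly time_bound n \<and> q \<le> poly call_bound n \<and>
         (case result_of n s of
            None \<Rightarrow> odd_C3_plus_free M
          | Some X \<Rightarrow> is_odd_C3_plus_of X M))"
proof -
  obtain p where p: "\<And>n. cost n find_odd_C3_plus = poly p n" using cost_poly by blast
  show ?thesis
  \<comment> \<open>One polynomial serves as both bounds, because calls never outnumber
    steps.\<close>
  proof (intro exI[of _ find_odd_C3_plus] exI[of _ p] allI impI)
    fix n and M :: "nat pre_matroid"
    assume M: "binary_matroid M \<and> loopless M \<and> ground M = {..<n}"
    then obtain \<C> where "matroid_cycle_space \<C> M" using binary_matroid_cycle_space by blast
    moreover have "matroid M" using M by (simp add: binary_matroid_def)
    ultimately obtain t q s where "exec (indep M) n find_odd_C3_plus (input_state n) t q s"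
      "t \<le> poly p n" "case result_of n s of None \<Rightarrow> odd_C3_plus_free M | Some X \<Rightarrow> is_odd_C3_plus_of X M"
      using find_odd_C3_plus_runs[of \<C> M n] M p unfolding runs_def by auto
    moreover from this have "q \<le> poly p n" using exec_calls_le_time order_trans by blast
    ultimately show "\<exists>t q s. exec (indep M) n find_odd_C3_plus (input_state n) t q s \<and>
         t \<le> poly p n \<and> q \<le> poly p n \<and>
         (case result_of n s of None \<Rightarrow> odd_C3_plus_free M | Some X \<Rightarrow> is_odd_C3_plus_of X M)" by blast
  qed
qed

end
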